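(* Let $f\in\mathbb{K}$, and let $U$ be a simply connected Baker domain of $f$, of hyperbolic or simply parabolic type. Then $f|_{\partial U}$ is non-ergodic and non-recurrent with respect to the harmonic measure $\omega_U$.
   Context: **Class $\mathbb{K}$.** $f\in\mathbb{K}$ if there is a compact countable set $E(f)\subset\widehat{\mathbb{C}}$ such that $f\colon\Omega(f)\to\widehat{\mathbb{C}}$ is meromorphic in $\Omega(f):=\widehat{\mathbb{C}}\setminus E(f)$ but in no larger set. The Fatou set $\mathcal{F}(f)$ is the set of points having a neighbourhood in which all iterates $f^n$ are defined and form a normal family; its connected components are the Fatou components. **Baker domain.** A Baker domain is an invariant Fatou component $U$ in which the iterates converge, uniformly on compact sets, to an essential singularity of $f$; conjugating by a Möbius transformation, this singularity is assumed to be $\infty$. **Boundary.** $\partial U$ denotes the boundary of $U$ taken in $\Omega(f)$. **Associated inner function and type.** For a simply connected Baker domain $U$ and a Riemann map $\varphi\colon\mathbb{D}\to U$, the inner function associated with $f|_U$ is $g:=\varphi^{-1}\circ f\circ\varphi\colon\mathbb{D}\to\mathbb{D}$ (unique up to conjugation by automorphisms of $\mathbb{D}$). It has a Denjoy–Wolff point $p\in\partial\mathbb{D}$, to which all $g$-orbits in $\mathbb{D}$ converge. By Cowen's theorem there are a simply connected domain $V\subset\mathbb{D}$, a domain $\Omega$ equal to $\mathbb{C}$ or to $\mathbb{H}=\{\mathrm{Im}\, z>0\}$, a holomorphic map $\psi\colon\mathbb{D}\to\Omega$ and a Möbius transformation $T\colon\Omega\to\Omega$ such that: $V$ is absorbing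 for $g$ in $\mathbb{D}$ (that is, $g(V)\subset V$ and for every compact $K\subset\mathbb{D}$ there is $n\ge 0$ with $g^n(K)\subset V$), $\psi(V)$ is absorbing for $T$ in $\Omega$, $\psi\circ g=T\circ\psi$ in $\mathbb{D}$, and $\psi$ is univalent in $V$. Here $\Omega$ and $T$ depend only on $g$ and, up to conjugating $T$ by a Möbius transformation preserving $\Omega$, exactly one case holds: $\Omega=\mathbb{C}$, $T(z)=z+1$ (doubly parabolic); $\Omega=\mathbb{H}$, $T(z)=\lambda z$ with $\lambda>1$ (hyperbolic); $\Omega=\mathbb{H}$, $T(z)=z\pm1$ (simply parabolic). The type of $U$ is the type of $g$. **Harmonic measure.** $\omega_U$ is the push-forward, under the radial extension $\varphi^*$ of a Riemann map $\varphi\colon\mathbb{D}\to U$, of normalized Lebesgue measure on $\partial\mathbb{D}$, considered on the Borel sets of $\partial U$; its null sets do not depend on the choice of $\varphi$. The map $f|_{\partial U}\colon\partial U\to\partial U$ is defined $\omega_U$-almost everywhere. **Ergodicity, recurrence.** Let $(X,\mathcal{A},\mu)$ be a measure space and $T\colon X\to X$ measurable (not necessarily measure-preserving). $T$ is ergodic if it is non-singular and every $A\in\mathcal{A}$ with $T^{-1}(A)=A$ satisfies $\mu(A)=0$ or $\mu(X\setminus A)=0$. $T$ is recurrent if for every $A\in\mathcal{A}$ and $\mu$-almost every $x\in A$ there is a sequence $n_k\to\infty$ with $T^{n_k}(x)\in A$. Non-ergodic and non-recurrent are the negations. *)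

theory Defs
  imports "HOL-Analysis.Analysis" "HOL-Complex_Analysis.Complex_Analysis"
begin

section \<open>The Riemann sphere\<close>

datatype riemann_sphere = Fin (fin_part: complex) | Infty
where "fin_part Infty = 0"

text \<open>Inverse stereographic projection onto the unit sphere of \<open>complex \<times> real\<close>,
  a copy of Euclidean 3-space. The metric is the chordal one.\<close>

fun stereo :: "riemann_sphere \<Rightarrow> complex \<times> real" where
  "stereo (Fin z) = ((2 / (1 + (norm z)\<^sup>2)) *\<^sub>R z, ((norm z)\<^sup>2 - 1) / (1 + (norm z)\<^sup>2))"
| "stereo Infty = (0, 1)"

lemma one_plus_norm_sq_pos: "0 < 1 + (norm (z::complex))\<^sup>2"
  by (simp add: add_pos_nonneg)

lemma one_minus_snd_stereo: "1 - snd (stereo (Fin z)) = 2 / (1 + (norm z)\<^sup>2)"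
  using one_plus_norm_sq_pos[of z] by (simp add: field_simps)

lemma snd_stereo_Fin_neq_1: "snd (stereo (Fin z)) \<noteq> 1"
  using one_minus_snd_stereo[of z] one_plus_norm_sq_pos[of z] by auto

lemma fin_part_stereo:
  "x \<noteq> Infty \<Longrightarrow> fin_part x = fst (stereo x) /\<^sub>R (1 - snd (stereo x))"
proof (cases x)
  case (Fin z)
  have "inverse (2 / (1 + (norm z)\<^sup>2)) * (2 / (1 + (norm z)\<^sup>2)) = 1"
    using one_plus_norm_sq_pos[of z] by (intro left_inverse) auto
  then show ?thesis
    unfolding Fin one_minus_snd_stereo by (simp only: stereo.simps fst_conv scaleR_scaleR riemann_sphere.sel scaleR_one)
qed simp

lemma inj_stereo: "inj stereo"
proof (rule injI)
  fix x y assume eq: "stereo x = stereo y"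
  show "x = y"
  proof (cases x; cases y)
    fix z w assume x: "x = Fin z" and y: "y = Fin w"
    have "fin_part x = fin_part y"
      using fin_part_stereo[of x] fin_part_stereo[of y] eq x y
      by (metis riemann_sphere.distinct(1))
    then show ?thesis using x y by simp
  next
    fix z assume "x = Fin z" "y = Infty"
    then show ?thesis using eq snd_stereo_Fin_neq_1[of z] by (metis snd_conv stereo.simps(2))
  next
    fix z assume "x = Infty" "y = Fin z"
    then show ?thesis using eq snd_stereo_Fin_neq_1[of z] by (metis snd_conv stereo.simps(2))
  qed simp
qed

instantiation riemann_sphere :: metric_space
begin

definition dist_riemann_sphere :: "riemann_sphere \<Rightarrow> riemann_sphere \<Rightarrow> real" where
  "dist_riemann_sphere x y = dist (stereo x) (stereo y)"

definition uniformity_riemann_sphere :: "(riemann_sphere \<times> riemann_sphere) filter" where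
  "uniformity_riemann_sphere = (INF e\<in>{0<..}. principal {(x, y). dist x y < e})"

definition open_riemann_sphere :: "riemann_sphere set \<Rightarrow> bool" where
  "open_riemann_sphere S \<longleftrightarrow> (\<forall>x\<in>S. \<forall>\<^sub>F (x', y) in uniformity. x' = x \<longrightarrow> y \<in> S)"

instance
proof
  fix x y z :: riemann_sphere
  show "dist x y = 0 \<longleftrightarrow> x = y"
    by (simp add: dist_riemann_sphere_def inj_eq[OF inj_stereo])
  show "dist x y \<le> dist x z + dist y z"
    unfolding dist_riemann_sphere_def by (rule dist_triangle2)
qed (rule uniformity_riemann_sphere_def open_riemann_sphere_def)+

end

lemma dist_Fin_Infty: "dist (Fin z) Infty = 2 / sqrt (1 + (norm z)\<^sup>2)"
proof -
  let ?s = "1 + (norm z)\<^sup>2"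
  have p: "?s > 0" by (rule one_plus_norm_sq_pos)
  have "(2 * norm z / ?s)\<^sup>2 + (((norm z)\<^sup>2 - 1) / ?s - 1)\<^sup>2 = (4 * (norm z)\<^sup>2 + 4) / ?s\<^sup>2"
  proof -
    have "((norm z)\<^sup>2 - 1) / ?s - 1 = - 2 / ?s" using p by (simp add: field_simps)
    then show ?thesis by (simp add: power_divide power_mult_distrib add_divide_distrib)
  qed
  also have "\<dots> = 4 / ?s"
    using p by (simp add: power2_eq_square divide_simps)
  finally show ?thesis
    by (simp add: dist_riemann_sphere_def dist_prod_def dist_real_def real_sqrt_divide
        power2_commute[of 1 "_ / _"])
qed

lemma continuous_Fin: "isCont Fin z"
proof -
  have "((\<lambda>w. stereo (Fin w)) \<longlongrightarrow> stereo (Fin z)) (at z)"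
    unfolding stereo.simps
    by (intro tendsto_intros) (use one_plus_norm_sq_pos[of z] in linarith)+
  then show ?thesis
    unfolding isCont_def tendsto_iff[of Fin] tendsto_iff[of "\<lambda>w. stereo (Fin w)"]
    by (simp add: dist_riemann_sphere_def)
qed

lemma continuous_fin_part: "isCont fin_part (Fin z)"
proof -
  have st: "(stereo \<longlongrightarrow> stereo (Fin z)) (at (Fin z))"
    unfolding tendsto_iff dist_riemann_sphere_def[symmetric]
    by (auto simp: eventually_at)
  have "((\<lambda>x. fst (stereo x) /\<^sub>R (1 - snd (stereo x)))
      \<longlongrightarrow> fst (stereo (Fin z)) /\<^sub>R (1 - snd (stereo (Fin z)))) (at (Fin z))"
    using snd_stereo_Fin_neq_1[of z]
    by (intro tendsto_scaleR tendsto_inverse tendsto_diff tendsto_const tendsto_fst tendsto_snd st)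
      (simp del: stereo.simps)
  moreover have "\<forall>\<^sub>F x in at (Fin z). x \<noteq> Infty"
    by (simp add: eventually_at) (metis dist_commute less_irrefl zero_less_dist_iff riemann_sphere.distinct(1))
  then have "\<forall>\<^sub>F x in at (Fin z). fst (stereo x) /\<^sub>R (1 - snd (stereo x)) = fin_part x"
    by eventually_elim (simp add: fin_part_stereo)
  ultimately have "(fin_part \<longlongrightarrow> fst (stereo (Fin z)) /\<^sub>R (1 - snd (stereo (Fin z)))) (at (Fin z))"
    by (rule Lim_transform_eventually)
  then show ?thesis
    using fin_part_stereo[of "Fin z"] by (simp add: isCont_def)
qed

text \<open>The topology is that of the one-point compactification of the plane.\<close>

lemma open_riemann_sphere_iff:
  "open (S :: riemann_sphere set) \<longleftrightarrow>
     open (Fin -` S) \<and> (Infty \<in> S \<longrightarrow> compact (- (Fin -` S)))"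
proof (intro iffI conjI impI)
  assume S: "open S"
  show "open (Fin -` S)"
    by (rule open_vimage[OF S]) (simp add: continuous_on_eq_continuous_at continuous_Fin)
next
  assume S: "open S" and "Infty \<in> S"
  then have op: "open (Fin -` S)"
    by (intro open_vimage) (simp_all add: continuous_on_eq_continuous_at continuous_Fin)
  obtain e where e: "e > 0" "\<And>x. dist x Infty < e \<Longrightarrow> x \<in> S"
    using S \<open>Infty \<in> S\<close> unfolding open_dist by blast
  have "norm z \<le> 2 / e" if "z \<in> - (Fin -` S)" for z
  proof -
    have "e \<le> 2 / sqrt (1 + (norm z)\<^sup>2)"
      using e(2)[of "Fin z"] that by (force simp: dist_Fin_Infty)
    moreover have "norm z \<le> sqrt (1 + (norm z)\<^sup>2)" by (simp add: real_le_rsqrt)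
    moreover have "0 < sqrt (1 + (norm z)\<^sup>2)" using one_plus_norm_sq_pos by simp
    ultimately have "e * sqrt (1 + (norm z)\<^sup>2) \<le> 2" by (simp add: field_simps)
    moreover have "e * norm z \<le> e * sqrt (1 + (norm z)\<^sup>2)"
      using \<open>norm z \<le> _\<close> e(1) by (intro mult_left_mono) auto
    ultimately have "e * norm z \<le> 2" by linarith
    then show ?thesis using e(1) by (simp add: field_simps)
  qed
  then show "compact (- (Fin -` S))"
    using op by (auto simp: compact_eq_bounded_closed bounded_iff)
next
  assume *: "open (Fin -` S) \<and> (Infty \<in> S \<longrightarrow> compact (- (Fin -` S)))"
  then have S: "open (Fin -` S)" and I: "Infty \<in> S \<longrightarrow> compact (- (Fin -` S))" by auto
  show "open S"
    unfolding open_dist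
  proof
    fix x assume x: "x \<in> S"
    show "\<exists>e>0. \<forall>y. dist y x < e \<longrightarrow> y \<in> S"
    proof (cases x)
      case (Fin z)
      have "\<forall>\<^sub>F y in at (Fin z). fin_part y \<in> Fin -` S"
        using continuous_fin_part[of z] S x Fin
        unfolding isCont_def by (intro topological_tendstoD[where l = z]) auto
      then obtain d where d: "d > 0"
        "\<And>y. y \<noteq> Fin z \<Longrightarrow> dist y (Fin z) < d \<Longrightarrow> Fin (fin_part y) \<in> S"
        by (auto simp: eventually_at)
      let ?d = "min d (dist (Fin z) Infty)"
      have "y \<in> S" if "dist y x < ?d" for y
      proof (cases "y = x")
        case False
        moreover have "y \<noteq> Infty" using that Fin by (auto simp: dist_commute)
        then have "Fin (fin_part y) = y" by (cases y) auto
        ultimately show ?thesis using d(2)[of y] that Fin by auto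
      qed (use x in simp)
      moreover have "?d > 0" using d(1) by simp
      ultimately show ?thesis by blast
    next
      case Infty
      then have "bounded (- (Fin -` S))" using I x compact_imp_bounded by blast
      then obtain B where B: "B > 0" "\<And>z. Fin z \<notin> S \<Longrightarrow> norm z \<le> B"
        by (auto simp: bounded_pos)
      let ?d = "2 / sqrt (1 + B\<^sup>2)"
      have "y \<in> S" if "dist y x < ?d" for y
      proof (cases y)
        case (Fin z)
        show ?thesis
        proof (rule ccontr)
          assume "y \<notin> S"
          then have "norm z \<le> B" using B(2) Fin by blast
          then have "sqrt (1 + (norm z)\<^sup>2) \<le> sqrt (1 + B\<^sup>2)" by (simp add: power_mono)
          then have "?d \<le> 2 / sqrt (1 + (norm z)\<^sup>2)"
            using one_plus_norm_sq_pos[of z] by (intro divide_left_mono) (auto simp: add_pos_nonneg)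
          then show False using that Fin Infty by (simp add: dist_Fin_Infty)
        qed
      qed (use x Infty in simp)
      moreover have "?d > 0" by (simp add: add_pos_nonneg)
      ultimately show ?thesis by blast
    qed
  qed
qed

fun sphere_recip :: "riemann_sphere \<Rightarrow> riemann_sphere" where
  "sphere_recip (Fin z) = (if z = 0 then Infty else Fin (1 / z))"
| "sphere_recip Infty = Fin 0"


section \<open>Meromorphic functions and the class K\<close>

text \<open>The library's notion of meromorphy ignores the values at isolated points; continuity as a map
  into the sphere makes \<open>h\<close> take the right value there (in particular \<open>Infty\<close> at the poles).
  The last clause rules out \<open>h\<close> being identically \<open>Infty\<close> near a point, which
  \<open>fin_part \<circ> h\<close> cannot tell from the zero function.\<close>

definition sphere_meromorphic_on :: "(complex \<Rightarrow> riemann_sphere) \<Rightarrow> complex set \<Rightarrow> bool" where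
  "sphere_meromorphic_on h S \<longleftrightarrow>
     continuous_on S h \<and> (\<lambda>z. fin_part (h z)) meromorphic_on S \<and>
     (\<forall>z\<in>S. \<exists>\<^sub>F w in at z. h w \<noteq> Infty)"

text \<open>Meromorphic functions on an open subset of the sphere, read in the two charts
  \<open>z\<close> and \<open>1 / z\<close> of the source.\<close>

definition meromorphic_in :: "(riemann_sphere \<Rightarrow> riemann_sphere) \<Rightarrow> riemann_sphere set \<Rightarrow> bool" where
  "meromorphic_in f W \<longleftrightarrow> open W \<and>
     sphere_meromorphic_on (\<lambda>z. f (Fin z)) {z. Fin z \<in> W} \<and>
     sphere_meromorphic_on (\<lambda>z. f (sphere_recip (Fin z))) {z. sphere_recip (Fin z) \<in> W}"

text \<open>A function defined on \<open>- E\<close> is represented by a total one; its values on the set \<open>E\<close> of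
  singularities are irrelevant everywhere below.\<close>

definition class_K :: "(riemann_sphere \<Rightarrow> riemann_sphere) \<Rightarrow> riemann_sphere set \<Rightarrow> bool" where
  "class_K f E \<longleftrightarrow> compact E \<and> countable E \<and> meromorphic_in f (- E) \<and>
     \<not> (\<exists>W h. - E \<subset> W \<and> meromorphic_in h W \<and> (\<forall>x\<in>- E. h x = f x))"


section \<open>Fatou set and Baker domains\<close>

definition normal_family_on :: "('a::topological_space \<Rightarrow> 'b::metric_space) set \<Rightarrow> 'a set \<Rightarrow> bool" where
  "normal_family_on \<F> W \<longleftrightarrow>
     (\<forall>s :: nat \<Rightarrow> 'a \<Rightarrow> 'b. range s \<subseteq> \<F> \<longrightarrow>
        (\<exists>r l. strict_mono r \<and>
           (\<forall>K. compact K \<and> K \<subseteq> W \<longrightarrow> uniform_limit K (s \<circ> r) l sequentially)))"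

text \<open>All iterates are defined at \<open>w\<close> iff the orbit of \<open>w\<close> never enters \<open>E\<close>.\<close>

definition fatou_set :: "(riemann_sphere \<Rightarrow> riemann_sphere) \<Rightarrow> riemann_sphere set \<Rightarrow> riemann_sphere set" where
  "fatou_set f E = {z. \<exists>W. open W \<and> z \<in> W \<and>
     (\<forall>w\<in>W. \<forall>n. (f ^^ n) w \<notin> E) \<and> normal_family_on (range (\<lambda>n. f ^^ n)) W}"

text \<open>Every point of \<open>E\<close> is an essential singularity of a function in the class K. The
  singularity is not normalized to be \<open>Infty\<close>.\<close>

definition baker_domain ::
  "(riemann_sphere \<Rightarrow> riemann_sphere) \<Rightarrow> riemann_sphere set \<Rightarrow> riemann_sphere set \<Rightarrow> bool" where
  "baker_domain f E U \<longleftrightarrow> U \<in> components (fatou_set f E) \<and> f ` U \<subseteq> U \<and>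
     (\<exists>e\<in>E. \<forall>K. compact K \<and> K \<subseteq> U \<longrightarrow> uniform_limit K (\<lambda>n. f ^^ n) (\<lambda>_. e) sequentially)"


section \<open>Associated inner function and type\<close>

abbreviation unit_disc :: "complex set" where "unit_disc \<equiv> ball 0 1"

definition upper_half_plane :: "complex set" where
  "upper_half_plane = {z. 0 < Im z}"

definition riemann_map :: "(complex \<Rightarrow> riemann_sphere) \<Rightarrow> riemann_sphere set \<Rightarrow> bool" where
  "riemann_map \<phi> U \<longleftrightarrow> sphere_meromorphic_on \<phi> unit_disc \<and> bij_betw \<phi> unit_disc U"

definition inner_function ::
  "(riemann_sphere \<Rightarrow> riemann_sphere) \<Rightarrow> (complex \<Rightarrow> riemann_sphere) \<Rightarrow> complex \<Rightarrow> complex" where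
  "inner_function f \<phi> = inv_into unit_disc \<phi> \<circ> f \<circ> \<phi>"

definition absorbing :: "(complex \<Rightarrow> complex) \<Rightarrow> complex set \<Rightarrow> complex set \<Rightarrow> bool" where
  "absorbing g D V \<longleftrightarrow> V \<subseteq> D \<and> g ` V \<subseteq> V \<and>
     (\<forall>K. compact K \<and> K \<subseteq> D \<longrightarrow> (\<exists>n. (g ^^ n) ` K \<subseteq> V))"

text \<open>Cowen's semiconjugacy of \<open>g\<close> to \<open>T\<close> on \<open>D\<close>. The Moebius transformation \<open>T\<close> is used in
  normal form below: a Moebius transformation preserving \<open>D\<close> that conjugates \<open>T\<close> to its normal
  form is absorbed into \<open>\<psi>\<close>.\<close>

definition cowen_model ::
  "(complex \<Rightarrow> complex) \<Rightarrow> complex set \<Rightarrow> complex set \<Rightarrow> (complex \<Rightarrow> complex) \<Rightarrow> (complex \<Rightarrow> complex) \<Rightarrow> bool" where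
  "cowen_model g V D \<psi> T \<longleftrightarrow>
     open V \<and> simply_connected V \<and> absorbing g unit_disc V \<and>
     \<psi> holomorphic_on unit_disc \<and> \<psi> ` unit_disc \<subseteq> D \<and> absorbing T D (\<psi> ` V) \<and>
     (\<forall>z\<in>unit_disc. \<psi> (g z) = T (\<psi> z)) \<and> inj_on \<psi> V"

definition hyperbolic :: "(complex \<Rightarrow> complex) \<Rightarrow> bool" where
  "hyperbolic g \<longleftrightarrow>
     (\<exists>V \<psi> c. 1 < c \<and> cowen_model g V upper_half_plane \<psi> (\<lambda>z. complex_of_real c * z))"

definition simply_parabolic :: "(complex \<Rightarrow> complex) \<Rightarrow> bool" where
  "simply_parabolic g \<longleftrightarrow>
     (\<exists>V \<psi>. cowen_model g V upper_half_plane \<psi> (\<lambda>z. z + 1) \<or>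
            cowen_model g V upper_half_plane \<psi> (\<lambda>z. z - 1))"

definition hyperbolic_type :: "(riemann_sphere \<Rightarrow> riemann_sphere) \<Rightarrow> riemann_sphere set \<Rightarrow> bool" where
  "hyperbolic_type f U \<longleftrightarrow> (\<exists>\<phi>. riemann_map \<phi> U \<and> hyperbolic (inner_function f \<phi>))"

definition simply_parabolic_type :: "(riemann_sphere \<Rightarrow> riemann_sphere) \<Rightarrow> riemann_sphere set \<Rightarrow> bool" where
  "simply_parabolic_type f U \<longleftrightarrow> (\<exists>\<phi>. riemann_map \<phi> U \<and> simply_parabolic (inner_function f \<phi>))"


section \<open>Harmonic measure\<close>

definition circle_measure :: "complex measure" where
  "circle_measure =
     distr (uniform_measure lborel {0..<2 * pi}) (restrict_space borel (sphere 0 1)) cis"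

text \<open>Where the radial limit does not exist (a Lebesgue null set of directions for a Riemann map)
  this has one fixed arbitrary value.\<close>

definition radial_extension :: "(complex \<Rightarrow> riemann_sphere) \<Rightarrow> complex \<Rightarrow> riemann_sphere" where
  "radial_extension \<phi> \<zeta> = Lim (at_left 1) (\<lambda>r. \<phi> (complex_of_real r * \<zeta>))"

text \<open>The boundary of \<open>U\<close> is taken in the domain \<open>- E\<close> of \<open>f\<close>, not in the sphere.\<close>

definition boundary :: "riemann_sphere set \<Rightarrow> riemann_sphere set \<Rightarrow> riemann_sphere set" where
  "boundary E U = frontier U - E"

definition harmonic_measure ::
  "riemann_sphere set \<Rightarrow> riemann_sphere set \<Rightarrow> (complex \<Rightarrow> riemann_sphere) \<Rightarrow> riemann_sphere measure" where
  "harmonic_measure E U \<phi> =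
     restrict_space (distr circle_measure borel (radial_extension \<phi>)) (boundary E U)"

text \<open>On the boundary \<open>f\<close> is a self-map only almost everywhere: countably many points are mapped
  into \<open>E\<close>. The points all of whose iterates stay in the boundary form a set of full measure
  which \<open>f\<close> maps into itself.\<close>

definition boundary_space ::
  "(riemann_sphere \<Rightarrow> riemann_sphere) \<Rightarrow> riemann_sphere set \<Rightarrow> riemann_sphere set \<Rightarrow>
   (complex \<Rightarrow> riemann_sphere) \<Rightarrow> riemann_sphere measure" where
  "boundary_space f E U \<phi> =
     restrict_space (harmonic_measure E U \<phi>) {x. \<forall>n. (f ^^ n) x \<in> boundary E U}"


section \<open>Ergodicity and recurrence\<close>

text \<open>These notions are meant for measurable \<open>T\<close> from \<open>M\<close> to \<open>M\<close>. Measurability is not part of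
  the definitions, so that the negations do not hold merely for lack of it.\<close>

definition nonsingular :: "'a measure \<Rightarrow> ('a \<Rightarrow> 'a) \<Rightarrow> bool" where
  "nonsingular M T \<longleftrightarrow> (\<forall>A\<in>sets M. emeasure M A = 0 \<longrightarrow> emeasure M (T -` A \<inter> space M) = 0)"

definition ergodic :: "'a measure \<Rightarrow> ('a \<Rightarrow> 'a) \<Rightarrow> bool" where
  "ergodic M T \<longleftrightarrow> nonsingular M T \<and>
     (\<forall>A\<in>sets M. T -` A \<inter> space M = A \<longrightarrow> emeasure M A = 0 \<or> emeasure M (space M - A) = 0)"

definition recurrent :: "'a measure \<Rightarrow> ('a \<Rightarrow> 'a) \<Rightarrow> bool" where
  "recurrent M T \<longleftrightarrow>
     (\<forall>A\<in>sets M. AE x in M. x \<in> A \<longrightarrow>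
        (\<exists>n :: nat \<Rightarrow> nat. filterlim n at_top sequentially \<and> (\<forall>k. (T ^^ n k) x \<in> A)))"

end

theory Submission
  imports Defs
begin

text \<open>
  Let \<open>g\<close> be the inner function with \<open>\<phi> \<circ> g = f \<circ> \<phi>\<close>. In the hyperbolic and simply parabolic cases
  there is a holomorphic map \<open>\<psi>\<close> of the disc into the upper half-plane with \<open>\<psi> \<circ> g = \<psi> + s\<close>, where
  \<open>s\<close> is \<open>1\<close> or \<open>-1\<close>: in the hyperbolic case take a multiple of the logarithm of Cowen's map
  (\<open>translation_model\<close>). The boundary values of \<open>\<psi>\<close> exist almost everywhere and are translated by the boundary map of \<open>g\<close>, so no orbit returns
  infinitely often to a set on which \<open>Re \<psi>\<close> is bounded. Moreover \<open>u = exp (2 \<pi> \<i> \<psi>)\<close> is a bounded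
  \<open>g\<close>-invariant function, and its boundary values are an invariant function on the circle that is
  not essentially finite-valued. Hence the boundary map of \<open>g\<close> is neither recurrent nor ergodic.

  This does not descend to \<open>f\<close> at once, because the radial limit map \<open>\<phi>\<^sup>*\<close> from the circle to \<open>\<partial>U\<close>
  need not be injective: for a general domain, a slit in the complement is reached from two sides. But
  two sides are the worst case. Two radii whose images end at the same point \<open>x\<close> form a Jordan curve, and no
  other point can be reached by radii from both sides of it (\<open>radial_limits_do_not_cross\<close>); therefore
  all but countably many points of \<open>\<partial>U\<close> are reached by at most two radii
  (\<open>countable_triple_radial_limits\<close>). Both negations follow by producing three radii:
  \<^item> if almost every point of the image under \<open>\<phi>\<^sup>*\<close> of a compact set of directions with bounded
    \<open>Re \<psi>\<close> returned infinitely often, then two returns that are far apart in time would give a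
    point reached along three radii with different values of \<open>Re \<psi>\<close> (\<open>not_recurrent\<close>);
  \<^item> if \<open>f\<close> were ergodic, then for each of three disjoint discs of values of \<open>u\<close> the grand orbit
    of the corresponding boundary points would have full measure, and a common point of the three grand
    orbits would eventually be mapped to a point reached along three radii with different values of
    \<open>u\<close> (\<open>not_ergodic\<close>).

  The analysis on the circle rests on Fatou's theorem (\<open>Fatou_radial_limit\<close>), on the boundary map of
  an inner function being non-singular (\<open>bmap_AE\<close>) and compatible with boundary values
  (\<open>bdry_compose_inner\<close>), and on the uniqueness theorem for zero-free functions
  (\<open>zero_free_boundary_nonzero\<close>), by which countable subsets of \<open>\<partial>U\<close> are negligible. All this
  concerns bounded functions. It applies to \<open>\<phi>\<close> because \<open>\<phi> = R \<circ> B\<close> with \<open>B\<close> bounded and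
  holomorphic and \<open>R\<close> continuous on the whole plane (\<open>exists_B\<close>).
\<close>

section \<open>Arc length and the Poisson kernel on the circle\<close>

abbreviation circ :: "complex measure" where "circ \<equiv> circle_measure"

lemma space_circle [simp]: "space circ = sphere 0 1"
  by (simp add: circle_measure_def space_restrict_space)

lemma sets_circle: "sets circ = sets (restrict_space borel (sphere 0 1))"
  by (simp add: circle_measure_def)

lemma measurable_cis [measurable]:
  "cis \<in> uniform_measure lborel {0..<2 * pi} \<rightarrow>\<^sub>M restrict_space borel (sphere 0 1)"
proof (rule measurable_restrict_space2)
  show "cis \<in> uniform_measure lborel {0..<2 * pi} \<rightarrow>\<^sub>M borel"
    by (subst measurable_cong_sets[of _ borel _ borel])
       (auto intro!: borel_measurable_continuous_onI continuous_intros)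
qed auto

lemma emeasure_circle_UNIV: "emeasure circ (sphere 0 1) = 1"
proof -
  have "emeasure circ (sphere 0 1) = emeasure (uniform_measure lborel {0..<2*pi}) UNIV"
    unfolding circle_measure_def
    by (subst emeasure_distr) (auto simp: space_restrict_space sets_restrict_space vimage_def)
  also have "\<dots> = 1"
    by (subst emeasure_uniform_measure) (auto simp: ennreal_divide_self)
  finally show ?thesis .
qed

interpretation circle: finite_measure circ
  by standard (simp add: emeasure_circle_UNIV)

lemma circ_space [simp]: "measure circ (sphere 0 1) = 1"
  using emeasure_circle_UNIV by (simp add: measure_def)

lemma borel_measurable_continuous_circle:
  "continuous_on (sphere 0 1) F \<Longrightarrow> F \<in> borel_measurable circ"
  by (subst measurable_cong_sets[OF sets_circle refl]) (rule borel_measurable_continuous_on_restrict)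

text \<open>Translates integrals over the circle into the gauge integrals that define contour integration.\<close>

lemma integral_circle_cis:
  fixes F :: "complex \<Rightarrow> complex"
  assumes F: "continuous_on (sphere 0 1) F"
  shows "((\<lambda>t. F (cis (2 * pi * t))) has_integral (LINT \<zeta>|circ. F \<zeta>)) {0..1}"
proof -
  have Fm: "F \<in> borel_measurable (restrict_space borel (sphere 0 1))"
    by (rule borel_measurable_continuous_on_restrict[OF F])
  have cF: "continuous_on UNIV (\<lambda>t. F (cis t))"
    by (rule continuous_on_compose2[OF F]) (auto intro!: continuous_intros)
  have Fm2: "(\<lambda>t. F (cis t)) \<in> borel_measurable borel"
    using cF by (rule borel_measurable_continuous_onI)
  have um: "uniform_measure lborel {0..<2 * pi} =
      density lborel (\<lambda>t. ennreal (indicator {0..<2*pi} t / (2 * pi)))"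
    unfolding uniform_measure_def
    using divide_ennreal[of 1 "2 * pi"]
    by (intro density_cong) (auto simp: indicator_def)
  have "(LINT \<zeta>|circ. F \<zeta>) = (LINT t|uniform_measure lborel {0..<2 * pi}. F (cis t))"
    unfolding circle_measure_def by (rule integral_distr[OF measurable_cis Fm])
  also have "\<dots> = (LINT t|lborel. (indicator {0..<2*pi} t / (2 * pi)) *\<^sub>R F (cis t))"
    unfolding um by (rule integral_density) (use Fm2 in \<open>auto simp: indicator_def\<close>)
  also have "\<dots> = \<bar>2 * pi\<bar> *\<^sub>R (LINT t|lborel. (indicator {0..<2*pi} (0 + 2*pi*t) / (2 * pi)) *\<^sub>R F (cis (0 + 2*pi*t)))"
    by (rule lborel_integral_real_affine) simp
  also have "\<dots> = (LINT t|lborel. \<bar>2 * pi\<bar> *\<^sub>R ((indicator {0..<2*pi} (0 + 2*pi*t) / (2 * pi)) *\<^sub>R F (cis (0 + 2*pi*t))))"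
    by (rule integral_scaleR_right[symmetric])
  also have "\<dots> = (LINT t|lborel. indicator {0..<1} t *\<^sub>R F (cis (2*pi*t)))"
    by (intro Bochner_Integration.integral_cong) (use pi_gt_zero in \<open>auto simp: indicator_def zero_le_mult_iff not_le[symmetric]\<close>)
  also have "\<dots> = (LINT t|lborel. indicator {0..1} t *\<^sub>R F (cis (2*pi*t)))"
  proof (rule integral_cong_AE)
    show "AE t in lborel. indicator {0..<1} t *\<^sub>R F (cis (2*pi*t)) = indicator {0..1} t *\<^sub>R F (cis (2*pi*t))"
      by (rule AE_mp[OF AE_lborel_singleton[of 1]]) (auto simp: indicator_def)
  qed (use measurable_compose[OF _ Fm2, of "\<lambda>t. 2*pi*t" lborel] in auto)
  finally have eq: "(LINT \<zeta>|circ. F \<zeta>) = (LINT t:{0..1}|lborel. F (cis (2*pi*t)))"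
    by (simp add: set_lebesgue_integral_def)
  have cF2: "continuous_on {0..1} (\<lambda>t. F (cis (2*pi*t)))"
    by (rule continuous_on_compose2[OF F]) (auto intro!: continuous_intros)
  have "set_integrable lborel {0..1} (\<lambda>t. F (cis (2*pi*t)))"
    unfolding set_integrable_def by (rule borel_integrable_compact[OF _ cF2]) simp
  from set_borel_integral_eq_integral[OF this] show ?thesis unfolding eq
    by (simp add: has_integral_iff)
qed

text \<open>On the unit circle, normalized arc length is \<open>d\<eta> / (2 \<pi> \<i> \<eta>)\<close>; hence the factor \<open>\<eta>\<close>.\<close>

lemma Cauchy_circle:
  assumes H: "H holomorphic_on cball 0 1" and w: "norm w < 1"
  shows "(LINT \<eta>|circ. H \<eta> * (\<eta> / (\<eta> - w))) = H w"
proof -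
  have c: "continuous_on (sphere 0 1) (\<lambda>\<eta>. H \<eta> * (\<eta> / (\<eta> - w)))"
    using w by (intro continuous_intros continuous_on_subset[OF holomorphic_on_imp_continuous_on[OF H]]) auto
  have "((\<lambda>u. H u/(u-w)) has_contour_integral (2 * of_real pi * \<i> * H w)) (circlepath 0 1)"
    by (rule Cauchy_integral_circlepath_simple[OF H]) (use w in simp)
  then have "((\<lambda>t. H (cis (2*pi*t)) / (cis (2*pi*t) - w) * (2 * of_real pi * \<i> * cis (2*pi*t)))
      has_integral (2 * of_real pi * \<i> * H w)) {0..1}"
    unfolding has_contour_integral vector_derivative_circlepath
    by (simp add: circlepath cis_conv_exp mult_ac)
  then have "((\<lambda>t. (1/(2 * of_real pi * \<i>)) * (H (cis (2*pi*t)) / (cis (2*pi*t) - w) * (2 * of_real pi * \<i> * cis (2*pi*t))))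
      has_integral (1/(2 * of_real pi * \<i>)) * (2 * of_real pi * \<i> * H w)) {0..1}"
    by (rule has_integral_mult_right)
  then have "((\<lambda>t. H (cis (2*pi*t)) * (cis (2*pi*t) / (cis (2*pi*t) - w))) has_integral H w) {0..1}"
    by (simp add: field_simps)
  with integral_circle_cis[OF c] show ?thesis by (rule has_integral_unique)
qed

lemma mean_value_circle:
  assumes h: "h holomorphic_on ball 0 1" and r: "0 \<le> r" "r < 1"
  shows "(LINT \<zeta>|circ. h (of_real r * \<zeta>)) = h 0"
proof -
  have "(\<lambda>z. h (of_real r * z)) holomorphic_on cball 0 1"
    using r by (intro holomorphic_on_compose_gen[OF _ h, unfolded o_def] holomorphic_intros)
       (auto simp: norm_mult intro: le_less_trans[OF mult_left_le])
  from Cauchy_circle[OF this, of 0] have "(LINT \<eta>|circ. h (of_real r * \<eta>) * (\<eta> / \<eta>)) = h 0" by simp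
  also have "(LINT \<eta>|circ. h (of_real r * \<eta>) * (\<eta> / \<eta>)) = (LINT \<eta>|circ. h (of_real r * \<eta>))"
    by (intro Bochner_Integration.integral_cong) auto
  finally show ?thesis .
qed

definition poisson :: "complex \<Rightarrow> complex \<Rightarrow> real" where
  "poisson w \<eta> = (1 - (norm w)\<^sup>2) / (norm (\<eta> - w))\<^sup>2"

lemma poisson_nonneg: "norm w < 1 \<Longrightarrow> 0 \<le> poisson w \<eta>"
  unfolding poisson_def by (intro divide_nonneg_nonneg) (auto simp: power_le_one)

lemma continuous_poisson:
  "norm w < 1 \<Longrightarrow> continuous_on (sphere 0 1) (poisson w)"
  unfolding poisson_def by (intro continuous_intros) auto

text \<open>On the circle \<open>cnj \<eta> = 1 / \<eta>\<close>, so the kernel is the Cauchy kernel times a function of \<open>\<eta>\<close> that is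
  holomorphic near the closed disc. That function has the value \<open>1\<close> at \<open>\<eta> = w\<close>, which turns Cauchy's
  formula into Poisson's.\<close>

lemma poisson_complex:
  assumes "norm \<eta> = 1" "norm w < 1"
  shows "complex_of_real (poisson w \<eta>) = (1 - (norm w)\<^sup>2) / (1 - cnj w * \<eta>) * (\<eta> / (\<eta> - w))"
proof -
  have e: "\<eta> * cnj \<eta> = 1" using assms(1) by (simp add: complex_norm_square[symmetric])
  have "complex_of_real ((norm (\<eta> - w))\<^sup>2) = (\<eta> - w) * (cnj \<eta> - cnj w)"
    by (simp only: complex_norm_square complex_cnj_diff)
  moreover have "(1 - cnj w * \<eta>) = \<eta> * (cnj \<eta> - cnj w)" using e by (simp add: algebra_simps)
  moreover have "\<eta> \<noteq> 0" "\<eta> \<noteq> w" using assms by auto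
  ultimately show ?thesis unfolding poisson_def by simp
qed

lemma poisson_Re:
  assumes "norm \<eta> = 1" "norm w < 1"
  shows "poisson w \<eta> = Re ((\<eta> + w) / (\<eta> - w))"
proof -
  have "\<eta> \<noteq> w" using assms by auto
  have "Re ((\<eta> + w) / (\<eta> - w)) = Re ((\<eta> + w) * cnj (\<eta> - w)) / (norm (\<eta> - w))\<^sup>2"
    using Re_divide_of_real[of "(\<eta> + w) * cnj (\<eta> - w)" "(norm (\<eta> - w))\<^sup>2"]
    by (simp only: complex_div_cnj[of "\<eta> + w"] of_real_power)
  also have "Re ((\<eta> + w) * cnj (\<eta> - w)) = (norm \<eta>)\<^sup>2 - (norm w)\<^sup>2"
    unfolding cmod_power2 by (simp add: algebra_simps power2_eq_square)
  finally show ?thesis using assms by (simp add: poisson_def)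
qed

lemma poisson_formula:
  assumes h: "h holomorphic_on cball 0 1" and w: "norm w < 1"
  shows "(LINT \<eta>|circ. of_real (poisson w \<eta>) * h \<eta>) = h w"
proof -
  have nz: "1 - cnj w * z \<noteq> 0" if "norm z \<le> 1" for z
  proof -
    have "norm (cnj w * z) < 1" using w that by (simp add: norm_mult mult_less_le_imp_less[of "norm w" 1 "norm z" 1] mult_le_less_imp_less)
       (metis mult.right_neutral mult_left_mono norm_ge_zero order_le_less_trans)
    then show ?thesis by auto
  qed
  let ?H = "\<lambda>z. h z * ((1 - (norm w)\<^sup>2) / (1 - cnj w * z))"
  have "?H holomorphic_on cball 0 1"
    by (intro holomorphic_intros h) (use nz in auto)
  from Cauchy_circle[OF this w]
  have "(LINT \<eta>|circ. ?H \<eta> * (\<eta> / (\<eta> - w))) = ?H w" .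
  also have "(LINT \<eta>|circ. ?H \<eta> * (\<eta> / (\<eta> - w))) = (LINT \<eta>|circ. of_real (poisson w \<eta>) * h \<eta>)"
    by (intro Bochner_Integration.integral_cong) (auto simp: poisson_complex w)
  also have "?H w = h w"
  proof -
    have "complex_of_real ((norm w)\<^sup>2) = cnj w * w" by (simp only: complex_norm_square mult.commute)
    then show ?thesis using nz[of w] w by simp
  qed
  finally show ?thesis .
qed

lemma integrable_continuous_circle:
  fixes F :: "complex \<Rightarrow> 'a::{banach, second_countable_topology}"
  assumes "continuous_on (sphere 0 1) F"
  shows "integrable circ F"
proof -
  have "compact (F ` sphere 0 1)" by (intro compact_continuous_image assms) auto
  then obtain B where "\<forall>x\<in>sphere 0 1. norm (F x) \<le> B"
    using compact_imp_bounded bounded_iff by (metis image_eqI)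
  then show ?thesis
    by (intro circle.integrable_const_bound[of _ B] borel_measurable_continuous_circle assms AE_I2) auto
qed

lemma integral_poisson: assumes "norm w < 1" shows "(LINT \<eta>|circ. poisson w \<eta>) = 1"
proof -
  have "complex_of_real (LINT \<eta>|circ. poisson w \<eta>) = (LINT \<eta>|circ. of_real (poisson w \<eta>) * 1)"
    by simp
  also have "\<dots> = 1" by (rule poisson_formula) (use assms in auto)
  finally show ?thesis by (simp only: of_real_eq_1_iff)
qed

lemma sets_circle_Int_open: "open A \<Longrightarrow> A \<inter> sphere 0 1 \<in> sets circ"
  by (auto simp: sets_circle sets_restrict_space)

lemma sets_circle_Int: "A \<in> sets borel \<Longrightarrow> A \<inter> sphere 0 1 \<in> sets circ"
  by (auto simp: sets_circle sets_restrict_space)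

text \<open>The Poisson kernel at \<open>(1 - \<rho>) \<zeta>\<close> has total mass 1 and is at least \<open>1 / (4 \<rho>)\<close> on the cap.\<close>

lemma measure_cap_le:
  assumes \<zeta>: "norm \<zeta> = 1" and \<rho>: "0 < \<rho>"
  shows "measure circ (cball \<zeta> \<rho> \<inter> sphere 0 1) \<le> 4 * \<rho>"
proof (cases "\<rho> < 1")
  case True
  let ?w = "of_real (1 - \<rho>) * \<zeta>" let ?A = "cball \<zeta> \<rho> \<inter> sphere 0 1"
  have A: "?A \<in> sets circ" by (intro sets_circle_Int) auto
  have nw: "norm ?w = 1 - \<rho>" using True \<rho> \<zeta> by (simp only: norm_mult norm_of_real) simp
  have lb: "1 / (4 * \<rho>) \<le> poisson ?w \<eta>" if "\<eta> \<in> ?A" for \<eta>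
  proof -
    have "norm (\<eta> - ?w) \<le> norm (\<eta> - \<zeta>) + norm (\<zeta> - ?w)" by (metis diff_add_cancel add_diff_eq norm_triangle_ineq)
    moreover have "\<zeta> - ?w = of_real \<rho> * \<zeta>" by (simp add: algebra_simps)
    then have "norm (\<zeta> - ?w) = \<rho>" using \<rho> \<zeta> by (simp add: norm_mult)
    ultimately have "norm (\<eta> - ?w) \<le> 2 * \<rho>" using that by (simp add: dist_norm norm_minus_commute)
    then have "(norm (\<eta> - ?w))\<^sup>2 \<le> 4 * \<rho>\<^sup>2" using power_mono[of "norm (\<eta> - ?w)" "2*\<rho>" 2] by (simp add: power_mult_distrib)
    moreover have "(norm (\<eta> - ?w))\<^sup>2 > 0" using nw that True \<rho> by auto
    moreover have "1 - (norm ?w)\<^sup>2 \<ge> \<rho>" unfolding nw using True \<rho> by (simp add: power2_eq_square algebra_simps mult_left_le)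
    ultimately have "\<rho> / (4 * \<rho>\<^sup>2) \<le> poisson ?w \<eta>"
      unfolding poisson_def using \<rho> by (intro frac_le) auto
    then show ?thesis using \<rho> by (simp add: power2_eq_square)
  qed
  have "measure circ ?A * (1 / (4*\<rho>)) = (LINT \<eta>|circ. indicator ?A \<eta> * (1 / (4*\<rho>)))"
    using A by (simp add: sets.sets_into_space Int_absorb1)
  also have "\<dots> \<le> (LINT \<eta>|circ. poisson ?w \<eta>)"
  proof (rule integral_mono)
    show "integrable circ (\<lambda>\<eta>. indicator ?A \<eta> * (1 / (4*\<rho>)))"
      using A by (intro integrable_mult_left integrable_real_indicator) (auto simp: circle.emeasure_eq_measure)
    show "integrable circ (poisson ?w)"
      using nw \<rho> by (intro integrable_continuous_circle continuous_poisson) auto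
    show "indicator ?A \<eta> * (1 / (4*\<rho>)) \<le> poisson ?w \<eta>" if "\<eta> \<in> space circ" for \<eta>
      using lb[of \<eta>] poisson_nonneg[of ?w \<eta>] nw \<rho> by (auto simp: indicator_def)
  qed
  also have "\<dots> = 1" using nw \<rho> by (intro integral_poisson) auto
  finally show ?thesis using \<rho> by (simp add: field_simps)
next
  case False
  have "measure circ (cball \<zeta> \<rho> \<inter> sphere 0 1) \<le> 1"
    using circle.bounded_measure[of "cball \<zeta> \<rho> \<inter> sphere 0 1"] by simp
  then show ?thesis using False by simp
qed

section \<open>The radial maximal inequality\<close>

lemma dist_to_radius_ge:
  fixes \<zeta> \<eta> :: complex
  assumes "norm \<zeta> = 1" "norm \<eta> = 1" "0 \<le> r" "r < 1"
  shows "1 - r \<le> norm (\<eta> - of_real r * \<zeta>)" "norm (\<eta> - \<zeta>) \<le> 2 * norm (\<eta> - of_real r * \<zeta>)"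
proof -
  have "norm \<eta> - norm (of_real r * \<zeta>) \<le> norm (\<eta> - of_real r * \<zeta>)" by (rule norm_triangle_ineq2)
  then show 1: "1 - r \<le> norm (\<eta> - of_real r * \<zeta>)" using assms by (simp add: norm_mult)
  have "\<eta> - \<zeta> = (\<eta> - of_real r * \<zeta>) - of_real (1 - r) * \<zeta>" by (simp add: algebra_simps)
  also have "norm \<dots> \<le> norm (\<eta> - of_real r * \<zeta>) + norm (of_real (1 - r) * \<zeta>)" by (rule norm_triangle_ineq4)
  also have "norm (of_real (1 - r) * \<zeta>) = 1 - r" using assms by (simp only: norm_mult norm_of_real) simp
  finally show "norm (\<eta> - \<zeta>) \<le> 2 * norm (\<eta> - of_real r * \<zeta>)" using 1 by simp
qed

text \<open>On the cap of radius \<open>2 ^ j * (1 - r)\<close> minus the preceding one, the distance from \<open>\<eta>\<close> to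
  \<open>of_real r * \<zeta>\<close> is at least a quarter of that radius. A Poisson integral is thus controlled by averages over
  the caps centred at \<open>\<zeta>\<close>.\<close>

lemma poisson_le_dyadic:
  assumes \<zeta>: "norm \<zeta> = 1" and \<eta>: "norm \<eta> = 1" and r: "0 \<le> r" "r < 1" and J: "2 \<le> 2 ^ J * (1 - r)"
  shows "poisson (of_real r * \<zeta>) \<eta> \<le> (\<Sum>j\<le>J. 32 / (4 ^ j * (1 - r)) * indicator (cball \<zeta> (2 ^ j * (1 - r))) \<eta>)"
proof -
  let ?\<rho> = "1 - r" let ?d = "norm (\<eta> - \<zeta>)" let ?n = "norm (\<eta> - of_real r * \<zeta>)"
  \<comment> \<open>The cap that contains \<open>\<eta>\<close> but whose predecessor does not.\<close>
  define j where "j = (LEAST j. ?d \<le> 2 ^ j * ?\<rho>)"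
  have "?d \<le> 2" using norm_triangle_ineq4[of \<eta> \<zeta>] \<zeta> \<eta> by simp
  then have dJ: "?d \<le> 2 ^ J * ?\<rho>" using J by linarith
  have j: "?d \<le> 2 ^ j * ?\<rho>" unfolding j_def by (rule LeastI[of "\<lambda>j. ?d \<le> 2 ^ j * ?\<rho>", OF dJ])
  have jJ: "j \<le> J" unfolding j_def by (rule Least_le[of "\<lambda>j. ?d \<le> 2 ^ j * ?\<rho>", OF dJ])
  note n = dist_to_radius_ge[OF \<zeta> \<eta> r]
  have num: "1 - (norm (of_real r * \<zeta>))\<^sup>2 \<le> 2 * ?\<rho>"
  proof -
    have "norm (of_real r * \<zeta>) = r" using \<zeta> r by (simp add: norm_mult)
    moreover have "(1-r)\<^sup>2 \<ge> 0" by simp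
    ultimately show ?thesis by (simp add: power2_eq_square algebra_simps)
  qed
  have key: "2 ^ j * ?\<rho> / 4 \<le> ?n"
  proof (cases j)
    case 0 then show ?thesis using n(1) r by simp
  next
    case (Suc i)
    then have "i < (LEAST j. ?d \<le> 2 ^ j * ?\<rho>)" by (simp add: j_def)
    from not_less_Least[OF this] have "2 ^ i * ?\<rho> < ?d" by simp
    moreover have "2 ^ j * ?\<rho> / 4 = 2 ^ i * ?\<rho> / 2" using Suc by simp
    ultimately show ?thesis using n(2) by linarith
  qed
  have "poisson (of_real r * \<zeta>) \<eta> \<le> 2 * ?\<rho> / (2 ^ j * ?\<rho> / 4)\<^sup>2"
    unfolding poisson_def using r key num by (intro frac_le power_mono) auto
  also have "\<dots> = 32 / (4 ^ j * ?\<rho>)"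
  proof -
    have "(4::real) ^ j = 2 ^ j * 2 ^ j" by (simp flip: power_mult_distrib)
    then have "2 * s / (2 ^ j * s / 4)\<^sup>2 = 32 / (4 ^ j * s)" if "0 < s" for s :: real
      using that by (simp add: power2_eq_square field_simps)
    from this[of "1 - r"] show ?thesis using r by linarith
  qed
  also have "\<dots> = 32 / (4 ^ j * ?\<rho>) * indicator (cball \<zeta> (2 ^ j * ?\<rho>)) \<eta>"
    using j by (simp add: dist_norm norm_minus_commute)
  also have "\<dots> \<le> (\<Sum>j\<le>J. 32 / (4 ^ j * ?\<rho>) * indicator (cball \<zeta> (2 ^ j * ?\<rho>)) \<eta>)"
    using jJ r by (intro member_le_sum[of j]) auto
  finally show ?thesis .
qed

lemma integrable_indicator_circle:
  fixes q :: "complex \<Rightarrow> real"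
  assumes q: "continuous_on (sphere 0 1) q" and A: "A \<in> sets borel"
  shows "integrable circ (\<lambda>\<eta>. indicator A \<eta> * q \<eta>)"
proof -
  have "integrable circ (\<lambda>\<eta>. indicator (A \<inter> sphere 0 1) \<eta> *\<^sub>R q \<eta>)"
    by (intro integrable_mult_indicator sets_circle_Int A integrable_continuous_circle q)
  then show ?thesis
    by (rule Bochner_Integration.integrable_cong[THEN iffD1, rotated -1]) (auto simp: indicator_def)
qed

text \<open>The cap of radius \<open>2 ^ j * (1 - r)\<close> contributes at most \<open>32 * \<mu> / 2 ^ j\<close>, so the sum does not depend
  on \<open>r\<close>.\<close>

lemma radial_bound_of_averages:
  assumes p: "p holomorphic_on UNIV" and \<zeta>: "norm \<zeta> = 1" and r: "0 \<le> r" "r < 1"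
    and avg: "\<And>\<rho>. 0 < \<rho> \<Longrightarrow> (LINT \<eta>|circ. indicator (cball \<zeta> \<rho>) \<eta> * norm (p \<eta>)) \<le> \<mu> * \<rho>"
  shows "norm (p (of_real r * \<zeta>)) \<le> 64 * \<mu>"
proof -
  let ?w = "of_real r * \<zeta>" let ?\<rho> = "1 - r"
  have cp: "continuous_on (sphere 0 1) p"
    using p holomorphic_on_imp_continuous_on continuous_on_subset by blast
  have nw: "norm ?w < 1" using \<zeta> r by (simp add: norm_mult)
  obtain J :: nat where "2 / ?\<rho> < 2 ^ J" using real_arch_pow[of 2 "2 / ?\<rho>"] by auto
  then have J: "2 \<le> 2 ^ J * ?\<rho>" using r by (simp add: field_simps)
  have \<mu>0: "0 \<le> \<mu>"
  proof -
    have "0 \<le> (LINT \<eta>|circ. indicator (cball \<zeta> 1) \<eta> * norm (p \<eta>))" by (intro integral_nonneg_AE) auto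
    also have "\<dots> \<le> \<mu> * 1" by (rule avg) simp
    finally show ?thesis by simp
  qed
  have int: "integrable circ (\<lambda>\<eta>. indicator (cball \<zeta> s) \<eta> * norm (p \<eta>))" for s
    by (intro integrable_indicator_circle continuous_intros cp) auto
  have "norm (p ?w) = norm (LINT \<eta>|circ. of_real (poisson ?w \<eta>) * p \<eta>)"
    by (subst poisson_formula) (use p nw holomorphic_on_subset in auto)
  also have "\<dots> \<le> (LINT \<eta>|circ. norm (of_real (poisson ?w \<eta>) * p \<eta>))"
    by (rule integral_norm_bound)
  also have "\<dots> \<le> (LINT \<eta>|circ. (\<Sum>j\<le>J. 32 / (4 ^ j * ?\<rho>) * (indicator (cball \<zeta> (2 ^ j * ?\<rho>)) \<eta> * norm (p \<eta>))))"
  proof (rule integral_mono)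
    show "integrable circ (\<lambda>\<eta>. norm (of_real (poisson ?w \<eta>) * p \<eta>))"
      by (intro integrable_continuous_circle continuous_intros continuous_on_of_real continuous_poisson nw cp)
    show "integrable circ (\<lambda>\<eta>. (\<Sum>j\<le>J. 32 / (4 ^ j * ?\<rho>) * (indicator (cball \<zeta> (2 ^ j * ?\<rho>)) \<eta> * norm (p \<eta>))))"
      by (intro Bochner_Integration.integrable_sum integrable_mult_right int)
    fix \<eta> assume "\<eta> \<in> space circ"
    then have \<eta>: "norm \<eta> = 1" by simp
    have "norm (of_real (poisson ?w \<eta>) * p \<eta>) = poisson ?w \<eta> * norm (p \<eta>)"
      using poisson_nonneg[OF nw, of \<eta>] by (simp add: norm_mult)
    also have "\<dots> \<le> (\<Sum>j\<le>J. 32 / (4 ^ j * ?\<rho>) * indicator (cball \<zeta> (2 ^ j * ?\<rho>)) \<eta>) * norm (p \<eta>)"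
      by (intro mult_right_mono poisson_le_dyadic \<zeta> \<eta> r J) auto
    finally show "norm (of_real (poisson ?w \<eta>) * p \<eta>)
        \<le> (\<Sum>j\<le>J. 32 / (4 ^ j * ?\<rho>) * (indicator (cball \<zeta> (2 ^ j * ?\<rho>)) \<eta> * norm (p \<eta>)))"
      by (simp only: sum_distrib_right mult.assoc)
  qed
  also have "\<dots> = (\<Sum>j\<le>J. 32 / (4 ^ j * ?\<rho>) * (LINT \<eta>|circ. indicator (cball \<zeta> (2 ^ j * ?\<rho>)) \<eta> * norm (p \<eta>)))"
    by (subst Bochner_Integration.integral_sum) (auto intro!: integrable_mult_right int)
  also have "\<dots> \<le> (\<Sum>j\<le>J. 32 / (4 ^ j * ?\<rho>) * (\<mu> * (2 ^ j * ?\<rho>)))"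
    using r by (intro sum_mono mult_left_mono avg) auto
  also have "\<dots> = 32 * \<mu> * (\<Sum>j\<le>J. (1/2) ^ j)"
    unfolding sum_distrib_left
  proof (intro sum.cong refl)
    fix j
    have "(4::real) ^ j = 2 ^ j * 2 ^ j" by (simp flip: power_mult_distrib)
    then show "32 / (4 ^ j * ?\<rho>) * (\<mu> * (2 ^ j * ?\<rho>)) = 32 * \<mu> * (1/2) ^ j"
      using r by (simp add: field_simps)
  qed
  also have "\<dots> \<le> 32 * \<mu> * 2"
  proof (intro mult_left_mono)
    have "(\<Sum>j\<le>J. (1/2::real) ^ j) = 2 - (1/2)^J"
      by (induction J) (auto simp: field_simps)
    then show "(\<Sum>j\<le>J. (1/2::real) ^ j) \<le> 2" by simp
  qed (use \<mu>0 in simp)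
  finally show ?thesis by simp
qed

text \<open>The argument of Hardy and Littlewood: every point of \<open>S\<close> is the centre of a cap over which the integral
  of \<open>norm \<circ> p\<close> exceeds \<open>\<mu>\<close> times the radius. By Vitali's covering lemma, disjoint caps of this kind
  can be chosen so that the caps with the fivefold radii still cover \<open>S\<close>.\<close>

lemma weak_type_radial:
  assumes p: "p holomorphic_on UNIV" and \<mu>: "0 < \<mu>"
  defines "S \<equiv> {\<zeta>\<in>sphere 0 1. \<exists>r\<in>{0..<1}. 64 * \<mu> < norm (p (of_real r * \<zeta>))}"
  shows "S \<in> sets circ"
    and "measure circ S \<le> 20 / \<mu> * (LINT \<eta>|circ. norm (p \<eta>))"
proof -
  let ?I = "\<lambda>A. LINT \<eta>|circ. indicator A \<eta> * norm (p \<eta>)"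
  let ?T = "LINT \<eta>|circ. norm (p \<eta>)"
  have cp: "continuous_on A p" for A
    using p holomorphic_on_imp_continuous_on continuous_on_subset by blast
  have "open (\<Union>r\<in>{0..<1::real}. {\<zeta>. 64 * \<mu> < norm (p (of_real r * \<zeta>))})"
    by (intro open_UN ballI open_Collect_less continuous_intros continuous_on_compose2[OF cp[of UNIV]]) auto
  moreover have "S = (\<Union>r\<in>{0..<1::real}. {\<zeta>. 64 * \<mu> < norm (p (of_real r * \<zeta>))}) \<inter> sphere 0 1"
    unfolding S_def by auto
  ultimately show Sm: "S \<in> sets circ" by (auto intro: sets_circle_Int_open)
  have int: "integrable circ (\<lambda>\<eta>. indicator A \<eta> * norm (p \<eta>))" if "A \<in> sets borel" for A
    by (intro integrable_indicator_circle continuous_intros cp that)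
  have Ile: "?I A \<le> ?T" if "A \<in> sets borel" for A
    using that by (intro integral_mono int integrable_continuous_circle continuous_intros cp) (auto simp: indicator_def)
  have "\<exists>\<rho>>0. \<mu> * \<rho> < ?I (cball \<zeta> \<rho>)" if "\<zeta> \<in> S" for \<zeta>
  proof (rule ccontr)
    assume "\<not> ?thesis"
    then have "?I (cball \<zeta> \<rho>) \<le> \<mu> * \<rho>" if "0 < \<rho>" for \<rho> using that not_less by blast
    then have "norm (p (of_real r * \<zeta>)) \<le> 64 * \<mu>" if "r \<in> {0..<1}" for r
      using that \<open>\<zeta> \<in> S\<close> by (intro radial_bound_of_averages[OF p]) (simp_all add: S_def)
    then show False using \<open>\<zeta> \<in> S\<close> by (force simp: S_def)
  qed
  then obtain \<rho> where \<rho>: "\<And>\<zeta>. \<zeta> \<in> S \<Longrightarrow> 0 < \<rho> \<zeta>" "\<And>\<zeta>. \<zeta> \<in> S \<Longrightarrow> \<mu> * \<rho> \<zeta> < ?I (cball \<zeta> (\<rho> \<zeta>))"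
    by metis
  have b: "\<rho> \<zeta> \<le> ?T / \<mu>" if "\<zeta> \<in> S" for \<zeta>
  proof -
    have "\<mu> * \<rho> \<zeta> \<le> ?T" using \<rho>(2)[OF that] Ile[of "cball \<zeta> (\<rho> \<zeta>)"] by simp
    then show ?thesis using \<mu> by (simp add: field_simps)
  qed
  have cov0: "S \<subseteq> (\<Union>\<zeta>\<in>S. cball (id \<zeta>) (\<rho> \<zeta>))" using \<rho>(1) by force
  obtain C where C: "countable C" "C \<subseteq> S"
    and disj: "pairwise (\<lambda>i j. disjnt (cball i (\<rho> i)) (cball j (\<rho> j))) C"
    and cov: "S \<subseteq> (\<Union>i\<in>C. cball i (5 * \<rho> i))"
    using Vitali_covering_lemma_cballs[OF cov0, of "?T / \<mu>"] \<rho>(1) b by (auto simp: id_def)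
  \<comment> \<open>Enumerate the centres, padding with empty sets in case there are only finitely many.\<close>
  define e where "e = from_nat_into C"
  define N where "N = to_nat_on C ` C"
  have eN: "inj_on e N" "e ` N = C"
    using C(1) unfolding e_def N_def by (auto simp: inj_on_def image_image)
  define F where "F n = (if n \<in> N then cball (e n) (5 * \<rho> (e n)) \<inter> sphere 0 1 else {})" for n
  define G where "G n = (if n \<in> N then cball (e n) (\<rho> (e n)) \<inter> sphere 0 1 else {})" for n
  define \<nu> where "\<nu> = density circ (\<lambda>\<eta>. ennreal (norm (p \<eta>)))"
  have pm: "(\<lambda>\<eta>. ennreal (norm (p \<eta>))) \<in> borel_measurable circ"
    by (intro measurable_compose[OF borel_measurable_continuous_circle measurable_ennreal] continuous_intros cp)
  have Fm: "F n \<in> sets circ" for n unfolding F_def by (auto intro: sets_circle_Int)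
  have Gm: "G n \<in> sets circ" for n unfolding G_def by (auto intro: sets_circle_Int)
  have FG: "emeasure circ (F n) \<le> ennreal (20 / \<mu>) * emeasure \<nu> (G n)" for n
  proof (cases "n \<in> N")
    case True
    let ?c = "e n"
    have c: "?c \<in> S" "norm ?c = 1" using True eN C(2) by (auto simp: S_def)
    have "measure circ (F n) \<le> 4 * (5 * \<rho> ?c)"
      using True \<rho>(1)[OF c(1)] measure_cap_le[OF c(2), of "5 * \<rho> ?c"] by (simp add: F_def)
    also have "\<dots> \<le> 20 / \<mu> * ?I (cball ?c (\<rho> ?c))"
      using \<rho>(2)[OF c(1)] \<mu> by (simp add: field_simps)
    finally have "ennreal (measure circ (F n)) \<le> ennreal (20 / \<mu> * ?I (cball ?c (\<rho> ?c)))"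
      by (rule ennreal_leI)
    also have "\<dots> = ennreal (20/\<mu>) * ennreal (?I (cball ?c (\<rho> ?c)))"
      using \<mu> by (intro ennreal_mult) (auto intro!: integral_nonneg_AE)
    also have "ennreal (?I (cball ?c (\<rho> ?c))) = (\<integral>\<^sup>+\<eta>. ennreal (indicator (cball ?c (\<rho> ?c)) \<eta> * norm (p \<eta>)) \<partial>circ)"
      by (rule nn_integral_eq_integral[symmetric]) (auto intro!: int)
    also have "\<dots> = emeasure \<nu> (G n)"
      unfolding \<nu>_def using True by (subst emeasure_density[OF pm Gm]) (auto simp: G_def indicator_def intro!: nn_integral_cong)
    finally show ?thesis by (simp add: circle.emeasure_eq_measure)
  qed (simp add: F_def)
  have dG: "disjoint_family G"
    using disj eN unfolding disjoint_family_on_def pairwise_def disjnt_def G_def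
    by (auto simp: inj_on_def)
  have "S \<subseteq> (\<Union>n. F n)"
  proof
    fix \<zeta> assume \<zeta>: "\<zeta> \<in> S"
    then obtain c where "c \<in> C" "\<zeta> \<in> cball c (5 * \<rho> c)" using cov by auto
    moreover obtain n where "n \<in> N" "e n = c" using eN(2) \<open>c \<in> C\<close> by auto
    ultimately have "\<zeta> \<in> F n" using \<zeta> by (auto simp: F_def S_def)
    then show "\<zeta> \<in> (\<Union>n. F n)" by auto
  qed
  then have "emeasure circ S \<le> emeasure circ (\<Union>n. F n)"
    using Fm by (intro emeasure_mono) auto
  also have "\<dots> \<le> (\<Sum>n. emeasure circ (F n))"
    using Fm by (intro emeasure_subadditive_countably) auto
  also have "\<dots> \<le> (\<Sum>n. ennreal (20/\<mu>) * emeasure \<nu> (G n))"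
    using FG by (intro suminf_le) auto
  also have "\<dots> = ennreal (20/\<mu>) * (\<Sum>n. emeasure \<nu> (G n))" by simp
  also have "(\<Sum>n. emeasure \<nu> (G n)) = emeasure \<nu> (\<Union>n. G n)"
    using Gm dG by (intro suminf_emeasure) (auto simp: \<nu>_def)
  also have "\<dots> \<le> emeasure \<nu> (space \<nu>)" by (rule emeasure_space)
  also have "emeasure \<nu> (space \<nu>) = (\<integral>\<^sup>+\<eta>. ennreal (norm (p \<eta>)) \<partial>circ)"
    unfolding \<nu>_def by (subst emeasure_density[OF pm]) (auto intro!: nn_integral_cong simp: indicator_def simp del: space_circle dest: sets.sets_into_space)
  also have "\<dots> = ennreal ?T"
    by (rule nn_integral_eq_integral) (auto intro!: integrable_continuous_circle continuous_intros cp)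
  finally have "emeasure circ S \<le> ennreal (20/\<mu>) * ennreal ?T" by (simp add: mult_left_mono)
  also have "\<dots> = ennreal (20/\<mu> * ?T)" using \<mu> by (intro ennreal_mult[symmetric]) auto
  finally show "measure circ S \<le> 20 / \<mu> * ?T"
    using \<mu> by (simp add: circle.emeasure_eq_measure)
qed

text \<open>The weak type estimate for the holomorphic function \<open>p\<^sup>2\<close>.\<close>

lemma maximal_inequality_L2:
  assumes p: "p holomorphic_on UNIV" and t: "0 < t"
  defines "S \<equiv> {\<zeta>\<in>sphere 0 1. \<exists>r\<in>{0..<1}. t < norm (p (of_real r * \<zeta>))}"
  shows "S \<in> sets circ"
    and "measure circ S \<le> 1280 / t\<^sup>2 * (LINT \<eta>|circ. (norm (p \<eta>))\<^sup>2)"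
proof -
  have p2: "(\<lambda>z. (p z)\<^sup>2) holomorphic_on UNIV" by (intro holomorphic_intros p)
  have \<mu>: "0 < t\<^sup>2 / 64" using t by simp
  have iff: "(64 * (t\<^sup>2 / 64) < norm ((p w)\<^sup>2)) = (t < norm (p w))" for w
    using t by (simp add: norm_power not_le[symmetric])
  note w = weak_type_radial[OF p2 \<mu>, unfolded iff]
  show "S \<in> sets circ" unfolding S_def by (rule w(1))
  show "measure circ S \<le> 1280 / t\<^sup>2 * (LINT \<eta>|circ. (norm (p \<eta>))\<^sup>2)"
    unfolding S_def using w(2) by (simp add: norm_power)
qed

section \<open>Radial limits of bounded holomorphic functions\<close>

lemma circle_orthogonal:
  "(LINT \<zeta>|circ. \<zeta> ^ m * cnj \<zeta> ^ n) = (if m = n then 1 else 0)"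
proof -
  have pow: "(LINT \<zeta>|circ. \<zeta> ^ k) = 0 ^ k" for k
  proof -
    have "(LINT \<zeta>|circ. \<zeta> ^ k * (\<zeta> / (\<zeta> - 0))) = 0 ^ k"
      by (rule Cauchy_circle) (auto intro!: holomorphic_intros)
    also have "(LINT \<zeta>|circ. \<zeta> ^ k * (\<zeta> / (\<zeta> - 0))) = (LINT \<zeta>|circ. \<zeta> ^ k)"
      by (intro Bochner_Integration.integral_cong) auto
    finally show ?thesis .
  qed
  have e: "\<zeta> * cnj \<zeta> = 1" if "norm \<zeta> = 1" for \<zeta>
    using that by (simp add: complex_norm_square[symmetric])
  have *: "\<zeta> ^ (n + d) * cnj \<zeta> ^ n = \<zeta> ^ d" if "norm \<zeta> = 1" for \<zeta> n d
    using e[OF that] by (simp add: power_add mult_ac flip: power_mult_distrib)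
  show ?thesis
  proof (cases "n \<le> m")
    case True
    then obtain d where d: "m = n + d" using le_Suc_ex by blast
    have "(LINT \<zeta>|circ. \<zeta> ^ m * cnj \<zeta> ^ n) = (LINT \<zeta>|circ. \<zeta> ^ d)"
      unfolding d by (intro Bochner_Integration.integral_cong) (auto simp: *)
    then show ?thesis by (simp add: pow d power_0_left)
  next
    case False
    then obtain d where d: "n = m + d" "d > 0" using less_imp_add_positive not_le_imp_less by blast
    have "(LINT \<zeta>|circ. \<zeta> ^ m * cnj \<zeta> ^ n) = (LINT \<zeta>|circ. cnj (\<zeta> ^ d))"
    proof (intro Bochner_Integration.integral_cong refl)
      fix \<zeta> assume "\<zeta> \<in> space circ"
      then have "\<zeta> ^ m * cnj \<zeta> ^ n = cnj (\<zeta> ^ n * cnj \<zeta> ^ m)" by simp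
      then show "\<zeta> ^ m * cnj \<zeta> ^ n = cnj (\<zeta> ^ d)" using * \<open>\<zeta> \<in> space circ\<close> by (simp only: d(1)) simp
    qed
    also have "\<dots> = cnj (LINT \<zeta>|circ. \<zeta> ^ d)" by (rule Bochner_Integration.integral_cnj)
    finally show ?thesis using d by (simp add: pow)
  qed
qed

lemma parseval_polynomial:
  assumes "finite A"
  shows "(LINT \<zeta>|circ. (norm (\<Sum>n\<in>A. a n * \<zeta> ^ n))\<^sup>2) = (\<Sum>n\<in>A. (norm (a n))\<^sup>2)"
proof -
  have "complex_of_real (LINT \<zeta>|circ. (norm (\<Sum>n\<in>A. a n * \<zeta> ^ n))\<^sup>2)
      = (LINT \<zeta>|circ. of_real ((norm (\<Sum>n\<in>A. a n * \<zeta> ^ n))\<^sup>2))"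
    by (intro integral_of_real[symmetric] integrable_continuous_circle continuous_intros)
  also have "\<dots> = (LINT \<zeta>|circ. (\<Sum>m\<in>A. \<Sum>n\<in>A. a m * cnj (a n) * (\<zeta> ^ m * cnj \<zeta> ^ n)))"
    by (intro Bochner_Integration.integral_cong refl)
       (simp only: complex_norm_square cnj_sum complex_cnj_mult complex_cnj_power sum_product, intro sum.cong refl, simp)
  also have "\<dots> = (\<Sum>m\<in>A. \<Sum>n\<in>A. a m * cnj (a n) * (LINT \<zeta>|circ. \<zeta> ^ m * cnj \<zeta> ^ n))"
    by (subst Bochner_Integration.integral_sum | subst integral_mult_right_zero
      | intro integrable_continuous_circle continuous_intros Bochner_Integration.integrable_sum sum.cong refl)+
  also have "\<dots> = (\<Sum>m\<in>A. a m * cnj (a m))"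
    using assms by (intro sum.cong refl) (simp add: circle_orthogonal if_distrib sum.delta cong: if_cong)
  also have "\<dots> = of_real (\<Sum>n\<in>A. (norm (a n))\<^sup>2)"
    by (simp only: of_real_sum complex_norm_square)
  finally show ?thesis by (simp only: of_real_eq_iff)
qed

text \<open>On the circle of radius \<open>r < 1\<close> the Taylor polynomials converge uniformly to \<open>h\<close>, so they are
  eventually bounded by \<open>M + d\<close> there, and Parseval's identity bounds their coefficients. Then \<open>r\<close>
  tends to \<open>1\<close>.\<close>

lemma taylor_coefficients_bounded:
  assumes h: "h holomorphic_on ball 0 1" and M: "\<And>z. norm z < 1 \<Longrightarrow> norm (h z) \<le> M"
    and a: "\<And>z. norm z < 1 \<Longrightarrow> (\<lambda>n. a n * z ^ n) sums h z"
  shows "(\<Sum>n<N. (norm (a n))\<^sup>2) \<le> M\<^sup>2"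
proof -
  have M0: "M \<ge> 0" using order_trans[OF norm_ge_zero M[of 0]] by simp
  have r: "(\<Sum>n<N. (norm (a n))\<^sup>2 * r ^ (2*n)) \<le> M\<^sup>2" if r: "0 < r" "r < 1" for r :: real
  proof (rule field_le_epsilon)
    fix e :: real assume e: "e > 0"
    obtain s where s: "r < s" "s < 1" using r dense by blast
    have "summable (\<lambda>n. norm (a n * of_real r ^ n))"
      using a[of "of_real s"] r s by (intro powser_insidea[of a "of_real s"]) (auto simp: sums_iff)
    then have "summable (\<lambda>n. norm (a n) * r ^ n)" using r by (simp add: norm_mult norm_power)
    then have ul: "uniform_limit (cball 0 r) (\<lambda>n z. \<Sum>i<n. a i * z ^ i) (\<lambda>z. suminf (\<lambda>i. a i * z ^ i)) sequentially"
      by (intro Weierstrass_m_test) (auto simp: norm_mult norm_power intro!: mult_left_mono power_mono)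
    \<comment> \<open>Chosen so that \<open>(M + d)\<^sup>2 \<le> M\<^sup>2 + e\<close>.\<close>
    define d where "d = e / (2 * M + e + 1)"
    have d: "d > 0" "d * (2 * M + d) \<le> e"
    proof -
      show "d > 0" using e M0 by (auto simp: d_def)
      have "d < 1" using e M0 by (simp add: d_def)
      then have "d * (2*M + d) \<le> d * (2 * M + e + 1)" using e \<open>d > 0\<close> by (intro mult_left_mono) auto
      also have "\<dots> = e" using e M0 by (simp add: d_def)
      finally show "d * (2 * M + d) \<le> e" .
    qed
    obtain m where m: "m \<ge> N" "\<And>z. norm z \<le> r \<Longrightarrow> norm ((\<Sum>i<m. a i * z ^ i) - h z) < d"
    proof -
      have "\<forall>\<^sub>F n in sequentially. n \<ge> N \<and> (\<forall>z\<in>cball 0 r. dist (\<Sum>i<n. a i * z ^ i) (suminf (\<lambda>i. a i * z ^ i)) < d)"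
        using uniform_limitD[OF ul d(1)] eventually_ge_at_top[of N] by eventually_elim auto
      then obtain n where n: "n \<ge> N" "\<forall>z\<in>cball 0 r. dist (\<Sum>i<n. a i * z ^ i) (suminf (\<lambda>i. a i * z ^ i)) < d"
        unfolding eventually_sequentially by blast
      have "suminf (\<lambda>i. a i * z ^ i) = h z" if "norm z \<le> r" for z
        using a[of z] that r by (simp add: sums_iff)
      then show thesis using n that by (auto simp: dist_norm)
    qed
    have "(\<Sum>n<N. (norm (a n))\<^sup>2 * r ^ (2*n)) \<le> (\<Sum>n<m. (norm (a n))\<^sup>2 * r ^ (2*n))"
      using m(1) r by (intro sum_mono2) auto
    also have "\<dots> = (\<Sum>n<m. (norm (a n * of_real r ^ n))\<^sup>2)"
      using r by (intro sum.cong) (auto simp: norm_mult norm_power power_mult_distrib power_mult[symmetric] mult.commute)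
    also have "\<dots> = (LINT \<zeta>|circ. (norm (\<Sum>n<m. a n * of_real r ^ n * \<zeta> ^ n))\<^sup>2)"
      by (rule parseval_polynomial[symmetric]) simp
    also have "\<dots> \<le> (LINT \<zeta>|circ. (M + d)\<^sup>2)"
    proof (rule integral_mono)
      show "(norm (\<Sum>n<m. a n * of_real r ^ n * \<zeta> ^ n))\<^sup>2 \<le> (M + d)\<^sup>2" if "\<zeta> \<in> space circ" for \<zeta>
      proof (rule power_mono)
        let ?z = "of_real r * \<zeta>"
        have z: "norm ?z \<le> r" "norm ?z < 1" using that r by (auto simp: norm_mult)
        have "norm (\<Sum>i<m. a i * ?z ^ i) \<le> norm ((\<Sum>i<m. a i * ?z ^ i) - h ?z) + norm (h ?z)"
          by (metis diff_add_cancel norm_triangle_ineq)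
        also have "\<dots> \<le> M + d" using m(2)[OF z(1)] M[OF z(2)] by simp
        finally show "norm (\<Sum>n<m. a n * of_real r ^ n * \<zeta> ^ n) \<le> M + d"
          by (simp add: power_mult_distrib mult.assoc)
      qed simp
    qed (auto intro!: integrable_continuous_circle continuous_intros)
    also have "\<dots> = (M + d)\<^sup>2" by simp
    also have "\<dots> = M\<^sup>2 + d * (2 * M + d)" by (simp add: power2_eq_square algebra_simps)
    also have "\<dots> \<le> M\<^sup>2 + e" using d(2) by simp
    finally show "(\<Sum>n<N. (norm (a n))\<^sup>2 * r ^ (2*n)) \<le> M\<^sup>2 + e" .
  qed
  have "((\<lambda>r. \<Sum>n<N. (norm (a n))\<^sup>2 * r ^ (2*n)) \<longlongrightarrow> (\<Sum>n<N. (norm (a n))\<^sup>2 * 1 ^ (2*n))) (at_left (1::real))"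
    by (intro tendsto_intros)
  moreover have "\<forall>\<^sub>F r in at_left (1::real). (\<Sum>n<N. (norm (a n))\<^sup>2 * r ^ (2*n)) \<le> M\<^sup>2"
    using eventually_at_left_real[of 0 1] by (auto elim!: eventually_mono intro: r)
  ultimately have "(\<Sum>n<N. (norm (a n))\<^sup>2 * 1 ^ (2*n)) \<le> M\<^sup>2"
    by (rule tendsto_upperbound) simp
  then show ?thesis by simp
qed

lemma geometric_uniform_limit:
  fixes f :: "nat \<Rightarrow> 'a \<Rightarrow> complex"
  assumes "\<And>k x. m \<le> k \<Longrightarrow> x \<in> X \<Longrightarrow> norm (f (Suc k) x - f k x) \<le> (1/2) ^ k"
  shows "\<exists>l. uniform_limit X f l sequentially"
proof -
  define g where "g i x = f (Suc (i + m)) x - f (i + m) x" for i x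
  have "uniform_limit X (\<lambda>n x. \<Sum>i<n. g i x) (\<lambda>x. suminf (\<lambda>i. g i x)) sequentially"
  proof (rule Weierstrass_m_test)
    show "norm (g i x) \<le> (1/2) ^ (i + m)" if "x \<in> X" for i x
      unfolding g_def using that by (intro assms) auto
    show "summable (\<lambda>i. (1/2::real) ^ (i + m))"
      by (subst summable_iff_shift) (simp add: summable_geometric)
  qed
  moreover have "uniform_limit X (\<lambda>n. f m) (f m) sequentially" by (rule uniform_limit_const)
  ultimately have "uniform_limit X (\<lambda>n x. f m x + (\<Sum>i<n. g i x)) (\<lambda>x. f m x + suminf (\<lambda>i. g i x)) sequentially"
    by (intro uniform_limit_intros)
  moreover have "f m x + (\<Sum>i<n. g i x) = f (n + m) x" for n x
    by (induction n) (simp_all add: g_def add.assoc[symmetric])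
  ultimately have u: "uniform_limit X (\<lambda>n. f (n + m)) (\<lambda>x. f m x + suminf (\<lambda>i. g i x)) sequentially"
    by simp
  show ?thesis
  proof (intro exI uniform_limitI)
    fix e :: real assume "0 < e"
    from uniform_limitD[OF u this]
    show "\<forall>\<^sub>F n in sequentially. \<forall>x\<in>X. dist (f n x) (f m x + suminf (\<lambda>i. g i x)) < e"
      by (rule eventually_sequentially_seg[THEN iffD1])
  qed
qed

text \<open>Along the whole radius of such a point, end point included, entire functions \<open>P k\<close> converge uniformly.
  These sets do two things: on them the limit function has radial limits, and these depend continuously on the
  point, so that these sets replace the sets of Lusin's theorem.\<close>

definition fast_points :: "(nat \<Rightarrow> complex \<Rightarrow> complex) \<Rightarrow> nat \<Rightarrow> complex set" where
  "fast_points P m = {\<zeta>\<in>sphere 0 1. \<forall>k\<ge>m. \<forall>r\<in>{0..1}.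
     norm (P (Suc k) (of_real r * \<zeta>) - P k (of_real r * \<zeta>)) \<le> (1/2) ^ k}"

text \<open>The \<open>P k\<close> are Taylor polynomials of \<open>h\<close>, chosen so that the coefficients of \<open>h\<close> missing in \<open>P k\<close> have
  square sum at most \<open>(1/8) ^ k\<close>. By the maximal inequality, \<open>P (Suc k) - P k\<close> then exceeds \<open>(1/2) ^ k\<close>
  somewhere on the radius only for a set of points of measure of order \<open>(1/2) ^ k\<close>, and the Borel--Cantelli lemma
  applies.\<close>

lemma bounded_fast_approximation:
  assumes h: "h holomorphic_on ball 0 1" and M: "\<And>z. norm z < 1 \<Longrightarrow> norm (h z) \<le> M"
  shows "\<exists>P. (\<forall>k. P k holomorphic_on UNIV) \<and>
    (\<forall>k. \<forall>j\<ge>k. (LINT \<zeta>|circ. (norm (P j \<zeta> - P k \<zeta>))\<^sup>2) \<le> (1/8) ^ k) \<and>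
    (\<forall>z. norm z < 1 \<longrightarrow> (\<lambda>k. P k z) \<longlonglongrightarrow> h z) \<and>
    (AE \<zeta> in circ. \<exists>m. \<zeta> \<in> fast_points P m)"
proof -
  define a where "a n = (deriv ^^ n) h 0 / fact n" for n
  have a: "(\<lambda>n. a n * z ^ n) sums h z" if "norm z < 1" for z
    using holomorphic_power_series[OF h, of z] that by (simp add: a_def)
  have sa: "summable (\<lambda>n. (norm (a n))\<^sup>2)"
    by (rule bounded_imp_summable[where B="M\<^sup>2"])
       (use taylor_coefficients_bounded[OF h M a, of "Suc _"] in \<open>auto simp: lessThan_Suc_atMost\<close>)
  have "\<exists>n. \<forall>m\<ge>n. \<forall>j. (\<Sum>i=m..<j. (norm (a i))\<^sup>2) < (1/8)^k" for k :: nat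
  proof -
    have "\<forall>e>0. \<exists>N. \<forall>m\<ge>N. \<forall>n. norm (\<Sum>i=m..<n. (norm (a i))\<^sup>2) < e"
      using sa by (simp only: summable_Cauchy)
    moreover have "(1/8::real)^k > 0" by simp
    ultimately obtain N where N: "\<forall>m\<ge>N. \<forall>n. norm (\<Sum>i=m..<n. (norm (a i))\<^sup>2) < (1/8)^k" by blast
    have "(\<Sum>i=m..<j. (norm (a i))\<^sup>2) < (1/8)^k" if "m \<ge> N" for m j
      using N that abs_ge_self[of "\<Sum>i=m..<j. (norm (a i))\<^sup>2"] unfolding real_norm_def by (meson le_less_trans)
    then show ?thesis by blast
  qed
  then obtain n where n: "\<And>k m j. n k \<le> m \<Longrightarrow> (\<Sum>i=m..<j. (norm (a i))\<^sup>2) < (1/8)^k" by metis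
  define N where "N k = (\<Sum>i\<le>k. n i) + k" for k
  have nN: "n k \<le> N k" for k unfolding N_def by (rule trans_le_add1, rule member_le_sum) auto
  have monoN: "strict_mono N" by (rule strict_monoI_Suc) (simp add: N_def)
  define P where "P k z = (\<Sum>i<N k. a i * z ^ i)" for k z
  have diff: "P j z - P k z = (\<Sum>i=N k..<N j. a i * z ^ i)" if "k \<le> j" for j k z
  proof -
    have "N k \<le> N j" using monoN that by (simp add: strict_mono_less_eq)
    then have "{..<N j} = {..<N k} \<union> {N k..<N j}" by auto
    then show ?thesis unfolding P_def by (simp add: sum.union_disjoint ivl_disj_int)
  qed
  have holP: "P k holomorphic_on UNIV" for k unfolding P_def by (intro holomorphic_intros)
  have L2: "(LINT \<zeta>|circ. (norm (P j \<zeta> - P k \<zeta>))\<^sup>2) \<le> (1/8) ^ k" if "k \<le> j" for j k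
    unfolding diff[OF that] by (subst parseval_polynomial) (use n[OF nN] less_imp_le in auto)
  have lim: "(\<lambda>k. P k z) \<longlonglongrightarrow> h z" if "norm z < 1" for z
    using a[OF that] unfolding sums_def P_def
    by (rule filterlim_compose[OF _ filterlim_subseq[OF monoN]])
  define D where "D k z = P (Suc k) z - P k z" for k z
  define S where "S k = {\<zeta>\<in>sphere 0 1. \<exists>r\<in>{0..<1}. (1/2)^k < norm (D k (of_real r * \<zeta>))}" for k :: nat
  have holD: "D k holomorphic_on UNIV" for k unfolding D_def by (intro holomorphic_intros holP)
  have S: "S k \<in> sets circ" "measure circ (S k) \<le> 1280 * (1/2)^k" for k
  proof -
    note m = maximal_inequality_L2[OF holD[of k], of "(1/2)^k"]
    show "S k \<in> sets circ" unfolding S_def by (rule m(1)) simp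
    have "measure circ (S k) \<le> 1280 / ((1/2)^k)\<^sup>2 * (LINT \<eta>|circ. (norm (D k \<eta>))\<^sup>2)"
      unfolding S_def by (rule m(2)) simp
    also have "\<dots> \<le> 1280 / ((1/2)^k)\<^sup>2 * (1/8)^k"
      unfolding D_def by (intro mult_left_mono L2) auto
    also have "\<dots> = 1280 * (1/2)^k"
    proof -
      have "(8::real)^k = 2^k * 2^k * 2^k" by (simp flip: power_mult_distrib)
      then show ?thesis by (simp add: power_one_over power2_eq_square field_simps)
    qed
    finally show "measure circ (S k) \<le> 1280 * (1/2)^k" .
  qed
  have "summable (\<lambda>k. measure circ (S k))"
  proof (rule summable_comparison_test)
    show "\<exists>N. \<forall>n\<ge>N. norm (measure circ (S n)) \<le> 1280 * (1/2)^n" using S(2) by auto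
    show "summable (\<lambda>k. 1280 * (1/2::real)^k)" by (intro summable_mult summable_geometric) auto
  qed
  then have "AE \<zeta> in circ. eventually (\<lambda>k. \<zeta> \<in> space circ - S k) sequentially"
    by (intro borel_cantelli_AE1 S) (auto simp: circle.emeasure_eq_measure)
  then have "AE \<zeta> in circ. \<exists>m. \<zeta> \<in> fast_points P m"
  proof (rule AE_mp, intro AE_I2 impI)
    fix \<zeta> assume "eventually (\<lambda>k. \<zeta> \<in> space circ - S k) sequentially"
    then obtain m where m: "\<And>k. k \<ge> m \<Longrightarrow> \<zeta> \<in> sphere 0 1 - S k" by (auto simp: eventually_sequentially)
    have "norm (D k (of_real r * \<zeta>)) \<le> (1/2)^k" if "k \<ge> m" "r \<in> {0..1}" for k r
    proof (rule continuous_le_on_closure[where S="{0..<1::real}" and f="\<lambda>r. norm (D k (of_real r * \<zeta>))"])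
      have "continuous_on UNIV (D k)" using holD by (rule holomorphic_on_imp_continuous_on)
      then have "continuous_on (closure {0..<1}) (\<lambda>r. D k (of_real r * \<zeta>))"
        by (rule continuous_on_compose2) (auto intro!: continuous_intros)
      then show "continuous_on (closure {0..<1}) (\<lambda>r. norm (D k (of_real r * \<zeta>)))"
        by (rule continuous_on_norm)
      show "r \<in> closure {0..<1}" using that by simp
      show "norm (D k (of_real s * \<zeta>)) \<le> (1/2)^k" if "s \<in> {0..<1}" for s
        using m[OF \<open>k \<ge> m\<close>] that by (auto simp: S_def not_less)
    qed
    then have "\<zeta> \<in> fast_points P m"
      using m[of m] by (auto simp: fast_points_def D_def)
    then show "\<exists>m. \<zeta> \<in> fast_points P m" ..
  qed
  then show ?thesis using holP L2 lim by blast
qed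

definition radius :: "nat \<Rightarrow> real" where "radius n = 1 - 1 / (real n + 2)"

lemma radius_bounds: "0 < radius n" "radius n < 1" "0 \<le> radius n"
  by (auto simp: radius_def field_simps)

lemma radius_tendsto: "filterlim radius (at_left 1) sequentially"
proof -
  have "(\<lambda>n. 1 - 1 / (real n + 2)) \<longlonglongrightarrow> 1 - 0"
    using LIMSEQ_Suc[OF LIMSEQ_inverse_real_of_nat]
    by (intro tendsto_diff tendsto_const) (simp add: inverse_eq_divide add.commute)
  then show ?thesis using radius_bounds
    by (auto simp: filterlim_at radius_def[abs_def])
qed

text \<open>The limit is taken along one fixed sequence of radii, so that measurability is immediate.\<close>

definition bdry :: "(complex \<Rightarrow> complex) \<Rightarrow> complex \<Rightarrow> complex" where
  "bdry h \<zeta> = lim (\<lambda>n. h (of_real (radius n) * \<zeta>))"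

lemma bdry_eqI: "((\<lambda>r. h (of_real r * \<zeta>)) \<longlongrightarrow> l) (at_left 1) \<Longrightarrow> bdry h \<zeta> = l"
  unfolding bdry_def by (rule limI, rule filterlim_compose[OF _ radius_tendsto])

lemma measurable_dilate:
  assumes "continuous_on (ball 0 1) h" "0 \<le> r" "r < 1"
  shows "(\<lambda>\<zeta>. h (of_real r * \<zeta>)) \<in> borel_measurable circ"
  using assms by (intro borel_measurable_continuous_circle continuous_on_compose2[OF assms(1)] continuous_intros)
    (auto simp: norm_mult)

lemma measurable_bdry:
  assumes "continuous_on (ball 0 1) h"
  shows "bdry h \<in> borel_measurable circ"
  unfolding bdry_def using radius_bounds by (intro borel_measurable_lim_metric measurable_dilate assms)

lemma fast_points_radial_limit:
  assumes P: "\<And>k. P k holomorphic_on UNIV" and lim: "\<And>z. norm z < 1 \<Longrightarrow> (\<lambda>k. P k z) \<longlonglongrightarrow> h z"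
    and \<zeta>: "\<zeta> \<in> fast_points P m"
  shows "((\<lambda>r. h (of_real r * \<zeta>)) \<longlongrightarrow> bdry h \<zeta>) (at_left 1)" "(\<lambda>k. P k \<zeta>) \<longlonglongrightarrow> bdry h \<zeta>"
proof -
  have n\<zeta>: "norm \<zeta> = 1" using \<zeta> by (simp add: fast_points_def)
  obtain l where l: "uniform_limit {0..1} (\<lambda>k r. P k (of_real r * \<zeta>)) l sequentially"
    using geometric_uniform_limit[of m "{0..1}" "\<lambda>k r. P k (of_real r * \<zeta>)"] \<zeta> by (auto simp: fast_points_def)
  have "continuous_on UNIV (P k)" for k using P by (rule holomorphic_on_imp_continuous_on)
  then have "continuous_on {0..1} (\<lambda>r. P k (of_real r * \<zeta>))" for k
    by (rule continuous_on_compose2) (auto intro!: continuous_intros)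
  then have "continuous_on {0..1} l"
    by (intro uniform_limit_theorem[OF _ l] always_eventually allI) auto
  then have "(l \<longlongrightarrow> l 1) (at_left 1)"
    by (simp add: continuous_on_Icc_at_leftD)
  moreover have lh: "l r = h (of_real r * \<zeta>)" if "r \<in> {0<..<1}" for r
    using tendsto_uniform_limitI[OF l, of r] lim[of "of_real r * \<zeta>"] that n\<zeta>
    by (intro LIMSEQ_unique[of "\<lambda>k. P k (of_real r * \<zeta>)"]) (auto simp: norm_mult)
  then have "\<forall>\<^sub>F r in at_left 1. l r = h (of_real r * \<zeta>)"
    using eventually_at_left_real[of 0 1] by (auto elim!: eventually_mono)
  ultimately have t: "((\<lambda>r. h (of_real r * \<zeta>)) \<longlongrightarrow> l 1) (at_left 1)"
    by (rule Lim_transform_eventually)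
  then have "bdry h \<zeta> = l 1" by (rule bdry_eqI)
  then show "((\<lambda>r. h (of_real r * \<zeta>)) \<longlongrightarrow> bdry h \<zeta>) (at_left 1)" "(\<lambda>k. P k \<zeta>) \<longlonglongrightarrow> bdry h \<zeta>"
    using t tendsto_uniform_limitI[OF l, of 1] by auto
qed

lemma fast_points_closed:
  assumes P: "\<And>k. P k holomorphic_on UNIV"
  shows "closed (fast_points P m)"
proof -
  have c: "continuous_on UNIV (P k)" for k using P by (rule holomorphic_on_imp_continuous_on)
  have "fast_points P m = sphere 0 1 \<inter> (\<Inter>k\<in>{m..}. \<Inter>r\<in>{0..1::real}. {\<zeta>. norm (P (Suc k) (of_real r * \<zeta>) - P k (of_real r * \<zeta>)) \<le> (1/2) ^ k})"
    unfolding fast_points_def by auto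
  also have "closed \<dots>"
    by (intro closed_Int closed_INT ballI closed_Collect_le continuous_intros continuous_on_compose2[OF c]) auto
  finally show ?thesis .
qed

lemma fast_points_continuous:
  assumes P: "\<And>k. P k holomorphic_on UNIV" and lim: "\<And>z. norm z < 1 \<Longrightarrow> (\<lambda>k. P k z) \<longlonglongrightarrow> h z"
  shows "continuous_on (fast_points P m) (bdry h)"
proof -
  have c: "continuous_on UNIV (P k)" for k using P by (rule holomorphic_on_imp_continuous_on)
  obtain l where l: "uniform_limit (fast_points P m) P l sequentially"
  proof -
    have "norm (P (Suc k) \<zeta> - P k \<zeta>) \<le> (1/2) ^ k" if "m \<le> k" "\<zeta> \<in> fast_points P m" for k \<zeta>
    proof -
      have "norm (P (Suc k) (of_real 1 * \<zeta>) - P k (of_real 1 * \<zeta>)) \<le> (1/2) ^ k"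
        using that unfolding fast_points_def mem_Collect_eq by (metis atLeastAtMost_iff order_refl zero_le_one)
      then show ?thesis by simp
    qed
    then show thesis using geometric_uniform_limit[of m "fast_points P m" P] that by blast
  qed
  have "continuous_on (fast_points P m) l"
    by (intro uniform_limit_theorem[OF _ l] always_eventually allI continuous_on_subset[OF c]) auto
  moreover have "l \<zeta> = bdry h \<zeta>" if "\<zeta> \<in> fast_points P m" for \<zeta>
    using LIMSEQ_unique[OF tendsto_uniform_limitI[OF l that] fast_points_radial_limit(2)[OF P lim that]] .
  ultimately show ?thesis by (simp cong: continuous_on_cong)
qed

text \<open>At a fast point the approximating polynomials converge uniformly on the closed radius, so their
  continuity at its end point carries over to \<open>h\<close>.\<close>

theorem Fatou_radial_limit:
  assumes h: "h holomorphic_on ball 0 1" and M: "\<And>z. norm z < 1 \<Longrightarrow> norm (h z) \<le> M"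
  shows "AE \<zeta> in circ. ((\<lambda>r. h (of_real r * \<zeta>)) \<longlongrightarrow> bdry h \<zeta>) (at_left 1)"
proof -
  obtain P where P: "\<And>k. P k holomorphic_on UNIV" "\<And>z. norm z < 1 \<Longrightarrow> (\<lambda>k. P k z) \<longlonglongrightarrow> h z"
    "AE \<zeta> in circ. \<exists>m. \<zeta> \<in> fast_points P m"
    using bounded_fast_approximation[OF h M] by blast
  from P(3) show ?thesis
    by (rule AE_mp) (auto intro!: AE_I2 fast_points_radial_limit(1)[OF P(1,2)])
qed

lemma nn_integral_le_of_liminf:
  assumes "\<And>n. u n \<in> borel_measurable M" "AE x in M. v x \<le> liminf (\<lambda>n. u n x)"
    and "\<And>n. (\<integral>\<^sup>+x. u n x \<partial>M) \<le> c n" "c \<longlonglongrightarrow> c0"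
  shows "(\<integral>\<^sup>+x. v x \<partial>M) \<le> (c0 :: ennreal)"
proof -
  have "(\<integral>\<^sup>+x. v x \<partial>M) \<le> (\<integral>\<^sup>+x. liminf (\<lambda>n. u n x) \<partial>M)" by (rule nn_integral_mono_AE) (rule assms)
  also have "\<dots> \<le> liminf (\<lambda>n. \<integral>\<^sup>+x. u n x \<partial>M)" by (rule nn_integral_liminf) (rule assms)
  also have "\<dots> \<le> liminf c" by (rule Liminf_mono) (use assms(3) in auto)
  also have "\<dots> = c0" using assms(4) by (simp add: lim_imp_Liminf)
  finally show ?thesis .
qed

lemma AE_le_liminf:
  "AE x in M. (\<lambda>n. u n x) \<longlonglongrightarrow> v x \<Longrightarrow> AE x in M. v x \<le> liminf (\<lambda>n. u n x :: ennreal)"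
  by (erule AE_mp) (auto intro!: AE_I2 simp: lim_imp_Liminf)

lemma bdry_radius_tendsto:
  "((\<lambda>r. h (of_real r * \<zeta>)) \<longlongrightarrow> bdry h \<zeta>) (at_left 1) \<Longrightarrow> (\<lambda>n. h (of_real (radius n) * \<zeta>)) \<longlonglongrightarrow> bdry h \<zeta>"
  by (rule filterlim_compose[OF _ radius_tendsto])

section \<open>Uniqueness of boundary values\<close>

text \<open>Let \<open>M = 1\<close> and let \<open>A\<close> be the set where the boundary values vanish. Having no zeros, \<open>h\<close> has
  holomorphic \<open>n\<close>-th roots; they are bounded by \<open>1\<close>, and their boundary values vanish on \<open>A\<close> too. By the
  mean value property the \<open>n\<close>-th root of \<open>norm (h 0)\<close> is at most \<open>1\<close> minus the measure of \<open>A\<close>. As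
  \<open>n\<close> tends to infinity, that root tends to \<open>1\<close>.\<close>

lemma zero_free_boundary_nonzero:
  assumes h: "h holomorphic_on ball 0 1" and M: "\<And>z. norm z < 1 \<Longrightarrow> norm (h z) \<le> M"
    and nz: "\<And>z. norm z < 1 \<Longrightarrow> h z \<noteq> 0"
  shows "AE \<zeta> in circ. bdry h \<zeta> \<noteq> 0"
proof -
  have M0: "M > 0" using M[of 0] nz[of 0] by (metis norm_zero zero_less_norm_iff less_le_trans zero_less_one)
  obtain L where L: "L holomorphic_on ball 0 1" "\<And>z. z \<in> ball 0 1 \<Longrightarrow> h z = exp (L z)"
    by (rule contractible_imp_holomorphic_log[OF h convex_imp_contractible]) (use nz in auto)
  define A where "A = {\<zeta>\<in>space circ. bdry h \<zeta> = 0}"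
  have lim: "AE \<zeta> in circ. ((\<lambda>r. h (of_real r * \<zeta>)) \<longlongrightarrow> bdry h \<zeta>) (at_left 1)"
    by (rule Fatou_radial_limit[OF h M])
  have cont: "continuous_on (ball 0 1) h" using h by (rule holomorphic_on_imp_continuous_on)
  have A: "A \<in> sets circ"
    unfolding A_def by (rule measurable_equality_set) (auto intro: measurable_bdry cont)
  have bound: "measure circ A \<le> 1 - exp ((Re (L 0) - ln M) / real (Suc k))" for k
  proof -
    define f where "f z = exp ((L z - of_real (ln M)) / of_nat (Suc k))" for z
    have f: "f holomorphic_on ball 0 1" unfolding f_def by (intro holomorphic_intros L) auto
    have nf: "norm (f z) = (norm (h z) / M) powr (1 / real (Suc k))" if "norm z < 1" for z
    proof -
      have "norm (f z) = exp ((Re (L z) - ln M) / real (Suc k))"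
        unfolding f_def norm_exp_eq_Re
        by (simp only: Re_divide_of_nat minus_complex.sel Re_complex_of_real)
      moreover have "ln (norm (h z) / M) = Re (L z) - ln M"
        using L(2)[of z] that M0 by (simp add: ln_div)
      moreover have "norm (h z) / M > 0" using nz[OF that] M0 by simp
      ultimately show ?thesis using nz[OF that] M0 by (simp add: powr_def)
    qed
    have f1: "norm (f z) \<le> 1" if "norm z < 1" for z
    proof -
      have "norm (h z) / M \<le> 1" using M[OF that] M0 by simp
      then show ?thesis unfolding nf[OF that] using M0 by (intro powr_le1) auto
    qed
    have inball: "norm (of_real (radius n) * \<zeta>) < 1" if "norm \<zeta> = 1" for n and \<zeta> :: complex
      using that radius_bounds[of n] by (simp add: norm_mult)
    have cf: "continuous_on (sphere 0 1) (\<lambda>\<zeta>. f (of_real (radius n) * \<zeta>))" for n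
      by (rule continuous_on_compose2[OF holomorphic_on_imp_continuous_on[OF f]])
         (auto intro!: continuous_intros simp: inball)
    let ?u = "\<lambda>n \<zeta>. ennreal (1 - norm (f (of_real (radius n) * \<zeta>)))"
    have int: "(\<integral>\<^sup>+\<zeta>. ?u n \<zeta> \<partial>circ) \<le> ennreal (1 - norm (f 0))" for n
    proof -
      have "(\<integral>\<^sup>+\<zeta>. ?u n \<zeta> \<partial>circ) = ennreal (LINT \<zeta>|circ. 1 - norm (f (of_real (radius n) * \<zeta>)))"
        by (intro nn_integral_eq_integral integrable_continuous_circle continuous_intros cf AE_I2) (simp add: f1 inball)
      also have "(LINT \<zeta>|circ. 1 - norm (f (of_real (radius n) * \<zeta>)))
          = 1 - (LINT \<zeta>|circ. norm (f (of_real (radius n) * \<zeta>)))"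
        by (subst Bochner_Integration.integral_diff) (auto intro!: integrable_continuous_circle continuous_intros cf)
      also have "\<dots> \<le> 1 - norm (LINT \<zeta>|circ. f (of_real (radius n) * \<zeta>))"
        using integral_norm_bound[of circ "\<lambda>\<zeta>. f (of_real (radius n) * \<zeta>)"] by simp
      also have "(LINT \<zeta>|circ. f (of_real (radius n) * \<zeta>)) = f 0"
        by (rule mean_value_circle[OF f]) (use radius_bounds in auto)
      finally show ?thesis by (simp add: ennreal_leI)
    qed
    have "(\<integral>\<^sup>+\<zeta>. indicator A \<zeta> \<partial>circ) \<le> ennreal (1 - norm (f 0))"
    proof (rule nn_integral_le_of_liminf[where u = ?u])
      show "?u n \<in> borel_measurable circ" for n
        by (intro measurable_compose[OF borel_measurable_continuous_circle measurable_ennreal] continuous_intros cf)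
      show "AE \<zeta> in circ. indicator A \<zeta> \<le> liminf (\<lambda>n. ?u n \<zeta>)"
        using lim
      proof (rule AE_mp, intro AE_I2 impI)
        fix \<zeta> assume \<zeta>: "\<zeta> \<in> space circ" and t: "((\<lambda>r. h (of_real r * \<zeta>)) \<longlongrightarrow> bdry h \<zeta>) (at_left 1)"
        show "indicator A \<zeta> \<le> liminf (\<lambda>n. ?u n \<zeta>)"
        proof (cases "\<zeta> \<in> A")
          case True
          have "(\<lambda>n. norm (h (of_real (radius n) * \<zeta>)) / M) \<longlonglongrightarrow> norm (0::complex) / M"
            using bdry_radius_tendsto[OF t] True M0 by (intro tendsto_intros) (auto simp: A_def)
          then have "(\<lambda>n. (norm (h (of_real (radius n) * \<zeta>)) / M) powr (1 / real (Suc k))) \<longlonglongrightarrow> 0 powr (1 / real (Suc k))"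
            using M0 by (intro tendsto_powr') auto
          then have "(\<lambda>n. norm (f (of_real (radius n) * \<zeta>))) \<longlonglongrightarrow> 0"
            using \<zeta> by (simp add: nf inball)
          then have "(\<lambda>n. ?u n \<zeta>) \<longlonglongrightarrow> ennreal (1 - 0)"
            by (intro tendsto_intros tendsto_ennrealI)
          then show ?thesis by (simp add: lim_imp_Liminf indicator_def)
        qed simp
      qed
    qed (rule int, rule tendsto_const)
    then have "emeasure circ A \<le> ennreal (1 - norm (f 0))" using A by simp
    then have "measure circ A \<le> 1 - norm (f 0)"
      using f1[of 0] by (simp add: circle.emeasure_eq_measure)
    also have "norm (f 0) = exp ((Re (L 0) - ln M) / real (Suc k))"
      unfolding f_def norm_exp_eq_Re by (simp only: Re_divide_of_nat minus_complex.sel Re_complex_of_real)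
    finally show ?thesis .
  qed
  have "(\<lambda>k. 1 - exp ((Re (L 0) - ln M) * inverse (real (Suc k)))) \<longlonglongrightarrow> 1 - exp ((Re (L 0) - ln M) * 0)"
    by (intro tendsto_intros LIMSEQ_inverse_real_of_nat)
  then have "measure circ A \<le> 1 - exp ((Re (L 0) - ln M) * 0)"
    by (rule LIMSEQ_le_const) (use bound in \<open>auto simp: divide_inverse\<close>)
  then have "emeasure circ A = 0"
    by (simp add: circle.emeasure_eq_measure measure_le_0_iff)
  then have "A \<in> null_sets circ" using A by auto
  then show ?thesis
    by (rule AE_I'[of A]) (auto simp: A_def)
qed

text \<open>Let \<open>n\<close> tend to infinity in Poisson's formula for the dilations of \<open>h\<close> by \<open>radius n\<close>.\<close>

lemma boundary_zero_imp_zero: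
  assumes h: "h holomorphic_on ball 0 1" and M: "\<And>z. norm z < 1 \<Longrightarrow> norm (h z) \<le> M"
    and z: "AE \<zeta> in circ. bdry h \<zeta> = 0" and w: "norm w < 1"
  shows "h w = 0"
proof -
  have inball: "norm (of_real (radius n) * \<zeta>) < 1" if "norm \<zeta> \<le> 1" for n and \<zeta> :: complex
  proof -
    have "norm (of_real (radius n) * \<zeta>) = radius n * norm \<zeta>" using radius_bounds[of n] by (simp add: norm_mult)
    also have "\<dots> \<le> radius n" using that radius_bounds[of n] by (intro mult_left_le) auto
    finally show ?thesis using radius_bounds[of n] by simp
  qed
  have hn: "(\<lambda>z. h (of_real (radius n) * z)) holomorphic_on cball 0 1" for n
    by (intro holomorphic_on_compose_gen[OF _ h, unfolded o_def] holomorphic_intros) (auto simp: inball)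
  have eq: "(LINT \<eta>|circ. of_real (poisson w \<eta>) * h (of_real (radius n) * \<eta>)) = h (of_real (radius n) * w)" for n
    by (rule poisson_formula[OF hn w])
  have ch: "continuous_on (sphere 0 1) (\<lambda>z. h (of_real (radius n) * z))" for n
    using holomorphic_on_imp_continuous_on[OF hn[of n]] by (rule continuous_on_subset) auto
  have lim: "AE \<zeta> in circ. ((\<lambda>r. h (of_real r * \<zeta>)) \<longlongrightarrow> bdry h \<zeta>) (at_left 1)"
    by (rule Fatou_radial_limit[OF h M])
  have "(\<lambda>n. LINT \<eta>|circ. of_real (poisson w \<eta>) * h (of_real (radius n) * \<eta>)) \<longlonglongrightarrow> (LINT \<eta>|circ. 0)"
  proof (rule integral_dominated_convergence[where w = "\<lambda>\<eta>. poisson w \<eta> * M"])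
    show "(\<lambda>\<eta>. of_real (poisson w \<eta>) * h (of_real (radius n) * \<eta>)) \<in> borel_measurable circ" for n
      by (intro borel_measurable_continuous_circle continuous_intros continuous_on_of_real continuous_poisson w ch)
    show "integrable circ (\<lambda>\<eta>. poisson w \<eta> * M)"
      by (intro integrable_continuous_circle continuous_intros continuous_poisson w)
    show "AE \<eta> in circ. norm (of_real (poisson w \<eta>) * h (of_real (radius n) * \<eta>)) \<le> poisson w \<eta> * M" for n
      using poisson_nonneg[OF w] by (intro AE_I2) (auto simp: norm_mult intro!: mult_left_mono M inball)
    show "AE \<eta> in circ. (\<lambda>n. of_real (poisson w \<eta>) * h (of_real (radius n) * \<eta>)) \<longlonglongrightarrow> 0"
      using z lim
    proof eventually_elim
      case (elim \<eta>)
      then show ?case using bdry_radius_tendsto[OF elim(2)] by (auto intro!: tendsto_mult_right_zero)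
    qed
  qed simp
  then have "(\<lambda>n. h (of_real (radius n) * w)) \<longlonglongrightarrow> 0" by (simp add: eq)
  moreover have "(\<lambda>n. h (of_real (radius n) * w)) \<longlonglongrightarrow> h (of_real 1 * w)"
  proof (rule continuous_on_tendsto_compose[OF holomorphic_on_imp_continuous_on[OF h]])
    have "radius \<longlonglongrightarrow> 1" using radius_tendsto by (simp add: filterlim_at)
    then show "(\<lambda>n. of_real (radius n) * w) \<longlonglongrightarrow> of_real 1 * w" by (intro tendsto_intros)
  qed (use w inball in auto)
  ultimately show ?thesis using LIMSEQ_unique by fastforce
qed

section \<open>Inner functions on the circle\<close>

lemma poisson_le:
  assumes "norm \<eta> = 1" "norm w < 1"
  shows "poisson w \<eta> \<le> (1 + norm w) / (1 - norm w)"
proof -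
  have "1 - norm w \<le> norm (\<eta> - w)" using norm_triangle_ineq2[of \<eta> w] assms by simp
  then have "poisson w \<eta> \<le> (1 - (norm w)\<^sup>2) / (1 - norm w)\<^sup>2"
    unfolding poisson_def using assms by (intro divide_left_mono power_mono mult_pos_pos) (auto simp: power_le_one)
  also have "\<dots> = (1 + norm w) / (1 - norm w)"
  proof -
    have "1 - (norm w)\<^sup>2 = (1 - norm w) * (1 + norm w)" by (simp add: power2_eq_square algebra_simps)
    then show ?thesis using assms by (simp add: power2_eq_square)
  qed
  finally show ?thesis .
qed

text \<open>As a function of \<open>z\<close>, the kernel \<open>poisson (g z) \<eta>\<close> is the real part of the holomorphic function
  \<open>(\<eta> + g z) / (\<eta> - g z)\<close>.\<close>

lemma poisson_mean:
  assumes g: "g holomorphic_on ball 0 1" and gd: "\<And>z. norm z < 1 \<Longrightarrow> norm (g z) < 1"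
    and \<eta>: "norm \<eta> = 1" and r: "0 \<le> r" "r < 1"
  shows "(\<integral>\<^sup>+\<zeta>. poisson (g (of_real r * \<zeta>)) \<eta> \<partial>circ) = poisson (g 0) \<eta>"
proof -
  let ?f = "\<lambda>z. (\<eta> + g z) / (\<eta> - g z)"
  have f: "?f holomorphic_on ball 0 1"
    using gd \<eta> by (intro holomorphic_intros g) force
  have inball: "norm (of_real r * \<zeta>) < 1" if "norm \<zeta> = 1" for \<zeta> :: complex
    using that r by (simp add: norm_mult)
  have cf: "continuous_on (sphere 0 1) (\<lambda>\<zeta>. ?f (of_real r * \<zeta>))"
    by (rule continuous_on_compose2[OF holomorphic_on_imp_continuous_on[OF f]])
       (auto intro!: continuous_intros simp: inball)
  have "(\<integral>\<^sup>+\<zeta>. poisson (g (of_real r * \<zeta>)) \<eta> \<partial>circ) = (\<integral>\<^sup>+\<zeta>. Re (?f (of_real r * \<zeta>)) \<partial>circ)"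
    by (intro nn_integral_cong) (auto simp: poisson_Re[OF \<eta>] gd inball)
  also have "\<dots> = ennreal (LINT \<zeta>|circ. Re (?f (of_real r * \<zeta>)))"
  proof (intro nn_integral_eq_integral AE_I2)
    show "integrable circ (\<lambda>\<zeta>. Re (?f (of_real r * \<zeta>)))"
      by (intro integrable_continuous_circle continuous_on_Re cf)
    show "0 \<le> Re (?f (of_real r * \<zeta>))" if "\<zeta> \<in> space circ" for \<zeta>
      using that poisson_nonneg[of "g (of_real r * \<zeta>)" \<eta>] by (simp add: poisson_Re[OF \<eta>, symmetric] gd inball)
  qed
  also have "(LINT \<zeta>|circ. Re (?f (of_real r * \<zeta>))) = Re (LINT \<zeta>|circ. ?f (of_real r * \<zeta>))"
    by (rule integral_Re) (intro integrable_continuous_circle cf)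
  also have "(LINT \<zeta>|circ. ?f (of_real r * \<zeta>)) = ?f 0"
    by (rule mean_value_circle[OF f r])
  also have "Re (?f 0) = poisson (g 0) \<eta>" using gd[of 0] by (simp add: poisson_Re[OF \<eta>])
  finally show ?thesis .
qed

lemma borel_measurable_circle_id [measurable]: "(\<lambda>\<eta>. \<eta>) \<in> borel_measurable circ"
  by (intro borel_measurable_continuous_circle continuous_intros)

text \<open>Littlewood's subordination principle for Poisson integrals. The order of integration is exchanged and the
  inner integral is a mean value; the constant is Harnack's bound for the kernel at \<open>g 0\<close>.\<close>

lemma poisson_subordination:
  fixes q :: "complex \<Rightarrow> ennreal"
  assumes g: "g holomorphic_on ball 0 1" and gd: "\<And>z. norm z < 1 \<Longrightarrow> norm (g z) < 1"
    and r: "0 \<le> r" "r < 1" and q [measurable]: "q \<in> borel_measurable circ"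
  shows "(\<integral>\<^sup>+\<zeta>. (\<integral>\<^sup>+\<eta>. q \<eta> * poisson (g (of_real r * \<zeta>)) \<eta> \<partial>circ) \<partial>circ)
    \<le> ennreal ((1 + norm (g 0)) / (1 - norm (g 0))) * (\<integral>\<^sup>+\<eta>. q \<eta> \<partial>circ)"
proof -
  have [measurable]: "(\<lambda>\<zeta>. g (of_real r * \<zeta>)) \<in> borel_measurable circ"
    by (intro measurable_dilate holomorphic_on_imp_continuous_on g r)
  interpret pair_sigma_finite circ circ ..
  have "(\<integral>\<^sup>+\<zeta>. (\<integral>\<^sup>+\<eta>. q \<eta> * poisson (g (of_real r * \<zeta>)) \<eta> \<partial>circ) \<partial>circ)
     = (\<integral>\<^sup>+\<eta>. (\<integral>\<^sup>+\<zeta>. q \<eta> * poisson (g (of_real r * \<zeta>)) \<eta> \<partial>circ) \<partial>circ)"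
    unfolding poisson_def by (rule Fubini'[symmetric]) measurable
  also have "\<dots> = (\<integral>\<^sup>+\<eta>. q \<eta> * (\<integral>\<^sup>+\<zeta>. poisson (g (of_real r * \<zeta>)) \<eta> \<partial>circ) \<partial>circ)"
    unfolding poisson_def by (intro nn_integral_cong nn_integral_cmult) measurable
  also have "\<dots> = (\<integral>\<^sup>+\<eta>. q \<eta> * poisson (g 0) \<eta> \<partial>circ)"
    by (intro nn_integral_cong) (simp add: poisson_mean[OF g gd _ r])
  also have "\<dots> \<le> (\<integral>\<^sup>+\<eta>. ennreal ((1 + norm (g 0)) / (1 - norm (g 0))) * q \<eta> \<partial>circ)"
    using gd[of 0] by (intro nn_integral_mono) (auto simp: mult.commute[of "q _"] intro!: mult_right_mono ennreal_leI poisson_le)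
  also have "\<dots> = ennreal ((1 + norm (g 0)) / (1 - norm (g 0))) * (\<integral>\<^sup>+\<eta>. q \<eta> \<partial>circ)"
    by (rule nn_integral_cmult) measurable
  finally show ?thesis .
qed

text \<open>The default value \<open>1\<close> makes the boundary map a self-map of the circle.\<close>

definition bmap :: "(complex \<Rightarrow> complex) \<Rightarrow> complex \<Rightarrow> complex" where
  "bmap g \<zeta> = (if norm (bdry g \<zeta>) = 1 then bdry g \<zeta> else 1)"

lemma norm_bmap [simp]: "norm (bmap g \<zeta>) = 1"
  by (simp add: bmap_def)

lemma measurable_bmap:
  assumes "continuous_on (ball 0 1) g"
  shows "bmap g \<in> circ \<rightarrow>\<^sub>M circ"
proof (subst measurable_cong_sets[OF refl sets_circle], rule measurable_restrict_space2)
  have [measurable]: "bdry g \<in> borel_measurable circ" by (rule measurable_bdry[OF assms])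
  show "bmap g \<in> borel_measurable circ" unfolding bmap_def by measurable
qed auto

text \<open>Outside a neighbourhood of \<open>\<eta>0\<close> the kernels tend to \<open>0\<close> uniformly, while their total mass is \<open>1\<close>.\<close>

lemma poisson_concentrates:
  assumes w: "w \<longlonglongrightarrow> \<eta>0" "\<And>n. norm (w n) < 1" and \<eta>0: "norm \<eta>0 = 1" "\<eta>0 \<in> A" "open A"
  shows "1 \<le> liminf (\<lambda>n. \<integral>\<^sup>+\<eta>. indicator A \<eta> * ennreal (poisson (w n) \<eta>) \<partial>circ)"
proof -
  obtain d where d: "d > 0" "ball \<eta>0 d \<subseteq> A" using \<eta>0 open_contains_ball by metis
  let ?e = "\<lambda>n. (1 - (norm (w n))\<^sup>2) / (d/2)\<^sup>2"
  have "(\<lambda>n. ennreal (1 - ?e n)) \<longlonglongrightarrow> ennreal (1 - (1 - (norm \<eta>0)\<^sup>2) / (d/2)\<^sup>2)"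
    using d by (intro tendsto_ennrealI tendsto_intros w) auto
  then have "1 = liminf (\<lambda>n. ennreal (1 - ?e n))" using \<eta>0 by (simp add: lim_imp_Liminf)
  also have "\<dots> \<le> liminf (\<lambda>n. \<integral>\<^sup>+\<eta>. indicator A \<eta> * ennreal (poisson (w n) \<eta>) \<partial>circ)"
  proof (rule Liminf_mono)
    have "\<forall>\<^sub>F n in sequentially. dist (w n) \<eta>0 < d/2" using w(1) d by (intro tendstoD) auto
    then show "\<forall>\<^sub>F n in sequentially. ennreal (1 - ?e n) \<le> (\<integral>\<^sup>+\<eta>. indicator A \<eta> * ennreal (poisson (w n) \<eta>) \<partial>circ)"
    proof eventually_elim
      case (elim n)
      let ?P = "poisson (w n)"
      have A: "A \<in> sets borel" using \<eta>0 by simp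
      have cP: "continuous_on (sphere 0 1) ?P" by (rule continuous_poisson[OF w(2)])
      have pt: "?P \<eta> - ?e n \<le> indicator A \<eta> * ?P \<eta>" if "norm \<eta> = 1" for \<eta>
      proof (cases "\<eta> \<in> A")
        case True
        then show ?thesis using w(2)[of n] by (simp add: power_le_one)
      next
        case False
        then have "d \<le> dist \<eta>0 \<eta>" using d(2) by (meson linorder_not_le mem_ball subsetD)
        also have "\<dots> \<le> dist \<eta>0 (w n) + dist (w n) \<eta>" by (rule dist_triangle)
        finally have "d/2 \<le> norm (\<eta> - w n)" using elim by (simp add: dist_commute dist_norm)
        then have "?P \<eta> \<le> ?e n" unfolding poisson_def using d w(2)[of n]
          by (intro divide_left_mono power_mono mult_pos_pos) (auto simp: power_le_one)
        then show ?thesis using False by simp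
      qed
      have "1 - ?e n = (LINT \<eta>|circ. ?P \<eta> - ?e n)"
        by (subst Bochner_Integration.integral_diff) (auto intro!: integrable_continuous_circle cP simp: integral_poisson w)
      also have "\<dots> \<le> (LINT \<eta>|circ. indicator A \<eta> * ?P \<eta>)"
      proof (rule integral_mono)
        show "integrable circ (\<lambda>\<eta>. ?P \<eta> - ?e n)"
          by (intro integrable_continuous_circle continuous_intros cP)
        show "integrable circ (\<lambda>\<eta>. indicator A \<eta> * ?P \<eta>)"
          by (rule integrable_indicator_circle[OF cP A])
      qed (simp add: pt)
      finally have "ennreal (1 - ?e n) \<le> ennreal (LINT \<eta>|circ. indicator A \<eta> * ?P \<eta>)" by (rule ennreal_leI)
      also have "\<dots> = (\<integral>\<^sup>+\<eta>. ennreal (indicator A \<eta> * ?P \<eta>) \<partial>circ)"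
        by (intro nn_integral_eq_integral[symmetric] integrable_indicator_circle cP A AE_I2) (simp add: poisson_nonneg w)
      also have "\<dots> = (\<integral>\<^sup>+\<eta>. indicator A \<eta> * ennreal (?P \<eta>) \<partial>circ)"
        by (intro nn_integral_cong) (auto simp: indicator_def)
      finally show ?case .
    qed
  qed
  finally show ?thesis .
qed

text \<open>At points that \<open>bmap g\<close> sends into \<open>A\<close>, the Poisson integral of the indicator of \<open>A\<close>, composed
  with \<open>g\<close>, tends to \<open>1\<close> along the radius. Its integrals over the circles of radius less than \<open>1\<close> are
  bounded by subordination.\<close>

lemma bmap_nonsingular_open:
  assumes g: "g holomorphic_on ball 0 1" and gd: "\<And>z. norm z < 1 \<Longrightarrow> norm (g z) < 1"
    and inner: "AE \<zeta> in circ. norm (bdry g \<zeta>) = 1" and A: "open A"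
  shows "emeasure circ (bmap g -` A \<inter> sphere 0 1)
    \<le> ennreal ((1 + norm (g 0)) / (1 - norm (g 0))) * emeasure circ (A \<inter> sphere 0 1)"
proof -
  have cg: "continuous_on (ball 0 1) g" using g by (rule holomorphic_on_imp_continuous_on)
  have Fg: "AE \<zeta> in circ. ((\<lambda>r. g (of_real r * \<zeta>)) \<longlongrightarrow> bdry g \<zeta>) (at_left 1)"
    by (rule Fatou_radial_limit[OF g less_imp_le[OF gd]])
  let ?B = "bmap g -` A \<inter> sphere 0 1"
  let ?C = "ennreal ((1 + norm (g 0)) / (1 - norm (g 0)))"
  let ?I = "\<lambda>w. \<integral>\<^sup>+\<eta>. indicator A \<eta> * ennreal (poisson w \<eta>) \<partial>circ"
  have "bmap g -` (A \<inter> sphere 0 1) \<inter> space circ \<in> sets circ"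
    by (rule measurable_sets[OF measurable_bmap[OF cg] sets_circle_Int_open[OF A]])
  moreover have "bmap g -` (A \<inter> sphere 0 1) \<inter> space circ = ?B" by auto
  ultimately have B: "?B \<in> sets circ" by simp
  have q: "(indicator A :: _ \<Rightarrow> ennreal) \<in> borel_measurable circ"
    using A by (intro measurable_compose[OF borel_measurable_circle_id]) simp
  have "(\<integral>\<^sup>+\<zeta>. indicator ?B \<zeta> \<partial>circ) \<le> ?C * (\<integral>\<^sup>+\<eta>. indicator A \<eta> \<partial>circ)"
  proof (rule nn_integral_le_of_liminf[where u = "\<lambda>n \<zeta>. ?I (g (of_real (radius n) * \<zeta>))"])
    show "(\<lambda>\<zeta>. ?I (g (of_real (radius n) * \<zeta>))) \<in> borel_measurable circ" for n
    proof -
      have [measurable]: "(\<lambda>\<zeta>. g (of_real (radius n) * \<zeta>)) \<in> borel_measurable circ"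
        using radius_bounds by (intro measurable_dilate cg) auto
      have [measurable]: "A \<in> sets borel" using A by simp
      show ?thesis unfolding poisson_def by measurable
    qed
    show "AE \<zeta> in circ. indicator ?B \<zeta> \<le> liminf (\<lambda>n. ?I (g (of_real (radius n) * \<zeta>)))"
      using inner Fg AE_space
    proof eventually_elim
      case (elim \<zeta>)
      show ?case
      proof (cases "\<zeta> \<in> ?B")
        case True
        have "bmap g \<zeta> = bdry g \<zeta>" using elim(1) by (simp add: bmap_def)
        moreover have "norm (of_real (radius n) * \<zeta>) < 1" for n using elim(3) radius_bounds[of n] by (simp add: norm_mult)
        ultimately have "1 \<le> liminf (\<lambda>n. ?I (g (of_real (radius n) * \<zeta>)))"
          using True A elim(1) by (intro poisson_concentrates[OF bdry_radius_tendsto[OF elim(2)]] gd) auto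
        then show ?thesis using True by simp
      qed simp
    qed
    show "(\<integral>\<^sup>+\<zeta>. ?I (g (of_real (radius n) * \<zeta>)) \<partial>circ) \<le> ?C * (\<integral>\<^sup>+\<eta>. indicator A \<eta> \<partial>circ)" for n
      by (rule poisson_subordination[OF g gd _ _ q]) (use radius_bounds in auto)
  qed (rule tendsto_const)
  also have "(\<integral>\<^sup>+\<eta>. indicator A \<eta> \<partial>circ) = (\<integral>\<^sup>+\<eta>. indicator (A \<inter> sphere 0 1) \<eta> \<partial>circ)"
    by (intro nn_integral_cong) (auto simp: indicator_def)
  finally show ?thesis using B sets_circle_Int_open[OF A] by simp
qed

text \<open>By outer regularity the estimate for open sets makes preimages of null sets null. Properties that hold almost
  everywhere can therefore be followed along orbits of the boundary map.\<close>

lemma bmap_AE: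
  assumes g: "g holomorphic_on ball 0 1" and gd: "\<And>z. norm z < 1 \<Longrightarrow> norm (g z) < 1"
    and inner: "AE \<zeta> in circ. norm (bdry g \<zeta>) = 1"
    and Q: "AE \<zeta> in circ. Q \<zeta>"
  shows "AE \<zeta> in circ. Q (bmap g \<zeta>)"
proof -
  have cg: "continuous_on (ball 0 1) g" using g by (rule holomorphic_on_imp_continuous_on)
  define C where "C = (1 + norm (g 0)) / (1 - norm (g 0))"
  have C: "C > 0" using gd[of 0] by (auto simp: C_def add_pos_nonneg)
  obtain N where N: "N \<in> null_sets circ" "{\<zeta>\<in>sphere 0 1. \<not> Q \<zeta>} \<subseteq> N"
    using Q by (auto simp: eventually_ae_filter)
  then have Ns: "N \<in> sets circ" by auto
  then obtain N' where N': "N' \<in> sets borel" "N = N' \<inter> sphere 0 1"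
    by (auto simp: sets_circle sets_restrict_space)
  let ?lam = "distr circ borel (\<lambda>x. x)"
  have em: "emeasure ?lam X = emeasure circ (X \<inter> sphere 0 1)" if "X \<in> sets borel" for X
    using that by (subst emeasure_distr) (auto simp: vimage_def)
  have "emeasure ?lam (space ?lam) \<noteq> \<infinity>" by (subst em) (auto simp: circle.emeasure_eq_measure)
  then have "emeasure ?lam N' = (INF U \<in> {U. N' \<subseteq> U \<and> open U}. emeasure ?lam U)"
    using N' by (intro outer_regular) auto
  moreover have "emeasure ?lam N' = 0" using em[OF N'(1)] N(1) N'(2) by auto
  ultimately have inf: "(INF U \<in> {U. N' \<subseteq> U \<and> open U}. emeasure ?lam U) = 0" by simp
  let ?B = "bmap g -` N \<inter> space circ"
  have B: "?B \<in> sets circ" by (rule measurable_sets[OF measurable_bmap[OF cg] Ns])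
  have "emeasure circ ?B \<le> 0 + ennreal e" if "e > 0" for e
  proof -
    have "(INF U \<in> {U. N' \<subseteq> U \<and> open U}. emeasure ?lam U) < ennreal (e / C)" using inf that C by simp
    then obtain U where U: "N' \<subseteq> U" "open U" "emeasure ?lam U < ennreal (e / C)" by (auto simp: INF_less_iff)
    have "?B \<subseteq> bmap g -` U \<inter> sphere 0 1" using U(1) N'(2) by auto
    moreover have "bmap g -` U \<inter> sphere 0 1 = bmap g -` (U \<inter> sphere 0 1) \<inter> space circ" by auto
    then have "bmap g -` U \<inter> sphere 0 1 \<in> sets circ"
      using measurable_sets[OF measurable_bmap[OF cg] sets_circle_Int_open[OF U(2)]] by simp
    ultimately have "emeasure circ ?B \<le> emeasure circ (bmap g -` U \<inter> sphere 0 1)"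
      by (rule emeasure_mono)
    also have "\<dots> \<le> ennreal C * emeasure circ (U \<inter> sphere 0 1)"
      unfolding C_def by (rule bmap_nonsingular_open[OF g gd inner U(2)])
    also have "\<dots> \<le> ennreal C * ennreal (e / C)"
      using U em[of U] by (intro mult_left_mono) auto
    also have "\<dots> = ennreal e" using C that by (subst ennreal_mult[symmetric]) auto
    finally show ?thesis by simp
  qed
  then have "emeasure circ ?B \<le> 0" by (rule ennreal_le_epsilon)
  then have "?B \<in> null_sets circ" using B by auto
  moreover have "{\<zeta>\<in>space circ. \<not> Q (bmap g \<zeta>)} \<subseteq> ?B"
    using N(2) norm_bmap[of g] by (auto simp: subset_iff)
  ultimately show ?thesis by (rule AE_I')
qed

lemma bmap_iterate_AE:
  assumes "g holomorphic_on ball 0 1" and "\<And>z. norm z < 1 \<Longrightarrow> norm (g z) < 1"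
    and "AE \<zeta> in circ. norm (bdry g \<zeta>) = 1"
    and "AE \<zeta> in circ. Q \<zeta>"
  shows "AE \<zeta> in circ. \<forall>n. Q ((bmap g ^^ n) \<zeta>)"
proof (subst AE_all_countable, rule allI)
  fix n show "AE \<zeta> in circ. Q ((bmap g ^^ n) \<zeta>)"
  proof (induction n)
    case (Suc n)
    show ?case unfolding funpow_Suc_right o_def by (rule bmap_AE[OF assms(1-3) Suc])
  qed (simp add: assms(4))
qed

text \<open>By Poisson's formula for \<open>p\<^sup>2\<close>, the square of \<open>norm \<circ> p\<close> is at most the Poisson integral of its own
  values on the circle.\<close>

lemma polynomial_subordination:
  assumes g: "g holomorphic_on ball 0 1" and gd: "\<And>z. norm z < 1 \<Longrightarrow> norm (g z) < 1"
    and r: "0 \<le> r" "r < 1" and p: "p holomorphic_on UNIV"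
  shows "(\<integral>\<^sup>+\<zeta>. ennreal ((norm (p (g (of_real r * \<zeta>))))\<^sup>2) \<partial>circ)
    \<le> ennreal ((1 + norm (g 0)) / (1 - norm (g 0))) * ennreal (LINT \<eta>|circ. (norm (p \<eta>))\<^sup>2)"
proof -
  have cp: "continuous_on A p" for A
    using p holomorphic_on_imp_continuous_on continuous_on_subset by blast
  have p2: "(\<lambda>z. (p z)\<^sup>2) holomorphic_on cball 0 1"
    by (intro holomorphic_intros holomorphic_on_subset[OF p]) auto
  let ?q = "\<lambda>\<eta>. ennreal ((norm (p \<eta>))\<^sup>2)"
  have q: "?q \<in> borel_measurable circ"
    by (intro measurable_compose[OF borel_measurable_continuous_circle measurable_ennreal] continuous_intros cp)
  have le: "ennreal ((norm (p w))\<^sup>2) \<le> (\<integral>\<^sup>+\<eta>. ?q \<eta> * poisson w \<eta> \<partial>circ)" if w: "norm w < 1" for w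
  proof -
    have "(norm (p w))\<^sup>2 = norm (LINT \<eta>|circ. of_real (poisson w \<eta>) * (p \<eta>)\<^sup>2)"
      by (subst poisson_formula[OF p2 w]) (simp add: norm_power)
    also have "\<dots> \<le> (LINT \<eta>|circ. norm (of_real (poisson w \<eta>) * (p \<eta>)\<^sup>2))" by (rule integral_norm_bound)
    also have "\<dots> = (LINT \<eta>|circ. (norm (p \<eta>))\<^sup>2 * poisson w \<eta>)"
      using poisson_nonneg[OF w] by (intro Bochner_Integration.integral_cong refl) (simp add: norm_mult norm_power)
    finally have "ennreal ((norm (p w))\<^sup>2) \<le> ennreal (LINT \<eta>|circ. (norm (p \<eta>))\<^sup>2 * poisson w \<eta>)" by (rule ennreal_leI)
    also have "\<dots> = (\<integral>\<^sup>+\<eta>. ennreal ((norm (p \<eta>))\<^sup>2 * poisson w \<eta>) \<partial>circ)"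
      using poisson_nonneg[OF w]
      by (intro nn_integral_eq_integral[symmetric] integrable_continuous_circle continuous_intros cp continuous_poisson w AE_I2) auto
    also have "\<dots> = (\<integral>\<^sup>+\<eta>. ?q \<eta> * poisson w \<eta> \<partial>circ)"
      using poisson_nonneg[OF w] by (intro nn_integral_cong) (simp add: ennreal_mult)
    finally show ?thesis .
  qed
  have "(\<integral>\<^sup>+\<zeta>. ennreal ((norm (p (g (of_real r * \<zeta>))))\<^sup>2) \<partial>circ)
     \<le> (\<integral>\<^sup>+\<zeta>. (\<integral>\<^sup>+\<eta>. ?q \<eta> * poisson (g (of_real r * \<zeta>)) \<eta> \<partial>circ) \<partial>circ)"
    using r by (intro nn_integral_mono le gd) (simp add: norm_mult)
  also have "\<dots> \<le> ennreal ((1 + norm (g 0)) / (1 - norm (g 0))) * (\<integral>\<^sup>+\<eta>. ?q \<eta> \<partial>circ)"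
    by (rule poisson_subordination[OF g gd r q])
  also have "(\<integral>\<^sup>+\<eta>. ?q \<eta> \<partial>circ) = ennreal (LINT \<eta>|circ. (norm (p \<eta>))\<^sup>2)"
    by (intro nn_integral_eq_integral integrable_continuous_circle continuous_intros cp) auto
  finally show ?thesis .
qed

text \<open>Since \<open>g (r * \<zeta>)\<close> may approach its limit tangentially, radial limits of \<open>h\<close> do not settle this
  directly. For polynomials the assertion is continuity. The polynomials \<open>P k\<close> approximate \<open>h\<close> in the mean, by
  subordination \<open>P k \<circ> g\<close> approximates \<open>h \<circ> g\<close> in the mean on all circles uniformly, and since \<open>bmap g\<close>
  is non-singular, \<open>P k \<circ> bmap g\<close> converges almost everywhere to \<open>bdry h \<circ> bmap g\<close>.\<close>

theorem bdry_compose_inner: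
  assumes g: "g holomorphic_on ball 0 1" and gd: "\<And>z. norm z < 1 \<Longrightarrow> norm (g z) < 1"
    and inner: "AE \<zeta> in circ. norm (bdry g \<zeta>) = 1"
    and h: "h holomorphic_on ball 0 1" and M: "\<And>z. norm z < 1 \<Longrightarrow> norm (h z) \<le> M"
  shows "AE \<zeta> in circ. ((\<lambda>r. h (g (of_real r * \<zeta>))) \<longlongrightarrow> bdry h (bmap g \<zeta>)) (at_left 1)"
proof -
  let ?g = "\<lambda>n \<zeta>. g (of_real (radius n) * \<zeta>)" and ?b = "bdry (\<lambda>z. h (g z))"
  define C where "C = (1 + norm (g 0)) / (1 - norm (g 0))"
  have C: "C > 0" using gd[of 0] by (auto simp: C_def add_pos_nonneg)
  obtain P where P: "\<And>k. P k holomorphic_on UNIV"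
    and L2: "\<And>j k. k \<le> j \<Longrightarrow> (LINT \<zeta>|circ. (norm (P j \<zeta> - P k \<zeta>))\<^sup>2) \<le> (1/8) ^ k"
    and lim: "\<And>z. norm z < 1 \<Longrightarrow> (\<lambda>k. P k z) \<longlonglongrightarrow> h z"
    and fast: "AE \<zeta> in circ. \<exists>m. \<zeta> \<in> fast_points P m"
    using bounded_fast_approximation[OF h M] by blast
  have cP: "continuous_on A (P k)" for A k
    using P holomorphic_on_imp_continuous_on continuous_on_subset by blast
  have hg: "(\<lambda>z. h (g z)) holomorphic_on ball 0 1"
    by (intro holomorphic_on_compose_gen[OF g h, unfolded o_def]) (auto simp: gd)
  have cg: "continuous_on (ball 0 1) g" and chg: "continuous_on (ball 0 1) (\<lambda>z. h (g z))"
    and ch: "continuous_on (ball 0 1) h"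
    using g hg h by (auto intro: holomorphic_on_imp_continuous_on)
  have Fg: "AE \<zeta> in circ. ((\<lambda>r. g (of_real r * \<zeta>)) \<longlongrightarrow> bdry g \<zeta>) (at_left 1)"
    by (rule Fatou_radial_limit[OF g less_imp_le[OF gd]])
  have Fhg: "AE \<zeta> in circ. ((\<lambda>r. h (g (of_real r * \<zeta>))) \<longlongrightarrow> ?b \<zeta>) (at_left 1)"
    by (rule Fatou_radial_limit[OF hg, of M]) (auto intro: M gd)
  have [measurable]: "bmap g \<in> borel_measurable circ"
  proof -
    have [measurable]: "bdry g \<in> borel_measurable circ" by (rule measurable_bdry[OF cg])
    show ?thesis unfolding bmap_def by measurable
  qed
  have mP: "P k \<in> borel_measurable borel" for k by (intro borel_measurable_continuous_onI cP)
  have mg: "(\<lambda>\<zeta>. ?g n \<zeta>) \<in> borel_measurable circ"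
    and mhg: "(\<lambda>\<zeta>. h (?g n \<zeta>)) \<in> borel_measurable circ" for n
    using radius_bounds measurable_dilate[OF cg] measurable_dilate[OF chg] by auto
  have Pg: "(\<lambda>\<zeta>. P k (?g n \<zeta>)) \<in> borel_measurable circ" for k n
    by (rule measurable_compose[OF mg mP])
  have Pb: "(\<lambda>\<zeta>. P k (bmap g \<zeta>)) \<in> borel_measurable circ" for k
    by (rule measurable_compose[OF _ mP]) measurable
  have mbd: "?b \<in> borel_measurable circ"
    by (rule measurable_bdry[OF chg])
  have meas2: "(\<lambda>\<zeta>. ennreal ((norm (u \<zeta> - v \<zeta>))\<^sup>2)) \<in> borel_measurable circ"
    if "u \<in> borel_measurable circ" "v \<in> borel_measurable circ" for u v :: "complex \<Rightarrow> complex"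
    using that by measurable
  have inball: "norm (of_real (radius n) * \<zeta>) < 1" if "norm \<zeta> = 1" for n and \<zeta> :: complex
    using that radius_bounds[of n] by (simp add: norm_mult)
  have step1: "(\<integral>\<^sup>+\<zeta>. ennreal ((norm (P k (?g n \<zeta>) - h (?g n \<zeta>)))\<^sup>2) \<partial>circ)
      \<le> ennreal (C * (1/8)^k)" for k n
  proof (rule nn_integral_le_of_liminf[where u = "\<lambda>j \<zeta>. ennreal ((norm (P k (?g n \<zeta>) - P (j + k) (?g n \<zeta>)))\<^sup>2)"])
    show "AE \<zeta> in circ. ennreal ((norm (P k (?g n \<zeta>) - h (?g n \<zeta>)))\<^sup>2)
       \<le> liminf (\<lambda>j. ennreal ((norm (P k (?g n \<zeta>) - P (j + k) (?g n \<zeta>)))\<^sup>2))"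
      by (intro AE_le_liminf AE_I2 tendsto_ennrealI tendsto_intros LIMSEQ_ignore_initial_segment[OF lim] gd inball) simp
    fix j
    have "(\<integral>\<^sup>+\<zeta>. ennreal ((norm (P k (?g n \<zeta>) - P (j + k) (?g n \<zeta>)))\<^sup>2) \<partial>circ)
      \<le> ennreal C * ennreal (LINT \<eta>|circ. (norm (P k \<eta> - P (j + k) \<eta>))\<^sup>2)"
      unfolding C_def using radius_bounds
      by (intro polynomial_subordination[OF g gd, where p = "\<lambda>z. P k z - P (j + k) z"] holomorphic_intros P) auto
    also have "\<dots> \<le> ennreal C * ennreal ((1/8)^k)"
      using L2[of k "j + k"] by (intro mult_left_mono ennreal_leI) (auto simp: norm_minus_commute)
    also have "\<dots> = ennreal (C * (1/8)^k)" using C by (intro ennreal_mult[symmetric]) auto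
    finally show "(\<integral>\<^sup>+\<zeta>. ennreal ((norm (P k (?g n \<zeta>) - P (j + k) (?g n \<zeta>)))\<^sup>2) \<partial>circ)
      \<le> ennreal (C * (1/8)^k)" .
  qed (rule tendsto_const | intro meas2 Pg)+
  have step2: "(\<integral>\<^sup>+\<zeta>. ennreal ((norm (P k (bmap g \<zeta>) - ?b \<zeta>))\<^sup>2) \<partial>circ)
      \<le> ennreal (C * (1/8)^k)" for k
  proof (rule nn_integral_le_of_liminf[where u = "\<lambda>n \<zeta>. ennreal ((norm (P k (?g n \<zeta>) - h (?g n \<zeta>)))\<^sup>2)"])
    show "AE \<zeta> in circ. ennreal ((norm (P k (bmap g \<zeta>) - ?b \<zeta>))\<^sup>2)
       \<le> liminf (\<lambda>n. ennreal ((norm (P k (?g n \<zeta>) - h (?g n \<zeta>)))\<^sup>2))"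
    proof (rule AE_le_liminf)
      show "AE \<zeta> in circ. (\<lambda>n. ennreal ((norm (P k (?g n \<zeta>) - h (?g n \<zeta>)))\<^sup>2))
         \<longlonglongrightarrow> ennreal ((norm (P k (bmap g \<zeta>) - ?b \<zeta>))\<^sup>2)"
        using inner Fg Fhg
      proof eventually_elim
        case (elim \<zeta>)
        have "bmap g \<zeta> = bdry g \<zeta>" using elim(1) by (simp add: bmap_def)
        then have "(\<lambda>n. P k (?g n \<zeta>)) \<longlonglongrightarrow> P k (bmap g \<zeta>)"
          using continuous_on_tendsto_compose[OF cP[of UNIV k] bdry_radius_tendsto[OF elim(2)]] by simp
        then show ?case
          by (intro tendsto_ennrealI tendsto_intros bdry_radius_tendsto[OF elim(3)])
      qed
    qed
  qed (rule tendsto_const step1 | intro meas2 Pg mhg)+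
  have fast2: "AE \<zeta> in circ. \<exists>m. bmap g \<zeta> \<in> fast_points P m"
    by (rule bmap_AE[OF g gd inner fast])
  have "(\<integral>\<^sup>+\<zeta>. ennreal ((norm (bdry h (bmap g \<zeta>) - ?b \<zeta>))\<^sup>2) \<partial>circ) \<le> ennreal (C * 0)"
  proof (rule nn_integral_le_of_liminf[where u = "\<lambda>k \<zeta>. ennreal ((norm (P k (bmap g \<zeta>) - ?b \<zeta>))\<^sup>2)"])
    show "AE \<zeta> in circ. ennreal ((norm (bdry h (bmap g \<zeta>) - ?b \<zeta>))\<^sup>2)
      \<le> liminf (\<lambda>k. ennreal ((norm (P k (bmap g \<zeta>) - ?b \<zeta>))\<^sup>2))"
    proof (rule AE_le_liminf)
      show "AE \<zeta> in circ. (\<lambda>k. ennreal ((norm (P k (bmap g \<zeta>) - ?b \<zeta>))\<^sup>2))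
         \<longlonglongrightarrow> ennreal ((norm (bdry h (bmap g \<zeta>) - ?b \<zeta>))\<^sup>2)"
        using fast2
      proof eventually_elim
        case (elim \<zeta>)
        then show ?case
          by (auto intro!: tendsto_ennrealI tendsto_intros fast_points_radial_limit(2)[OF P lim])
      qed
    qed
    show "(\<lambda>k. ennreal (C * (1/8)^k)) \<longlonglongrightarrow> ennreal (C * 0)"
      by (intro tendsto_ennrealI tendsto_intros LIMSEQ_realpow_zero) auto
  qed (rule step2 | intro meas2 Pb mbd)+
  then have "(\<integral>\<^sup>+\<zeta>. ennreal ((norm (bdry h (bmap g \<zeta>) - ?b \<zeta>))\<^sup>2) \<partial>circ) = 0" by simp
  moreover have mbb: "(\<lambda>\<zeta>. bdry h (bmap g \<zeta>)) \<in> borel_measurable circ"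
    by (rule measurable_compose[OF measurable_bmap[OF cg] measurable_bdry[OF ch]])
  ultimately have "AE \<zeta> in circ. ennreal ((norm (bdry h (bmap g \<zeta>) - ?b \<zeta>))\<^sup>2) = 0"
    using nn_integral_0_iff_AE[OF meas2[OF mbb mbd]] by simp
  then show ?thesis using Fhg
    by eventually_elim (auto simp: ennreal_eq_0_iff)
qed

section \<open>Radial limits of injective maps do not cross\<close>

definition radial_lim :: "(complex \<Rightarrow> 'a::topological_space) \<Rightarrow> complex \<Rightarrow> 'a \<Rightarrow> bool" where
  "radial_lim F \<zeta> x \<longleftrightarrow> ((\<lambda>r. F (of_real r * \<zeta>)) \<longlongrightarrow> x) (at_left 1)"

lemma radial_lim_unique:
  fixes F :: "complex \<Rightarrow> 'a::t2_space"
  shows "radial_lim F \<zeta> x \<Longrightarrow> radial_lim F \<zeta> y \<Longrightarrow> x = y"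
  unfolding radial_lim_def by (rule tendsto_unique) auto

definition ray :: "(complex \<Rightarrow> complex) \<Rightarrow> complex \<Rightarrow> complex \<Rightarrow> real \<Rightarrow> complex" where
  "ray \<Phi> \<zeta> x t = (if t < 1 then \<Phi> (of_real t * \<zeta>) else x)"

lemma path_image_ray: "path_image (ray \<Phi> \<zeta> x) = insert x ((\<lambda>t. \<Phi> (of_real t * \<zeta>)) ` {0..<1})"
  unfolding path_image_def ray_def by (force simp: image_iff)

lemma arc_ray:
  assumes c: "continuous_on (ball 0 1) \<Phi>" and inj: "inj_on \<Phi> (ball 0 1)"
    and \<zeta>: "norm \<zeta> = 1" and lim: "radial_lim \<Phi> \<zeta> x" and x: "x \<notin> \<Phi> ` ball 0 1"
  shows "arc (ray \<Phi> \<zeta> x)"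
proof -
  have ib: "of_real t * \<zeta> \<in> ball 0 1" if "0 \<le> t" "t < 1" for t :: real using that \<zeta> by (simp add: norm_mult)
  have cc: "continuous_on {0..<1} (\<lambda>t. \<Phi> (of_real t * \<zeta>))"
    by (rule continuous_on_compose2[OF c]) (auto intro!: continuous_intros ib)
  have cr: "continuous_on {0..<1} (ray \<Phi> \<zeta> x)"
    using cc by (rule continuous_on_eq) (simp add: ray_def)
  have "continuous_on {0..1} (ray \<Phi> \<zeta> x)"
    unfolding continuous_on_def
  proof
    fix t :: real assume t: "t \<in> {0..1}"
    show "(ray \<Phi> \<zeta> x \<longlongrightarrow> ray \<Phi> \<zeta> x t) (at t within {0..1})"
    proof (cases "t = 1")
      case True
      have "\<forall>\<^sub>F r in at_left 1. \<Phi> (of_real r * \<zeta>) = ray \<Phi> \<zeta> x r"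
        by (auto simp: eventually_at_filter ray_def)
      then have "(ray \<Phi> \<zeta> x \<longlongrightarrow> x) (at_left 1)"
        using lim unfolding radial_lim_def by (rule Lim_transform_eventually[rotated])
      moreover have "at (1::real) within {0..1} \<le> at_left 1"
        by (simp add: at_within_Icc_at_left)
      ultimately show ?thesis using True by (auto simp: ray_def intro: tendsto_mono)
    next
      case False
      then have "at t within {0..1} = at t within {0..<1}"
        using t by (intro at_within_nhd[of t "{..<1}"]) auto
      then show ?thesis using cr False t by (auto simp: continuous_on_def)
    qed
  qed
  moreover have "inj_on (ray \<Phi> \<zeta> x) {0..1}"
  proof (rule inj_onI)
    fix s t :: real assume st: "s \<in> {0..1}" "t \<in> {0..1}" "ray \<Phi> \<zeta> x s = ray \<Phi> \<zeta> x t"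
    have "x \<noteq> \<Phi> (of_real u * \<zeta>)" if "0 \<le> u" "u < 1" for u using x imageI[OF ib[OF that], of \<Phi>] by metis
    moreover have "s = t" if "s < 1" "t < 1"
    proof -
      have "of_real s * \<zeta> = of_real t * \<zeta>" using st that by - (rule inj_onD[OF inj, rotated], auto simp: ray_def norm_mult \<zeta>)
      then show ?thesis using \<zeta> by auto
    qed
    ultimately show "s = t" using st by (auto simp: ray_def split: if_splits)
  qed
  ultimately show ?thesis by (simp add: arc_def path_def)
qed

lemma cis_eq_imp_eq:
  assumes "cis s = cis t" "\<bar>s - t\<bar> < 2 * pi"
  shows "s = t"
proof -
  obtain n :: int where "\<i> * of_real s = \<i> * of_real t + of_real (of_int (2 * n) * pi) * \<i>"
    using assms(1) by (auto simp: cis_conv_exp exp_eq)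
  then have "\<i> * of_real s = \<i> * of_real (t + of_int (2 * n) * pi)" by (simp add: algebra_simps)
  then have st: "s = t + of_int (2 * n) * pi" by (simp only: mult_cancel_left of_real_eq_iff) simp
  then have "\<bar>of_int n\<bar> * (2 * pi) < 1 * (2 * pi)" using assms(2) by (simp add: abs_mult)
  then have "\<bar>of_int n :: real\<bar> < 1" by (rule mult_right_less_imp_less) simp
  then have "n = 0" by linarith
  then show ?thesis using st by simp
qed

text \<open>For \<open>0 \<le> a < b < 2 \<pi>\<close>, the radii at the angles \<open>a\<close> and \<open>b\<close> cut the disc into \<open>sector a b\<close> and
  \<open>sector b (a + 2 * pi)\<close>.\<close>

definition sector :: "real \<Rightarrow> real \<Rightarrow> complex set" where
  "sector a b = (\<lambda>(r, t). of_real r * cis t) ` ({0<..<1} \<times> {a<..<b})"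

lemma connected_sector: "connected (sector a b)"
  unfolding sector_def
  by (intro connected_continuous_image convex_connected convex_Times)
     (auto intro!: continuous_intros simp: split_beta)

lemma sector_subset_ball: "sector a b \<subseteq> ball 0 1"
  by (auto simp: sector_def norm_mult)

lemma sector_disjoint_ray:
  assumes "z \<in> sector a b" "\<And>t. a < t \<Longrightarrow> t < b \<Longrightarrow> t \<noteq> c \<and> \<bar>t - c\<bar> < 2 * pi" and s: "0 \<le> s"
  shows "z \<noteq> of_real s * cis c"
proof
  assume z: "z = of_real s * cis c"
  obtain r t where rt: "0 < r" "a < t" "t < b" "z = of_real r * cis t" using assms(1) by (auto simp: sector_def)
  have "norm z = r" using rt by (simp add: norm_mult)
  moreover have "norm z = s" using z s by (simp add: norm_mult)
  ultimately have "cis t = cis c" using z rt by simp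
  then show False using cis_eq_imp_eq assms(2)[OF rt(2,3)] by blast
qed

lemma ball_minus_rays_subset:
  assumes "0 \<le> a" "a < b" "b < 2 * pi" and z: "z \<in> ball 0 1"
    and nr: "\<And>s. 0 \<le> s \<Longrightarrow> s < 1 \<Longrightarrow> z \<noteq> of_real s * cis a \<and> z \<noteq> of_real s * cis b"
  shows "z \<in> sector a b \<union> sector b (a + 2 * pi)"
proof -
  have n: "0 < norm z" "norm z < 1" using nr[of 0] z by auto
  define t where "t = Arg2pi z"
  have t: "0 \<le> t" "t < 2 * pi" "z = of_real (norm z) * cis t"
    using Arg2pi_ge_0[of z] Arg2pi_lt_2pi[of z] Arg2pi_eq[of z]
    by (auto simp: t_def cis_conv_exp mult.commute)
  have "t \<noteq> a" "t \<noteq> b" using nr[of "norm z"] n t(3) by auto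
  then consider "a < t" "t < b" | "t < a" | "b < t" by linarith
  then show ?thesis
  proof cases
    case 1 then show ?thesis using n t(3) by (force simp: sector_def)
  next
    case 2
    have "z = of_real (norm z) * cis (t + 2 * pi)" using t(3) by (simp add: cis.ctr)
    moreover have "b < t + 2 * pi" "t + 2 * pi < a + 2 * pi" using 2 assms t by linarith+
    ultimately show ?thesis using n by (force simp: sector_def)
  next
    case 3
    then have "t < a + 2 * pi" using t assms by linarith
    then show ?thesis using n t(3) 3 by (force simp: sector_def)
  qed
qed

text \<open>If \<open>x \<noteq> y\<close>, the images of the radii at \<open>a\<close> and \<open>b\<close> close up at \<open>x\<close> to a Jordan curve that misses
  \<open>y\<close>. The radii at \<open>u\<close> and \<open>v\<close> lie in different sectors and both end at \<open>y\<close>, so \<open>\<Phi>\<close> maps both sectors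
  into the component of the complement that contains \<open>y\<close>. But the other component also has the whole curve as
  its frontier, so it meets the open image of \<open>\<Phi>\<close> near \<open>\<Phi> 0\<close>.\<close>

lemma radial_limits_do_not_cross:
  fixes \<Phi> :: "complex \<Rightarrow> complex"
  assumes c: "continuous_on (ball 0 1) \<Phi>" and inj: "inj_on \<Phi> (ball 0 1)"
    and ang: "0 \<le> a" "a < u" "u < b" "b < v" "v < 2 * pi"
    and x: "radial_lim \<Phi> (cis a) x" "radial_lim \<Phi> (cis b) x" "x \<notin> \<Phi> ` ball 0 1"
    and y: "radial_lim \<Phi> (cis u) y" "radial_lim \<Phi> (cis v) y" "y \<notin> \<Phi> ` ball 0 1"
  shows "x = y"
proof (rule ccontr)
  assume "x \<noteq> y"
  let ?p = "ray \<Phi> (cis a) x" let ?q = "ray \<Phi> (cis b) x"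
  let ?c = "?p +++ reversepath ?q"
  have ab: "a < b" "b < 2 * pi" using ang by auto
  have ap: "arc ?p" "arc ?q" using arc_ray[OF c inj _ _ x(3)] x by auto
  have ne: "of_real r * cis a \<noteq> of_real s * cis b" if "0 \<le> r" "0 < s" for r s
  proof
    assume eq: "of_real r * cis a = of_real s * cis b"
    then have "norm (of_real r * cis a) = norm (of_real s * cis b)" by simp
    then have "r = s" using that by (simp add: norm_mult)
    then have "cis a = cis b" using eq that by simp
    then show False using cis_eq_imp_eq[of a b] ab ang by auto
  qed
  have int: "path_image ?p \<inter> path_image ?q \<subseteq> {pathstart ?p, x}"
  proof
    fix w assume w: "w \<in> path_image ?p \<inter> path_image ?q"
    show "w \<in> {pathstart ?p, x}"
    proof (cases "w = x")
      case False
      then obtain r s where rs: "0 \<le> r" "r < 1" "0 \<le> s" "s < 1" "w = \<Phi> (of_real r * cis a)" "w = \<Phi> (of_real s * cis b)"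
        using w by (auto simp: path_image_ray)
      then have "of_real r * cis a = of_real s * cis b" by - (rule inj_onD[OF inj, rotated], auto simp: norm_mult)
      then have "s = 0" using ne[of r s] rs by force
      then show ?thesis using rs by (simp add: pathstart_def ray_def)
    qed simp
  qed
  have ends: "pathstart ?p = \<Phi> 0" "pathfinish ?p = x" "pathstart ?q = \<Phi> 0" "pathfinish ?q = x"
    by (auto simp: pathstart_def pathfinish_def ray_def)
  have sp: "simple_path ?c"
    by (rule simple_path_join_loop) (use ap int ends in \<open>auto simp: arc_reversepath\<close>)
  have loop: "pathfinish ?c = pathstart ?c" by (simp add: ends)
  define J where "J = path_image ?c"
  have J: "J = path_image ?p \<union> path_image ?q"
    unfolding J_def by (simp add: path_image_join ends)
  note Jordan = Jordan_inside_outside[OF sp loop, folded J_def]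
  have yJ: "y \<notin> J" using \<open>x \<noteq> y\<close> y(3) unfolding J by (auto simp: path_image_ray norm_mult)
  \<comment> \<open>The component \<open>O1\<close> that contains \<open>y\<close> is the inside or the outside of the curve.\<close>
  have part: False if O: "open O1" "open O2" "O1 \<inter> O2 = {}" "O1 \<union> O2 = - J" "frontier O2 = J" "y \<in> O1" for O1 O2
  proof -
    have sub: "sector e f \<subseteq> \<Phi> -` O1"
      if ef: "\<And>t. e < t \<Longrightarrow> t < f \<Longrightarrow> t \<noteq> a \<and> \<bar>t - a\<bar> < 2 * pi" "\<And>t. e < t \<Longrightarrow> t < f \<Longrightarrow> t \<noteq> b \<and> \<bar>t - b\<bar> < 2 * pi"
        and w: "radial_lim \<Phi> (cis w) y" "e < w" "w < f" for e f w
    proof -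
      have J0: "\<Phi> z \<notin> J" if "z \<in> sector e f" for z
      proof
        assume "\<Phi> z \<in> J"
        have zb: "z \<in> ball 0 1" using that sector_subset_ball by blast
        then have "\<Phi> z \<noteq> x" using x(3) by auto
        then obtain s d where "0 \<le> s" "s < 1" "\<Phi> z = \<Phi> (of_real s * cis d)" "d = a \<or> d = b"
          using \<open>\<Phi> z \<in> J\<close> unfolding J by (auto simp: path_image_ray)
        moreover from this have "z = of_real s * cis d"
          using zb by - (rule inj_onD[OF inj, rotated], auto simp: norm_mult)
        ultimately show False using sector_disjoint_ray[OF that] ef by metis
      qed
      have con: "connected (\<Phi> ` sector e f)"
        by (intro connected_continuous_image continuous_on_subset[OF c] connected_sector sector_subset_ball)
      have "\<forall>\<^sub>F r in at_left 1. \<Phi> (of_real r * cis w) \<in> O1"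
        using w(1) O(1,6) unfolding radial_lim_def by (rule topological_tendstoD)
      moreover have "\<forall>\<^sub>F r in at_left 1. r \<in> {0<..<1::real}" by (rule eventually_at_left_real) simp
      ultimately have "\<forall>\<^sub>F r in at_left 1. r \<in> {0<..<1::real} \<and> \<Phi> (of_real r * cis w) \<in> O1"
        by eventually_elim simp
      then obtain r where "r \<in> {0<..<1::real}" "\<Phi> (of_real r * cis w) \<in> O1"
        using eventually_happens'[of "at_left (1::real)"] by auto
      moreover from this have "of_real r * cis w \<in> sector e f" using w by (force simp: sector_def)
      ultimately have m: "O1 \<inter> \<Phi> ` sector e f \<noteq> {}" by blast
      have "\<Phi> ` sector e f \<subseteq> O1 \<union> O2" using J0 O(4) by auto
      then have "O2 \<inter> \<Phi> ` sector e f = {}"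
        using connectedD[OF con O(1,2)] O(3) m by blast
      then show ?thesis using \<open>\<Phi> ` sector e f \<subseteq> O1 \<union> O2\<close> by auto
    qed
    have s1: "sector a b \<subseteq> \<Phi> -` O1"
      by (rule sub[OF _ _ y(1)]) (use ang in auto)
    have s2: "sector b (a + 2 * pi) \<subseteq> \<Phi> -` O1"
      by (rule sub[OF _ _ y(2)]) (use ang in auto)
    have "open (\<Phi> ` ball 0 1)" by (rule invariance_of_domain[OF c open_ball inj])
    moreover have "\<Phi> 0 \<in> frontier O2" using O(5) unfolding J by (auto simp: path_image_ray image_iff intro!: bexI[of _ 0])
    moreover have "\<Phi> 0 \<in> \<Phi> ` ball 0 1" by (rule imageI) simp
    ultimately have "\<Phi> ` ball 0 1 \<inter> O2 \<noteq> {}"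
      using open_Int_closure_eq_empty[of "\<Phi> ` ball 0 1" O2] unfolding frontier_def by blast
    then obtain z where z: "z \<in> ball 0 1" "\<Phi> z \<in> O2" by auto
    have "z \<notin> sector a b \<union> sector b (a + 2 * pi)" using s1 s2 z(2) O(3) by auto
    then obtain s d where "0 \<le> s" "s < 1" "z = of_real s * cis d" "d = a \<or> d = b"
      using ball_minus_rays_subset[OF ang(1) ab z(1)] by blast
    then have "\<Phi> z \<in> J" unfolding J by (auto simp: path_image_ray)
    then show False using z(2) O(4) by auto
  qed
  show False
    using part[of "inside J" "outside J"] part[of "outside J" "inside J"] Jordan yJ by blast
qed

lemma three_sorted:
  fixes t1 t2 t3 :: "'a::linorder"
  assumes "R t1" "R t2" "R t3" "t1 \<noteq> t2" "t1 \<noteq> t3" "t2 \<noteq> t3"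
  shows "\<exists>a1 a2 a3. a1 < a2 \<and> a2 < a3 \<and> R a1 \<and> R a2 \<and> R a3"
  using assms by (metis linorder_less_linear)

definition three_radii :: "(complex \<Rightarrow> 'a::topological_space) \<Rightarrow> 'a \<Rightarrow> bool" where
  "three_radii F x \<longleftrightarrow> (\<exists>\<zeta>1 \<zeta>2 \<zeta>3. norm \<zeta>1 = 1 \<and> norm \<zeta>2 = 1 \<and> norm \<zeta>3 = 1 \<and>
     \<zeta>1 \<noteq> \<zeta>2 \<and> \<zeta>1 \<noteq> \<zeta>3 \<and> \<zeta>2 \<noteq> \<zeta>3 \<and> radial_lim F \<zeta>1 x \<and> radial_lim F \<zeta>2 x \<and> radial_lim F \<zeta>3 x)"

text \<open>Separate the three angles by two rationals. If two points had the same pair of rationals, then an angle of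
  one point would lie between the first two angles of the other, with its third angle beyond them, and the pairs would
  cross. Hence the pair of rationals determines the point.\<close>

theorem countable_triple_radial_limits:
  fixes \<Phi> :: "complex \<Rightarrow> complex"
  assumes c: "continuous_on (ball 0 1) \<Phi>" and inj: "inj_on \<Phi> (ball 0 1)"
  shows "countable {x. x \<notin> \<Phi> ` ball 0 1 \<and> three_radii \<Phi> x}" (is "countable ?Z")
proof -
  let ?P = "\<lambda>x t. 0 \<le> t \<and> t < 2 * pi \<and> radial_lim \<Phi> (cis t) x"
  define Q where "Q x q1 q2 a1 a2 a3 \<longleftrightarrow> ?P x a1 \<and> ?P x a2 \<and> ?P x a3 \<and>
      a1 < of_rat q1 \<and> of_rat q1 < a2 \<and> a2 < of_rat q2 \<and> of_rat q2 < a3" for x a1 a2 a3 and q1 q2 :: rat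
  define Z where "Z = ?Z"
  have "\<exists>q1 q2 a1 a2 a3. Q x q1 q2 a1 a2 a3" if xZ: "x \<in> Z" for x
  proof -
    have ang: "\<exists>t. ?P x t \<and> \<zeta> = cis t" if "norm \<zeta> = 1" "radial_lim \<Phi> \<zeta> x" for \<zeta>
      using that Arg2pi_ge_0[of \<zeta>] Arg2pi_lt_2pi[of \<zeta>] Arg2pi_eq[of \<zeta>]
      by (intro exI[of _ "Arg2pi \<zeta>"]) (auto simp: cis_conv_exp)
    obtain \<zeta>1 \<zeta>2 \<zeta>3 where \<zeta>: "norm \<zeta>1 = 1" "norm \<zeta>2 = 1" "norm \<zeta>3 = 1" "\<zeta>1 \<noteq> \<zeta>2" "\<zeta>1 \<noteq> \<zeta>3" "\<zeta>2 \<noteq> \<zeta>3"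
      "radial_lim \<Phi> \<zeta>1 x" "radial_lim \<Phi> \<zeta>2 x" "radial_lim \<Phi> \<zeta>3 x"
      using xZ unfolding Z_def three_radii_def by blast
    obtain t1 t2 t3 where t: "?P x t1" "\<zeta>1 = cis t1" "?P x t2" "\<zeta>2 = cis t2" "?P x t3" "\<zeta>3 = cis t3"
      using ang[OF \<zeta>(1,7)] ang[OF \<zeta>(2,8)] ang[OF \<zeta>(3,9)] by blast
    have "\<exists>a1 a2 a3. a1 < a2 \<and> a2 < a3 \<and> ?P x a1 \<and> ?P x a2 \<and> ?P x a3"
      by (rule three_sorted[of "?P x" t1 t2 t3]) (use t \<zeta> in auto)
    then obtain a1 a2 a3 where a: "a1 < a2" "a2 < a3" "?P x a1" "?P x a2" "?P x a3" by blast
    obtain q1 q2 :: rat where "a1 < of_rat q1" "of_rat q1 < a2" "a2 < of_rat q2" "of_rat q2 < a3"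
      using of_rat_dense[OF a(1)] of_rat_dense[OF a(2)] by blast
    with a have "Q x q1 q2 a1 a2 a3" by (simp add: Q_def)
    then show ?thesis by blast
  qed
  then obtain q1 q2 :: "complex \<Rightarrow> rat" and a1 a2 a3 where
    a: "\<And>x. x \<in> Z \<Longrightarrow> Q x (q1 x) (q2 x) (a1 x) (a2 x) (a3 x)"
    by metis
  have less: "x = y" if xy: "x \<in> Z" "y \<in> Z" "q1 x = q1 y" "q2 x = q2 y" "a1 x < a1 y" for x y
  proof (rule radial_limits_do_not_cross[OF c inj])
    note ax = a[OF xy(1), unfolded Q_def xy(3,4)] and ay = a[OF xy(2), unfolded Q_def]
    show "0 \<le> a1 x" "a1 x < a1 y" "a1 y < a2 x" "a2 x < a3 y" "a3 y < 2 * pi"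
      using ax ay xy(3-5) by linarith+
    show "radial_lim \<Phi> (cis (a1 x)) x" "radial_lim \<Phi> (cis (a2 x)) x"
      "radial_lim \<Phi> (cis (a1 y)) y" "radial_lim \<Phi> (cis (a3 y)) y" using ax ay by blast+
  qed (use xy in \<open>auto simp: Z_def\<close>)
  have "inj_on (\<lambda>x. (q1 x, q2 x)) Z"
  proof (rule inj_onI)
    fix x y assume xy: "x \<in> Z" "y \<in> Z" "(q1 x, q2 x) = (q1 y, q2 y)"
    consider "a1 x < a1 y" | "a1 y < a1 x" | "a1 x = a1 y" by linarith
    then show "x = y"
    proof cases
      case 3
      then show ?thesis using a[OF xy(1)] a[OF xy(2)] unfolding Q_def by (intro radial_lim_unique[of \<Phi> "cis (a1 x)"]) auto
    qed (use xy less[of x y] less[of y x] in auto)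
  qed
  then show ?thesis unfolding Z_def by (rule countableI')
qed

section \<open>Charts of the sphere\<close>

text \<open>The Moebius transformation \<open>x \<mapsto> 1 / (x - a)\<close>, or the identity for \<open>Infty\<close>, which identifies the
  complement of the first argument with the plane. Its value at that point itself is a default, \<open>0\<close>.\<close>

fun chart :: "riemann_sphere \<Rightarrow> riemann_sphere \<Rightarrow> complex" where
  "chart Infty x = fin_part x"
| "chart (Fin a) (Fin z) = 1 / (z - a)"
| "chart (Fin a) Infty = 0"

fun unchart :: "riemann_sphere \<Rightarrow> complex \<Rightarrow> riemann_sphere" where
  "unchart Infty w = Fin w"
| "unchart (Fin a) w = (if w = 0 then Infty else Fin (a + 1 / w))"

lemma chart_unchart [simp]: "chart e (unchart e w) = w"
  by (cases e) auto

lemma unchart_chart: "x \<noteq> e \<Longrightarrow> unchart e (chart e x) = x"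
  by (cases e; cases x) (auto simp: field_simps)

lemma tendsto_Fin_Infty:
  assumes "filterlim f at_infinity F"
  shows "((\<lambda>x. Fin (f x)) \<longlongrightarrow> Infty) F"
proof -
  have "filterlim (\<lambda>x. norm (f x)) at_top F"
    using assms by (simp add: filterlim_at_infinity_conv_norm_at_top)
  then have "filterlim (\<lambda>x. 1 + (norm (f x))\<^sup>2) at_top F"
    by (intro filterlim_tendsto_add_at_top[OF tendsto_const] filterlim_pow_at_top) auto
  then have "filterlim (\<lambda>x. sqrt (1 + (norm (f x))\<^sup>2)) at_top F"
    by (rule filterlim_compose[OF sqrt_at_top])
  then have "((\<lambda>x. 2 / sqrt (1 + (norm (f x))\<^sup>2)) \<longlongrightarrow> 0) F"
    by (rule real_tendsto_divide_at_top[OF tendsto_const])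
  then show ?thesis
    by (subst tendsto_dist_iff) (simp add: dist_Fin_Infty)
qed

lemma continuous_on_unchart: "continuous_on UNIV (unchart e)"
proof (cases e)
  case Infty
  then have "unchart e = Fin" by auto
  then show ?thesis by (simp add: continuous_on_eq_continuous_at continuous_Fin)
next
  case (Fin a)
  have "isCont (unchart e) w" for w
  proof (cases "w = 0")
    case True
    have "filterlim (\<lambda>w. a + inverse w) at_infinity (at 0)"
      by (intro tendsto_add_filterlim_at_infinity[OF tendsto_const] filterlim_inverse_at_infinity)
    then have "((\<lambda>w. Fin (a + inverse w)) \<longlongrightarrow> Infty) (at 0)" by (rule tendsto_Fin_Infty)
    moreover have "\<forall>\<^sub>F w in at 0. Fin (a + inverse w) = unchart e w"
      by (simp add: eventually_at_filter Fin divide_inverse)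
    ultimately have "(unchart e \<longlongrightarrow> Infty) (at 0)" by (rule Lim_transform_eventually)
    then show ?thesis using True Fin by (simp add: isCont_def)
  next
    case False
    then have "isCont (\<lambda>w. Fin (a + 1 / w)) w"
      by (intro isCont_o2[OF _ continuous_Fin] continuous_intros) auto
    moreover have "\<forall>\<^sub>F v in nhds w. Fin (a + 1 / v) = unchart e v"
      using t1_space_nhds[OF False] by eventually_elim (simp add: Fin)
    ultimately show ?thesis by (simp add: isCont_cong)
  qed
  then show ?thesis by (simp add: continuous_on_eq_continuous_at)
qed

lemma unchart_at_infinity: "(unchart e \<longlongrightarrow> e) at_infinity"
proof (cases e)
  case Infty
  then have "unchart e = Fin" by auto
  then show ?thesis using Infty tendsto_Fin_Infty[OF filterlim_ident] by simp
next
  case (Fin a)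
  have "((\<lambda>w. a + inverse w) \<longlongrightarrow> a + 0) at_infinity"
    by (intro tendsto_intros tendsto_inverse_0)
  then have "((\<lambda>w. Fin (a + inverse w)) \<longlongrightarrow> Fin a) at_infinity"
    using isCont_tendsto_compose[OF continuous_Fin] by force
  moreover have "\<forall>\<^sub>F w in at_infinity. Fin (a + inverse w) = unchart e w"
    using eventually_not_equal_at_infinity[of "0::complex"] by eventually_elim (simp add: Fin divide_inverse)
  ultimately show ?thesis unfolding Fin by (rule Lim_transform_eventually)
qed

lemma eventually_neq_sphere: "x \<noteq> y \<Longrightarrow> \<forall>\<^sub>F z in nhds (x::riemann_sphere). z \<noteq> y"
  by (rule t1_space_nhds)

lemma isCont_chart: assumes "x \<noteq> e" shows "isCont (chart e) x"
proof (cases e)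
  case Infty
  then obtain z where "x = Fin z" using assms by (cases x) auto
  moreover have "chart e = fin_part" using Infty by auto
  ultimately show ?thesis by (simp add: continuous_fin_part)
next
  case (Fin a)
  show ?thesis
  proof (cases x)
    case x: (Fin z)
    have "isCont (\<lambda>x. 1 / (fin_part x - a)) x"
      using assms x Fin by (intro continuous_intros) (auto simp: continuous_fin_part)
    moreover have "\<forall>\<^sub>F y in nhds x. 1 / (fin_part y - a) = chart e y"
      using eventually_neq_sphere[of x Infty, simplified x] unfolding x
      by (auto elim!: eventually_mono simp: Fin) (metis chart.simps(2) riemann_sphere.exhaust riemann_sphere.sel(1))
    ultimately show ?thesis by (simp add: isCont_cong)
  next
    case Infty
    have "(chart e \<longlongrightarrow> 0) (at Infty)"
    proof (rule tendstoI)
      fix \<epsilon> :: real assume \<epsilon>: "\<epsilon> > 0"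
      define B where "B = norm a + 1 / \<epsilon>"
      have B: "B > 0" using \<epsilon> by (simp add: B_def add_nonneg_pos)
      have "\<forall>\<^sub>F y in at Infty. dist y Infty < 2 / sqrt (1 + B\<^sup>2)"
        by (rule order_tendstoD(2)[OF tendsto_dist[OF tendsto_ident_at tendsto_const], simplified]) (simp add: add_pos_nonneg)
      then show "\<forall>\<^sub>F y in at Infty. dist (chart e y) 0 < \<epsilon>"
      proof eventually_elim
        case (elim y)
        show ?case
        proof (cases y)
          case y: (Fin z)
          have "2 / sqrt (1 + (norm z)\<^sup>2) < 2 / sqrt (1 + B\<^sup>2)" using elim by (simp add: y dist_Fin_Infty)
          moreover have "0 < sqrt (1 + (norm z)\<^sup>2)" "0 < sqrt (1 + B\<^sup>2)" by (auto simp: add_pos_nonneg)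
          ultimately have "sqrt (1 + B\<^sup>2) < sqrt (1 + (norm z)\<^sup>2)" by (simp add: field_simps)
          then have "B\<^sup>2 < (norm z)\<^sup>2" by simp
          then have "B < norm z" by (rule power2_less_imp_less) simp
          then have "1 / \<epsilon> < norm (z - a)" using norm_triangle_ineq2[of z a] by (simp add: B_def)
          then have "1 / norm (z - a) < \<epsilon>" using \<epsilon> by (simp add: field_simps) (smt (verit) divide_less_0_iff divide_pos_pos mult.commute pos_divide_less_eq)
          then show ?thesis by (simp add: Fin y norm_divide)
        qed (simp add: Fin \<epsilon>)
      qed
    qed
    then show ?thesis using Infty Fin by (simp add: isCont_def)
  qed
qed

lemma continuous_on_chart: "continuous_on (- {e}) (chart e)"
  by (intro continuous_at_imp_continuous_on ballI isCont_chart) auto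

lemma compact_sphere: "compact (UNIV :: riemann_sphere set)"
proof (rule compactI)
  fix C :: "riemann_sphere set set" assume C: "\<forall>t\<in>C. open t" "UNIV \<subseteq> \<Union> C"
  then obtain W where W: "W \<in> C" "Infty \<in> W" by blast
  have "compact (- (Fin -` W))" using C W by (simp add: open_riemann_sphere_iff)
  then have "compact (Fin ` (- (Fin -` W)))"
    by (intro compact_continuous_image continuous_at_imp_continuous_on ballI continuous_Fin)
  then obtain D where D: "D \<subseteq> C" "finite D" "Fin ` (- (Fin -` W)) \<subseteq> \<Union> D"
    using compactE[of "Fin ` (- (Fin -` W))" C] C by (metis subset_UNIV subset_trans)
  have cov: "x \<in> \<Union> (insert W D)" for x
  proof (cases x)
    case (Fin z) then show ?thesis using D(3) by (cases "Fin z \<in> W") auto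
  qed (use W in auto)
  then show "\<exists>C'\<subseteq>C. finite C' \<and> UNIV \<subseteq> \<Union> C'"
    using D(1,2) W(1) cov by (intro exI[of _ "insert W D"]) blast
qed

lemma complete_sphere: "complete (UNIV :: riemann_sphere set)"
  by (rule compact_imp_complete[OF compact_sphere])

section \<open>Meromorphic maps in charts\<close>

lemma sphere_meromorphic_on_subset:
  "sphere_meromorphic_on h S \<Longrightarrow> T \<subseteq> S \<Longrightarrow> sphere_meromorphic_on h T"
  unfolding sphere_meromorphic_on_def
  by (meson continuous_on_subset meromorphic_on_subset subsetD)

text \<open>Near a given point \<open>z\<close> of \<open>S\<close>, and except at \<open>z\<close> itself, \<open>h\<close> is finite and its finite part is
  holomorphic: a finite part that vanishes arbitrarily close to \<open>z\<close> vanishes identically nearby, which the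
  frequent finiteness of \<open>h\<close> excludes if \<open>h z = Infty\<close>. Continuity removes the singularity at \<open>z\<close>.\<close>

lemma holomorphic_chart_compose:
  assumes h: "sphere_meromorphic_on h S" and S: "open S" and ne: "\<And>z. z \<in> S \<Longrightarrow> h z \<noteq> e"
  shows "(\<lambda>z. chart e (h z)) holomorphic_on S"
proof -
  define F where "F z = fin_part (h z)" for z
  have cont: "continuous_on S h" and mer: "F meromorphic_on S" and fr: "\<And>z. z \<in> S \<Longrightarrow> \<exists>\<^sub>F w in at z. h w \<noteq> Infty"
    using h unfolding sphere_meromorphic_on_def F_def by auto
  have cc: "continuous_on S (\<lambda>z. chart e (h z))"
    using cont by (rule continuous_on_compose2[OF continuous_on_chart]) (use ne in auto)
  have "(\<lambda>z. chart e (h z)) analytic_on {z}" if z: "z \<in> S" for z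
  proof -
    have ct: "isCont h z" using cont S z by (simp add: continuous_on_eq_continuous_at)
    have iso: "isolated_singularity_at F z" "not_essential F z" using mer z by (auto simp: meromorphic_on_altdef)
    have nI: "\<forall>\<^sub>F w in at z. h w \<noteq> Infty"
    proof (cases "h z = Infty")
      case False
      then show ?thesis using ct tendsto_imp_eventually_ne unfolding isCont_def by blast
    next
      case True
      have n0: "\<forall>\<^sub>F w in at z. h w \<noteq> Fin 0"
        using ct True tendsto_imp_eventually_ne unfolding isCont_def by fastforce
      have "\<exists>\<^sub>F w in at z. F w \<noteq> 0"
        using frequently_eventually_conj[OF fr[OF z] n0]
        by (rule frequently_elim1) (auto simp: F_def, metis riemann_sphere.exhaust riemann_sphere.sel(1))
      then have "\<not> (\<forall>\<^sub>F w in at z. F w = 0)" by (simp add: frequently_def)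
      then have "\<not> (\<exists>\<^sub>F w in at z. F w = 0)"
        using not_essential_frequently_0_imp_eventually_0[OF iso] by blast
      then have "\<forall>\<^sub>F w in at z. F w \<noteq> 0" by (simp add: frequently_def)
      then show ?thesis by eventually_elim (auto simp: F_def)
    qed
    have "\<forall>\<^sub>F w in at z. F analytic_on {w}" using iso(1) by (simp add: isolated_singularity_at_altdef)
    moreover have "\<forall>\<^sub>F w in at z. w \<in> S" using S z by (rule eventually_at_in_open')
    ultimately have "\<forall>\<^sub>F w in at z. F analytic_on {w} \<and> w \<in> S \<and> h w \<noteq> Infty"
      using nI by eventually_elim simp
    then obtain d where d: "d > 0" "\<And>w. w \<noteq> z \<Longrightarrow> dist w z < d \<Longrightarrow> F analytic_on {w} \<and> w \<in> S \<and> h w \<noteq> Infty"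
      by (auto simp: eventually_at)
    have dS: "ball z d \<subseteq> S"
    proof
      fix w assume "w \<in> ball z d"
      then show "w \<in> S" using d(2)[of w] z by (cases "w = z") (auto simp: dist_commute)
    qed
    have Fh: "F holomorphic_on (ball z d - {z})"
      by (rule analytic_imp_holomorphic, subst analytic_on_analytic_at) (use d(2) in \<open>auto simp: dist_commute\<close>)
    have hF: "h w = Fin (F w)" if "w \<in> ball z d - {z}" for w
      using d(2)[of w] that by (cases "h w") (auto simp: F_def dist_commute)
    have "(\<lambda>w. chart e (h w)) holomorphic_on (ball z d - {z})"
    proof (cases e)
      case Infty
      show ?thesis by (rule holomorphic_transform[OF Fh]) (simp add: Infty F_def)
    next
      case (Fin a)
      have nz: "F w - a \<noteq> 0" if "w \<in> ball z d - {z}" for w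
        using hF[OF that] ne[of w] dS that Fin by auto
      have "(\<lambda>w. 1 / (F w - a)) holomorphic_on (ball z d - {z})"
        using nz by (intro holomorphic_intros Fh)
      then show ?thesis by (rule holomorphic_transform) (use hF Fin in auto)
    qed
    then have "(\<lambda>w. chart e (h w)) holomorphic_on ball z d"
      by (rule no_isolated_singularity[OF continuous_on_subset[OF cc dS] _ open_ball]) auto
    then show ?thesis using d(1) centre_in_ball open_ball unfolding analytic_at by blast
  qed
  then show ?thesis by (intro analytic_imp_holomorphic) (subst analytic_on_analytic_at, blast)
qed

lemma sphere_recip_unchart: "sphere_recip (Fin w) = unchart (Fin 0) w"
  by simp

lemma continuous_on_meromorphic_in:
  assumes "meromorphic_in f W"
  shows "continuous_on W f"
proof (rule continuous_at_imp_continuous_on, rule ballI)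
  fix x assume x: "x \<in> W"
  have W: "open W" and c1: "continuous_on {z. Fin z \<in> W} (\<lambda>z. f (Fin z))"
    and c2: "continuous_on {z. unchart (Fin 0) z \<in> W} (\<lambda>z. f (unchart (Fin 0) z))"
    using assms unfolding meromorphic_in_def sphere_meromorphic_on_def sphere_recip_unchart by blast+
  have key: "isCont f x" if "x \<noteq> e" and ce: "continuous_on {z. unchart e z \<in> W} (\<lambda>z. f (unchart e z))" for e
  proof -
    have "open {z. unchart e z \<in> W}"
      using open_vimage[OF W continuous_on_unchart[of e]] by (simp add: vimage_def)
    then have "isCont (\<lambda>z. f (unchart e z)) (chart e x)"
      using ce x unchart_chart[OF that(1)] by (simp add: continuous_on_eq_continuous_at)
    then have "isCont (\<lambda>y. f (unchart e (chart e y))) x"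
      by (rule isCont_o2[OF isCont_chart[OF that(1)]])
    moreover have "\<forall>\<^sub>F y in nhds x. f (unchart e (chart e y)) = f y"
      using eventually_neq_sphere[OF that(1)] by eventually_elim (simp add: unchart_chart)
    ultimately show ?thesis by (simp add: isCont_cong)
  qed
  show "isCont f x"
  proof (cases "x = Infty")
    case True then show ?thesis using key[of "Fin 0"] c2 by simp
  next
    case False then show ?thesis using key[of Infty] c1 by simp
  qed
qed

text \<open>The set \<open>S\<close> is covered by the two open pieces where \<open>\<phi>\<close> avoids \<open>Infty\<close> and \<open>Fin 0\<close>; on each of them
  the source of \<open>f\<close> can be read in a single chart.\<close>

lemma holomorphic_chart_compose2:
  assumes f: "meromorphic_in f W" and \<phi>: "sphere_meromorphic_on \<phi> S" and S: "open S"
    and U: "open U" "U \<subseteq> W" "\<phi> ` S \<subseteq> U" and ne: "\<And>x. x \<in> U \<Longrightarrow> f x \<noteq> e"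
  shows "(\<lambda>z. chart e (f (\<phi> z))) holomorphic_on S"
proof -
  have c: "continuous_on S \<phi>" using \<phi> by (simp add: sphere_meromorphic_on_def)
  have part: "open {z\<in>S. \<phi> z \<noteq> d}" "(\<lambda>z. chart e (f (\<phi> z))) holomorphic_on {z\<in>S. \<phi> z \<noteq> d}"
    if m: "sphere_meromorphic_on (\<lambda>z. f (unchart d z)) {z. unchart d z \<in> W}" for d
  proof -
    let ?S = "{z\<in>S. \<phi> z \<noteq> d}" let ?V = "{w. unchart d w \<in> U}"
    have "open (S \<inter> \<phi> -` (- {d}))" using c S by (rule continuous_open_preimage) auto
    moreover have "S \<inter> \<phi> -` (- {d}) = ?S" by auto
    ultimately show o: "open ?S" by simp
    have V: "open ?V" using open_vimage[OF U(1) continuous_on_unchart[of d]] by (simp add: vimage_def)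
    have "(\<lambda>z. chart d (\<phi> z)) holomorphic_on ?S"
      by (rule holomorphic_chart_compose[OF sphere_meromorphic_on_subset[OF \<phi>] o]) auto
    moreover have "(\<lambda>w. chart e (f (unchart d w))) holomorphic_on ?V"
      by (rule holomorphic_chart_compose[OF sphere_meromorphic_on_subset[OF m] V]) (use U ne in auto)
    ultimately have "((\<lambda>w. chart e (f (unchart d w))) \<circ> (\<lambda>z. chart d (\<phi> z))) holomorphic_on ?S"
      using U(3) by (intro holomorphic_on_compose_gen) (auto simp: unchart_chart)
    then show "(\<lambda>z. chart e (f (\<phi> z))) holomorphic_on ?S"
      by (rule holomorphic_transform) (simp add: unchart_chart)
  qed
  have m1: "sphere_meromorphic_on (\<lambda>z. f (unchart Infty z)) {z. unchart Infty z \<in> W}"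
    and m2: "sphere_meromorphic_on (\<lambda>z. f (unchart (Fin 0) z)) {z. unchart (Fin 0) z \<in> W}"
    using f unfolding meromorphic_in_def sphere_recip_unchart by (simp_all only: unchart.simps(1))
  have "(\<lambda>z. chart e (f (\<phi> z))) holomorphic_on {z\<in>S. \<phi> z \<noteq> Infty} \<union> {z\<in>S. \<phi> z \<noteq> Fin 0}"
    by (intro holomorphic_on_Un part m1 m2)
  moreover have "{z\<in>S. \<phi> z \<noteq> Infty} \<union> {z\<in>S. \<phi> z \<noteq> Fin 0} = S" by auto
  ultimately show ?thesis by simp
qed

section \<open>The boundary of a Fatou component\<close>

lemma fatou_set_avoids: "fatou_set f E \<inter> E = {}"
proof -
  have "z \<notin> E" if "z \<in> fatou_set f E" for z
  proof -
    have "(f ^^ 0) z \<notin> E" using that unfolding fatou_set_def by blast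
    then show ?thesis by simp
  qed
  then show ?thesis by blast
qed

text \<open>On the preimage of a good neighbourhood of \<open>f x\<close>, an iterate of positive order is \<open>f\<close> followed by an
  iterate on that neighbourhood, and \<open>f\<close> maps compact sets to compact sets.\<close>

lemma fatou_set_backward:
  assumes E: "closed E" and f: "continuous_on (- E) f" and x: "x \<notin> E" "f x \<in> fatou_set f E"
  shows "x \<in> fatou_set f E"
proof -
  obtain W where W: "open W" "f x \<in> W" "\<And>w n. w \<in> W \<Longrightarrow> (f ^^ n) w \<notin> E"
    "normal_family_on (range (\<lambda>n. f ^^ n)) W"
    using x(2) unfolding fatou_set_def by blast
  let ?V = "- E \<inter> f -` W"
  have V: "open ?V" using f E W(1) by (intro continuous_open_preimage) auto
  have "(f ^^ n) w \<notin> E" if "w \<in> ?V" for w n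
    using that W(3)[of "f w" "n - 1"] by (cases n) (auto simp: funpow_swap1)
  moreover have "normal_family_on (range (\<lambda>n. f ^^ n)) ?V"
    unfolding normal_family_on_def
  proof (intro allI impI)
    fix s :: "nat \<Rightarrow> riemann_sphere \<Rightarrow> riemann_sphere" assume "range s \<subseteq> range (\<lambda>n. f ^^ n)"
    then have "\<forall>k. \<exists>n. s k = f ^^ n" by blast
    then obtain m where m: "\<And>k. s k = f ^^ m k" by metis
    \<comment> \<open>The iterate of order \<open>0\<close> does not factor through \<open>f\<close>. If it occurs infinitely often, the identity is a limit.\<close>
    show "\<exists>r l. strict_mono r \<and> (\<forall>K. compact K \<and> K \<subseteq> ?V \<longrightarrow> uniform_limit K (s \<circ> r) l sequentially)"
    proof (cases "\<exists>\<^sub>\<infinity>k. m k = 0")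
      case True
      then have inf: "infinite {k. m k = 0}" by (simp add: frequently_cofinite)
      define r where "r = enumerate {k. m k = 0}"
      have "strict_mono r" "\<And>k. m (r k) = 0"
        using inf enumerate_in_set[OF inf] strict_mono_enumerate[OF inf] by (auto simp: r_def)
      then have "s \<circ> r = (\<lambda>_. id)" by (auto simp: m)
      then have "uniform_limit K (s \<circ> r) id sequentially" for K by (simp add: uniform_limit_const)
      then show ?thesis using \<open>strict_mono r\<close> by blast
    next
      case False
      then have "finite {k. m k = 0}" by (simp add: frequently_cofinite)
      then obtain N where N: "\<And>k. m k = 0 \<Longrightarrow> k < N" by (auto simp: finite_nat_set_iff_bounded)
      define s' where "s' k = f ^^ (m (k + N) - 1)" for k
      have s': "s (k + N) w = s' k (f w)" for k w
      proof -
        have "m (k + N) \<noteq> 0" using N[of "k + N"] by auto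
        then have "m (k + N) = Suc (m (k + N) - 1)" by simp
        then have "(f ^^ m (k + N)) w = (f ^^ (m (k + N) - 1)) (f w)" by (metis comp_apply funpow_Suc_right)
        then show ?thesis by (simp add: m s'_def)
      qed
      have "range s' \<subseteq> range (\<lambda>n. f ^^ n)" by (auto simp: s'_def)
      then obtain r l where r: "strict_mono r"
        and l: "\<And>K. compact K \<Longrightarrow> K \<subseteq> W \<Longrightarrow> uniform_limit K (s' \<circ> r) l sequentially"
        using W(4) unfolding normal_family_on_def by metis
      let ?r = "\<lambda>k. r k + N"
      have "strict_mono ?r" using r by (auto simp: strict_mono_def)
      moreover have "uniform_limit K (s \<circ> ?r) (l \<circ> f) sequentially" if K: "compact K" "K \<subseteq> ?V" for K
      proof (rule uniform_limitI)
        fix e :: real assume "e > 0"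
        have "compact (f ` K)" using K by (intro compact_continuous_image continuous_on_subset[OF f]) auto
        moreover have "f ` K \<subseteq> W" using K by auto
        ultimately have "\<forall>\<^sub>F n in sequentially. \<forall>x\<in>f ` K. dist ((s' \<circ> r) n x) (l x) < e"
          using \<open>e > 0\<close> by (intro uniform_limitD[OF l])
        then show "\<forall>\<^sub>F n in sequentially. \<forall>x\<in>K. dist ((s \<circ> ?r) n x) ((l \<circ> f) x) < e"
          by eventually_elim (simp add: s')
      qed
      ultimately show ?thesis by blast
    qed
  qed
  ultimately show ?thesis using V x W(2) unfolding fatou_set_def by blast
qed

text \<open>Adding a point of the closure to a connected set keeps it connected, and components are maximal.\<close>

lemma frontier_component_disjoint:
  assumes U: "U \<in> components F" and x: "x \<in> closure U" "x \<notin> U"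
  shows "x \<notin> F"
proof
  assume "x \<in> F"
  have "connected (insert x U)"
    by (rule connected_intermediate_closure[of U]) (use x in_components_connected[OF U] closure_subset in auto)
  then have "insert x U \<subseteq> U"
    using \<open>x \<in> F\<close> in_components_subset[OF U] in_components_nonempty[OF U]
    by (intro components_maximal[OF U]) auto
  then show False using x by simp
qed

section \<open>Univalent maps of the disc\<close>

lemma eventually_radius_in_ball:
  assumes "norm (\<zeta>::complex) = 1"
  shows "\<forall>\<^sub>F r in at_left 1. of_real r * \<zeta> \<in> ball 0 1"
proof -
  have "\<forall>\<^sub>F r in at_left 1. r \<in> {0<..<1::real}" by (rule eventually_at_left_real) simp
  then show ?thesis by eventually_elim (use assms in \<open>auto simp: norm_mult\<close>)
qed

lemma univalent_inverse:
  assumes "\<Phi> holomorphic_on ball 0 1" "inj_on \<Phi> (ball 0 1)"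
  shows "\<exists>G. G holomorphic_on \<Phi> ` ball 0 1 \<and> (\<forall>z\<in>ball 0 1. G (\<Phi> z) = z)"
  by (rule holomorphic_has_inverse[OF assms(1) open_ball assms(2)]) blast

lemma holomorphic_inverse_compose:
  assumes \<Phi>: "\<Phi> holomorphic_on ball 0 1" "inj_on \<Phi> (ball 0 1)"
    and h: "(\<lambda>z. \<Phi> (m z)) holomorphic_on ball 0 1" and m: "\<And>z. z \<in> ball 0 1 \<Longrightarrow> m z \<in> ball 0 1"
  shows "m holomorphic_on ball 0 1"
proof -
  obtain G where G: "G holomorphic_on \<Phi> ` ball 0 1" "\<And>z. z \<in> ball 0 1 \<Longrightarrow> G (\<Phi> z) = z"
    using univalent_inverse[OF \<Phi>] by blast
  have "(G \<circ> (\<lambda>z. \<Phi> (m z))) holomorphic_on ball 0 1"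
    by (rule holomorphic_on_compose_gen[OF h G(1)]) (use m in auto)
  then show ?thesis by (rule holomorphic_transform) (use G m in auto)
qed

text \<open>Otherwise the inverse would be a bounded entire function.\<close>

lemma univalent_not_onto:
  assumes \<Phi>: "\<Phi> holomorphic_on ball 0 1" "inj_on \<Phi> (ball 0 1)"
  shows "\<Phi> ` ball 0 1 \<noteq> UNIV"
proof
  assume eq: "\<Phi> ` ball 0 1 = UNIV"
  obtain G where G: "G holomorphic_on \<Phi> ` ball 0 1" "\<And>z. z \<in> ball 0 1 \<Longrightarrow> G (\<Phi> z) = z"
    using univalent_inverse[OF \<Phi>] by blast
  have "range G \<subseteq> ball 0 1" using G(2) eq by (metis image_subsetI imageE rangeI UNIV_I)
  then have "bounded (range G)" using bounded_ball bounded_subset by blast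
  then obtain c where "\<And>w. G w = c" using Liouville_theorem G(1) eq unfolding constant_on_def by force
  then have "c = 0" "c = 1/2" using G(2)[of 0] G(2)[of "1/2"] by auto
  then show False by simp
qed

text \<open>Koebe's square root trick. If \<open>\<Phi>\<close> omits \<open>x0\<close>, there is a holomorphic \<open>q\<close> with \<open>q\<^sup>2 = \<Phi> - x0\<close>. As
  \<open>q\<^sup>2\<close> is injective and \<open>q\<close> has no zeros, \<open>q\<close> never takes both a value and its negative. The range of
  \<open>q\<close> contains a disc about \<open>q 0\<close>, so \<open>q\<close> stays away from \<open>- q 0\<close>, and \<open>B = 1 / (q + q 0)\<close> is bounded.\<close>

lemma bounded_univalent_chart:
  assumes \<Phi>: "\<Phi> holomorphic_on ball 0 1" "inj_on \<Phi> (ball 0 1)"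
  shows "\<exists>B x0 q0 M. B holomorphic_on ball 0 1 \<and>
     (\<forall>z. norm z < 1 \<longrightarrow> B z \<noteq> 0 \<and> norm (B z) \<le> M \<and> \<Phi> z = x0 + (1 / B z - q0)\<^sup>2)"
proof -
  obtain x0 where x0: "x0 \<notin> \<Phi> ` ball 0 1" using univalent_not_onto[OF \<Phi>] by auto
  obtain q where q: "q holomorphic_on ball 0 1" "\<And>z. z \<in> ball 0 1 \<Longrightarrow> \<Phi> z - x0 = (q z)\<^sup>2"
  proof (rule contractible_imp_holomorphic_sqrt[of "\<lambda>z. \<Phi> z - x0" "ball 0 1"])
    show "(\<lambda>z. \<Phi> z - x0) holomorphic_on ball 0 1" by (intro holomorphic_intros \<Phi>)
    show "contractible (ball (0::complex) 1)" by (intro convex_imp_contractible convex_ball)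
  qed (use x0 in auto)
  have qinj: "z = w" if "z \<in> ball 0 1" "w \<in> ball 0 1" "q z = q w \<or> q z = - q w" for z w
  proof -
    have "(q z)\<^sup>2 = (q w)\<^sup>2" using that(3) by auto
    then have "\<Phi> z - x0 = \<Phi> w - x0" using q(2)[OF that(1)] q(2)[OF that(2)] by simp
    then have "\<Phi> z = \<Phi> w" by simp
    then show ?thesis using \<Phi>(2) that by (auto dest: inj_onD)
  qed
  have "open (q ` ball 0 1)"
    by (rule open_mapping_thm3[OF q(1) open_ball]) (use qinj in \<open>auto simp: inj_on_def\<close>)
  then obtain \<delta> where \<delta>: "\<delta> > 0" "ball (q 0) \<delta> \<subseteq> q ` ball 0 1"
    using open_contains_ball[of "q ` ball 0 1"] by (metis centre_in_ball imageI zero_less_one)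
  have far: "\<delta> \<le> norm (q z + q 0)" if z: "z \<in> ball 0 1" for z
  proof (rule ccontr)
    assume "\<not> ?thesis"
    then have "- q z \<in> ball (q 0) \<delta>" by (simp add: dist_norm add.commute)
    then obtain w where w: "w \<in> ball 0 1" "q w = - q z" using \<delta>(2) by auto
    then have "w = z" using qinj[OF w(1) z] by simp
    then have "q z = 0" using w(2) by simp
    then show False using q(2)[OF z] x0 z by auto
  qed
  define B where "B z = 1 / (q z + q 0)" for z
  have nz: "q z + q 0 \<noteq> 0" if "norm z < 1" for z using far[of z] \<delta>(1) that by auto
  have "B holomorphic_on ball 0 1" unfolding B_def using nz by (intro holomorphic_intros q) auto
  moreover have "B z \<noteq> 0 \<and> norm (B z) \<le> 1 / \<delta> \<and> \<Phi> z = x0 + (1 / B z - q 0)\<^sup>2" if "norm z < 1" for z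
    using nz[OF that] far[of z] \<delta>(1) that q(2)[of z]
    by (auto simp: B_def norm_divide frac_le algebra_simps)
  ultimately show ?thesis by blast
qed

section \<open>Boundary values of the Riemann map\<close>

text \<open>The chart at a singularity \<open>e\<close> turns \<open>U\<close> into a plane domain, because \<open>U\<close> does not contain \<open>e\<close>.\<close>

locale baker_map =
  fixes f :: "riemann_sphere \<Rightarrow> riemann_sphere" and E U :: "riemann_sphere set"
    and \<phi> :: "complex \<Rightarrow> riemann_sphere" and e :: riemann_sphere
  assumes K: "class_K f E" and baker: "baker_domain f E U" and \<phi>: "riemann_map \<phi> U" and e: "e \<in> E"
begin

lemma closed_E: "closed E" and countable_E: "countable E" and mero_f: "meromorphic_in f (- E)"
  using K by (auto simp: class_K_def compact_imp_closed)

lemma cont_f: "continuous_on (- E) f"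
  by (rule continuous_on_meromorphic_in[OF mero_f])

lemma U_component: "U \<in> components (fatou_set f E)" and fU: "f ` U \<subseteq> U"
  using baker by (auto simp: baker_domain_def)

lemma U_E: "U \<inter> E = {}"
  using in_components_subset[OF U_component] fatou_set_avoids by blast

lemma \<phi>_mero: "sphere_meromorphic_on \<phi> (ball 0 1)" and \<phi>_image: "\<phi> ` ball 0 1 = U" and \<phi>_inj: "inj_on \<phi> (ball 0 1)"
  using \<phi> by (auto simp: riemann_map_def bij_betw_def)

lemma \<phi>_cont: "continuous_on (ball 0 1) \<phi>"
  using \<phi>_mero by (simp add: sphere_meromorphic_on_def)

lemma \<phi>_neq_e: "z \<in> ball 0 1 \<Longrightarrow> \<phi> z \<noteq> e"
  using \<phi>_image U_E e by blast

definition "\<Phi> z = chart e (\<phi> z)"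

lemma \<phi>_eq: "z \<in> ball 0 1 \<Longrightarrow> \<phi> z = unchart e (\<Phi> z)"
  by (simp add: \<Phi>_def unchart_chart \<phi>_neq_e)

lemma \<Phi>_hol: "\<Phi> holomorphic_on ball 0 1"
  unfolding \<Phi>_def[abs_def] by (rule holomorphic_chart_compose[OF \<phi>_mero]) (use \<phi>_neq_e in auto)

lemma \<Phi>_inj: "inj_on \<Phi> (ball 0 1)"
  using \<phi>_inj \<phi>_eq by (metis (no_types, lifting) inj_on_def)

lemma open_U: "open U"
proof -
  have "open (\<Phi> ` ball 0 1)" by (rule open_mapping_thm3[OF \<Phi>_hol open_ball \<Phi>_inj])
  then have "open (- {e} \<inter> chart e -` (\<Phi> ` ball 0 1))"
    by (intro continuous_open_preimage[OF continuous_on_chart]) auto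
  moreover have "- {e} \<inter> chart e -` (\<Phi> ` ball 0 1) = U"
  proof
    show "- {e} \<inter> chart e -` (\<Phi> ` ball 0 1) \<subseteq> U"
    proof
      fix x assume "x \<in> - {e} \<inter> chart e -` (\<Phi> ` ball 0 1)"
      then obtain z where z: "x \<noteq> e" "z \<in> ball 0 1" "chart e x = \<Phi> z" by auto
      then have "x = \<phi> z" by (metis \<phi>_eq unchart_chart)
      then show "x \<in> U" using z \<phi>_image by auto
    qed
    show "U \<subseteq> - {e} \<inter> chart e -` (\<Phi> ` ball 0 1)"
    proof
      fix x assume "x \<in> U"
      then obtain z where "z \<in> ball 0 1" "x = \<phi> z" using \<phi>_image by blast
      then show "x \<in> - {e} \<inter> chart e -` (\<Phi> ` ball 0 1)" using \<phi>_neq_e[of z] by (auto simp: \<Phi>_def)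
    qed
  qed
  ultimately show ?thesis by simp
qed

abbreviation g :: "complex \<Rightarrow> complex" where "g \<equiv> inner_function f \<phi>"

lemma g_ball: "norm z < 1 \<Longrightarrow> norm (g z) < 1" and \<phi>_g: "norm z < 1 \<Longrightarrow> \<phi> (g z) = f (\<phi> z)"
proof -
  assume "norm z < 1"
  then have "f (\<phi> z) \<in> \<phi> ` ball 0 1" using fU \<phi>_image by auto
  then have "g z \<in> ball 0 1" "\<phi> (g z) = f (\<phi> z)"
    unfolding inner_function_def o_def by (rule inv_into_into, rule f_inv_into_f)
  then show "norm (g z) < 1" "\<phi> (g z) = f (\<phi> z)" by auto
qed

lemma g_hol: "g holomorphic_on ball 0 1"
proof (rule holomorphic_inverse_compose[OF \<Phi>_hol \<Phi>_inj])
  have "(\<lambda>z. chart e (f (\<phi> z))) holomorphic_on ball 0 1"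
    by (rule holomorphic_chart_compose2[OF mero_f \<phi>_mero open_ball open_U]) (use U_E \<phi>_image fU e in auto)
  then show "(\<lambda>z. \<Phi> (g z)) holomorphic_on ball 0 1"
    by (rule holomorphic_transform) (simp add: \<Phi>_def \<phi>_g)
qed (simp add: g_ball)

text \<open>The inverse of the Riemann map is continuous on \<open>U\<close>, so a radial limit in \<open>U\<close> would force the radius
  itself to converge inside the disc.\<close>

lemma radial_lim_not_in_U:
  assumes \<zeta>: "norm \<zeta> = 1" and x: "radial_lim \<phi> \<zeta> x"
  shows "x \<in> closure U" "x \<notin> U"
proof -
  have ev: "\<forall>\<^sub>F r in at_left 1. \<phi> (of_real r * \<zeta>) \<in> U"
    using eventually_radius_in_ball[OF \<zeta>] by eventually_elim (use \<phi>_image in auto)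
  show "x \<in> closure U"
    by (rule Lim_in_closed_set[OF closed_closure _ _ x[unfolded radial_lim_def]])
       (use ev closure_subset in \<open>auto elim!: eventually_mono\<close>)
  show "x \<notin> U"
  proof
    assume xU: "x \<in> U"
    obtain G where G: "G holomorphic_on \<Phi> ` ball 0 1" "\<And>z. z \<in> ball 0 1 \<Longrightarrow> G (\<Phi> z) = z"
      using univalent_inverse[OF \<Phi>_hol \<Phi>_inj] by blast
    obtain z where z: "z \<in> ball 0 1" "x = \<phi> z" using xU \<phi>_image by auto
    have "open (\<Phi> ` ball 0 1)" by (rule open_mapping_thm3[OF \<Phi>_hol open_ball \<Phi>_inj])
    then have "isCont G (\<Phi> z)" using G(1) z(1)
      by (meson continuous_on_eq_continuous_at holomorphic_on_imp_continuous_on imageI)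
    moreover have "((\<lambda>r. chart e (\<phi> (of_real r * \<zeta>))) \<longlongrightarrow> chart e x) (at_left 1)"
    proof (rule isCont_tendsto_compose[OF isCont_chart x[unfolded radial_lim_def]])
      show "x \<noteq> e" using xU U_E e by blast
    qed
    ultimately have "((\<lambda>r. G (\<Phi> (of_real r * \<zeta>))) \<longlongrightarrow> G (\<Phi> z)) (at_left 1)"
      unfolding \<Phi>_def z(2) by (rule isCont_tendsto_compose)
    moreover have "\<forall>\<^sub>F r in at_left 1. G (\<Phi> (of_real r * \<zeta>)) = of_real r * \<zeta>"
      using eventually_radius_in_ball[OF \<zeta>] by eventually_elim (simp add: G)
    ultimately have "((\<lambda>r. of_real r * \<zeta>) \<longlongrightarrow> z) (at_left 1)"
      using G(2)[OF z(1)] by (auto intro: Lim_transform_eventually)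
    moreover have "((\<lambda>r. of_real r * \<zeta>) \<longlongrightarrow> of_real 1 * \<zeta>) (at_left 1)" by (intro tendsto_intros)
    ultimately have "z = of_real 1 * \<zeta>" by (rule tendsto_unique[rotated]) simp
    then show False using z(1) \<zeta> by simp
  qed
qed

definition triple_points :: "riemann_sphere set" where
  "triple_points = {x. x \<notin> U \<and> x \<noteq> e \<and> three_radii \<phi> x}"

lemma countable_triple_points: "countable triple_points"
proof -
  define T where "T = {x. x \<notin> \<Phi> ` ball 0 1 \<and> three_radii \<Phi> x}"
  have T: "countable T"
    unfolding T_def by (rule countable_triple_radial_limits[OF holomorphic_on_imp_continuous_on[OF \<Phi>_hol] \<Phi>_inj])
  have lim: "radial_lim \<Phi> \<zeta> (chart e x)" if "radial_lim \<phi> \<zeta> x" "x \<noteq> e" for \<zeta> x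
    using isCont_tendsto_compose[OF isCont_chart[OF that(2)]] that(1) unfolding radial_lim_def \<Phi>_def by blast
  have "chart e x \<in> T" if "x \<in> triple_points" for x
  proof -
    have x: "x \<notin> U" "x \<noteq> e" using that by (auto simp: triple_points_def)
    have "chart e x \<notin> \<Phi> ` ball 0 1"
    proof
      assume "chart e x \<in> \<Phi> ` ball 0 1"
      then obtain z where z: "z \<in> ball 0 1" "chart e x = \<Phi> z" by auto
      then have "x = \<phi> z" by (metis \<phi>_eq unchart_chart x(2))
      then show False using x z \<phi>_image by auto
    qed
    then show ?thesis using that lim unfolding triple_points_def three_radii_def T_def mem_Collect_eq by metis
  qed
  note inT = this
  have "triple_points \<subseteq> unchart e ` T"
  proof
    fix x assume x: "x \<in> triple_points"
    then have "x = unchart e (chart e x)" by (simp add: triple_points_def unchart_chart)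
    then show "x \<in> unchart e ` T" using inT[OF x] by blast
  qed
  then show ?thesis by (rule countable_subset) (intro countable_image T)
qed

text \<open>Koebe's bounded function for \<open>\<Phi>\<close>, with \<open>R\<close> undoing the trick and the chart. Sending \<open>0\<close> to \<open>e\<close> makes
  \<open>R\<close> continuous everywhere, so radial limits of \<open>B\<close> give radial limits of \<open>\<phi>\<close>; the fibres being finite,
  null sets for the boundary values of \<open>B\<close> give null sets for those of \<open>\<phi>\<close>.\<close>

lemma exists_B: "\<exists>B R M. B holomorphic_on ball 0 1 \<and> (\<forall>z. norm z < 1 \<longrightarrow> norm (B z) \<le> M \<and> \<phi> z = R (B z)) \<and>
   continuous_on UNIV R \<and> (\<forall>x. finite (R -` {x}))"
proof -
  obtain B x0 q0 M where B: "B holomorphic_on ball 0 1"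
    "\<And>z. norm z < 1 \<Longrightarrow> B z \<noteq> 0 \<and> norm (B z) \<le> M \<and> \<Phi> z = x0 + (1 / B z - q0)\<^sup>2"
    using bounded_univalent_chart[OF \<Phi>_hol \<Phi>_inj] by (elim exE conjE) (rule that, assumption, blast)
  define R where "R b = (if b = 0 then e else unchart e (x0 + (1 / b - q0)\<^sup>2))" for b
  have cR: "isCont R b" for b
  proof (cases "b = 0")
    case True
    have "filterlim (\<lambda>b. inverse b + (- q0)) at_infinity (at 0)"
      by (intro filterlim_inverse_at_infinity tendsto_add_filterlim_at_infinity'[OF _ tendsto_const])
    then have "filterlim (\<lambda>b. (inverse b + (- q0)) ^ 2) at_infinity (at 0)"
      by (intro Limits.filterlim_power_at_infinity) auto
    then have "filterlim (\<lambda>b. x0 + (inverse b + (- q0)) ^ 2) at_infinity (at 0)"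
      by (rule tendsto_add_filterlim_at_infinity[OF tendsto_const])
    then have "((\<lambda>b. unchart e (x0 + (inverse b + (- q0)) ^ 2)) \<longlongrightarrow> e) (at 0)"
      by (rule filterlim_compose[OF unchart_at_infinity])
    moreover have "\<forall>\<^sub>F b in at 0. unchart e (x0 + (inverse b + (- q0)) ^ 2) = R b"
      by (simp add: eventually_at_filter R_def inverse_eq_divide)
    ultimately have "(R \<longlongrightarrow> e) (at 0)" by (rule Lim_transform_eventually)
    then show ?thesis using True by (simp add: isCont_def R_def)
  next
    case False
    have "isCont (unchart e) w" for w using continuous_on_unchart by (simp add: continuous_on_eq_continuous_at)
    moreover have "isCont (\<lambda>b. x0 + (1 / b - q0)\<^sup>2) b" using False by (intro continuous_intros) auto
    ultimately have "isCont (\<lambda>b. unchart e (x0 + (1 / b - q0)\<^sup>2)) b" by (metis isCont_o2)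
    moreover have "\<forall>\<^sub>F v in nhds b. unchart e (x0 + (1 / v - q0)\<^sup>2) = R v"
      using t1_space_nhds[OF False] by eventually_elim (simp add: R_def)
    ultimately show ?thesis by (simp add: isCont_cong)
  qed
  have fin: "finite (R -` {x})" for x
  proof -
    define s where "s = csqrt (chart e x - x0)"
    have "R -` {x} \<subseteq> {0, 1 / (q0 + s), 1 / (q0 - s)}"
    proof
      fix b assume "b \<in> R -` {x}"
      then have b: "R b = x" by simp
      show "b \<in> {0, 1 / (q0 + s), 1 / (q0 - s)}"
      proof (cases "b = 0")
        case False
        then have "chart e x = x0 + (1 / b - q0)\<^sup>2" using b by (auto simp: R_def)
        then have "(1 / b - q0)\<^sup>2 = s\<^sup>2" by (simp add: s_def)
        then have "1 / b - q0 = s \<or> 1 / b - q0 = - s" by (simp add: power2_eq_iff)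
        then have "1 / b = q0 + s \<or> 1 / b = q0 - s" by (auto simp: algebra_simps)
        then have "b = 1 / (q0 + s) \<or> b = 1 / (q0 - s)" by (metis div_by_1 divide_divide_eq_right mult_1)
        then show ?thesis by auto
      qed simp
    qed
    then show ?thesis by (rule finite_subset) simp
  qed
  have "\<phi> z = R (B z)" if "norm z < 1" for z using B(2)[OF that] \<phi>_eq[of z] that by (simp add: R_def)
  then show ?thesis using B cR fin by (intro exI[of _ B] exI[of _ R] exI[of _ M]) (auto simp: continuous_on_eq_continuous_at)
qed

end

locale baker_map_bounded = baker_map +
  fixes B :: "complex \<Rightarrow> complex" and R :: "complex \<Rightarrow> riemann_sphere" and M :: real
  assumes B_hol: "B holomorphic_on ball 0 1" and B_bound: "\<And>z. norm z < 1 \<Longrightarrow> norm (B z) \<le> M"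
    and \<phi>_RB: "\<And>z. norm z < 1 \<Longrightarrow> \<phi> z = R (B z)"
    and R_cont: "continuous_on UNIV R" and R_finite: "\<And>x. finite (R -` {x})"
begin

definition bval :: "complex \<Rightarrow> riemann_sphere" where "bval \<zeta> = R (bdry B \<zeta>)"

lemma isCont_R: "isCont R b"
  using R_cont by (simp add: continuous_on_eq_continuous_at)

lemma bval_radial_lim: "AE \<zeta> in circ. radial_lim \<phi> \<zeta> (bval \<zeta>)"
proof -
  have "AE \<zeta> in circ. ((\<lambda>r. B (of_real r * \<zeta>)) \<longlongrightarrow> bdry B \<zeta>) (at_left 1)"
    by (rule Fatou_radial_limit[OF B_hol B_bound])
  then show ?thesis using AE_space
  proof eventually_elim
    case (elim \<zeta>)
    have "((\<lambda>r. R (B (of_real r * \<zeta>))) \<longlongrightarrow> bval \<zeta>) (at_left 1)"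
      unfolding bval_def by (rule isCont_tendsto_compose[OF isCont_R elim(1)])
    moreover have "\<forall>\<^sub>F r in at_left 1. R (B (of_real r * \<zeta>)) = \<phi> (of_real r * \<zeta>)"
      using eventually_radius_in_ball[of \<zeta>] elim(2) by (auto elim!: eventually_mono simp: \<phi>_RB)
    ultimately show ?case unfolding radial_lim_def by (rule Lim_transform_eventually)
  qed
qed

text \<open>If \<open>R b = x\<close> lies outside \<open>U\<close>, then \<open>B - b\<close> has no zeros.\<close>

lemma bval_avoids_point:
  assumes x: "x \<notin> U"
  shows "AE \<zeta> in circ. bval \<zeta> \<noteq> x"
proof -
  have "AE \<zeta> in circ. bdry B \<zeta> \<noteq> b" if b: "R b = x" for b
  proof -
    have h: "(\<lambda>z. B z - b) holomorphic_on ball 0 1" by (intro holomorphic_intros B_hol)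
    have bd: "norm (B z - b) \<le> M + norm b" if "norm z < 1" for z
      using norm_triangle_ineq4[of "B z" b] B_bound[OF that] by simp
    have nz: "B z - b \<noteq> 0" if "norm z < 1" for z
    proof
      assume "B z - b = 0"
      then have "\<phi> z = x" using \<phi>_RB[OF that] b by simp
      moreover have "\<phi> z \<in> U" using \<phi>_image that by auto
      ultimately show False using x by simp
    qed
    have 1: "AE \<zeta> in circ. bdry (\<lambda>z. B z - b) \<zeta> \<noteq> 0"
      by (rule zero_free_boundary_nonzero[OF h bd nz])
    have 2: "AE \<zeta> in circ. ((\<lambda>r. B (of_real r * \<zeta>)) \<longlongrightarrow> bdry B \<zeta>) (at_left 1)"
      by (rule Fatou_radial_limit[OF B_hol B_bound])
    show ?thesis using 1 2
    proof eventually_elim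
      case (elim \<zeta>)
      have "bdry (\<lambda>z. B z - b) \<zeta> = bdry B \<zeta> - b"
        by (rule bdry_eqI) (intro tendsto_intros elim(2))
      then show ?case using elim(1) by auto
    qed
  qed
  then have "AE \<zeta> in circ. \<forall>b\<in>R -` {x}. bdry B \<zeta> \<noteq> b"
    by (intro AE_ball_countable' countable_finite R_finite) auto
  then show ?thesis by eventually_elim (auto simp: bval_def)
qed

lemma bval_avoids_countable:
  assumes N: "countable N" "N \<inter> U = {}"
  shows "AE \<zeta> in circ. bval \<zeta> \<notin> N"
proof -
  have "AE \<zeta> in circ. \<forall>x\<in>N. bval \<zeta> \<noteq> x"
    using N by (intro AE_ball_countable' bval_avoids_point) auto
  then show ?thesis by eventually_elim auto
qed

lemma bval_boundary: "AE \<zeta> in circ. bval \<zeta> \<in> boundary E U"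
proof -
  have "AE \<zeta> in circ. bval \<zeta> \<notin> E"
    using U_E by (intro bval_avoids_countable countable_E) auto
  then show ?thesis using bval_radial_lim AE_space
  proof eventually_elim
    case (elim \<zeta>)
    then show ?case using radial_lim_not_in_U[of \<zeta> "bval \<zeta>"] open_U
      by (auto simp: boundary_def frontier_def interior_open)
  qed
qed

text \<open>A point of the boundary that is mapped into \<open>U\<close> would belong to the Fatou set, hence to \<open>U\<close>.\<close>

lemma f_boundary_not_in_U:
  assumes "x \<in> boundary E U"
  shows "f x \<notin> U"
proof
  assume "f x \<in> U"
  then have "f x \<in> fatou_set f E" using in_components_subset[OF U_component] by auto
  then have "x \<in> fatou_set f E"
    by (rule fatou_set_backward[OF closed_E cont_f, rotated]) (use assms in \<open>simp add: boundary_def\<close>)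
  moreover have "x \<in> closure U" "x \<notin> U" using assms open_U by (auto simp: boundary_def frontier_def interior_open)
  ultimately show False using frontier_component_disjoint[OF U_component] by blast
qed

lemma \<phi>_g_tendsto:
  assumes "norm \<zeta> = 1" "radial_lim \<phi> \<zeta> x" "x \<notin> E"
  shows "((\<lambda>r. \<phi> (g (of_real r * \<zeta>))) \<longlongrightarrow> f x) (at_left 1)"
proof -
  have "isCont f x" using cont_f closed_E assms(3) by (simp add: continuous_on_eq_continuous_at open_Compl)
  then have "((\<lambda>r. f (\<phi> (of_real r * \<zeta>))) \<longlongrightarrow> f x) (at_left 1)"
    using assms(2) unfolding radial_lim_def by (rule isCont_tendsto_compose)
  moreover have "\<forall>\<^sub>F r in at_left 1. f (\<phi> (of_real r * \<zeta>)) = \<phi> (g (of_real r * \<zeta>))"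
    using eventually_radius_in_ball[OF assms(1)] by eventually_elim (simp add: \<phi>_g)
  ultimately show ?thesis by (rule Lim_transform_eventually)
qed

text \<open>If \<open>g\<close> had a radial limit inside the disc, then \<open>\<phi> \<circ> g = f \<circ> \<phi>\<close> would have a radial limit in
  \<open>U\<close>; but this limit is the image under \<open>f\<close> of a boundary point.\<close>

lemma g_inner: "AE \<zeta> in circ. norm (bdry g \<zeta>) = 1"
proof -
  have "AE \<zeta> in circ. ((\<lambda>r. g (of_real r * \<zeta>)) \<longlongrightarrow> bdry g \<zeta>) (at_left 1)"
    by (rule Fatou_radial_limit[OF g_hol less_imp_le[OF g_ball]])
  then show ?thesis using bval_radial_lim bval_boundary AE_space
  proof eventually_elim
    case (elim \<zeta>)
    let ?w = "bdry g \<zeta>"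
    have \<zeta>: "norm \<zeta> = 1" using elim(4) by simp
    have "\<forall>\<^sub>F r in at_left 1. norm (g (of_real r * \<zeta>)) \<le> 1"
      using eventually_radius_in_ball[OF \<zeta>] by eventually_elim (simp add: g_ball less_imp_le)
    then have "norm ?w \<le> 1" using tendsto_norm[OF elim(1)] by (intro tendsto_upperbound) auto
    moreover have "\<not> norm ?w < 1"
    proof
      assume w: "norm ?w < 1"
      then have "isCont \<phi> ?w" using \<phi>_cont by (simp add: continuous_on_eq_continuous_at)
      then have "((\<lambda>r. \<phi> (g (of_real r * \<zeta>))) \<longlongrightarrow> \<phi> ?w) (at_left 1)"
        using elim(1) by (rule isCont_tendsto_compose)
      moreover have "((\<lambda>r. \<phi> (g (of_real r * \<zeta>))) \<longlongrightarrow> f (bval \<zeta>)) (at_left 1)"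
        using elim(3) by (intro \<phi>_g_tendsto[OF \<zeta> elim(2)]) (simp add: boundary_def)
      ultimately have "f (bval \<zeta>) = \<phi> ?w" by (intro tendsto_unique[of "at_left (1::real)"]) auto
      then show False using f_boundary_not_in_U[OF elim(3)] \<phi>_image w by auto
    qed
    ultimately show ?case by simp
  qed
qed

text \<open>Both sides are the radial limit of \<open>\<phi> \<circ> g = f \<circ> \<phi>\<close>: one by the theorem on compositions with inner
  functions, the other by continuity of \<open>f\<close>.\<close>

lemma bval_bmap: "AE \<zeta> in circ. bval (bmap g \<zeta>) = f (bval \<zeta>)"
proof -
  have "AE \<zeta> in circ. ((\<lambda>r. B (g (of_real r * \<zeta>))) \<longlongrightarrow> bdry B (bmap g \<zeta>)) (at_left 1)"
    by (rule bdry_compose_inner[OF g_hol g_ball g_inner B_hol B_bound])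
  then show ?thesis using bval_radial_lim bval_boundary AE_space
  proof eventually_elim
    case (elim \<zeta>)
    have \<zeta>: "norm \<zeta> = 1" using elim(4) by simp
    have "((\<lambda>r. R (B (g (of_real r * \<zeta>)))) \<longlongrightarrow> bval (bmap g \<zeta>)) (at_left 1)"
      unfolding bval_def by (rule isCont_tendsto_compose[OF isCont_R elim(1)])
    moreover have "\<forall>\<^sub>F r in at_left 1. R (B (g (of_real r * \<zeta>))) = \<phi> (g (of_real r * \<zeta>))"
      using eventually_radius_in_ball[OF \<zeta>] by eventually_elim (simp add: g_ball \<phi>_RB)
    ultimately have "((\<lambda>r. \<phi> (g (of_real r * \<zeta>))) \<longlongrightarrow> bval (bmap g \<zeta>)) (at_left 1)"
      by (rule Lim_transform_eventually)
    moreover have "((\<lambda>r. \<phi> (g (of_real r * \<zeta>))) \<longlongrightarrow> f (bval \<zeta>)) (at_left 1)"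
      using elim(3) by (intro \<phi>_g_tendsto[OF \<zeta> elim(2)]) (simp add: boundary_def)
    ultimately show ?case by (intro tendsto_unique[of "at_left (1::real)"]) auto
  qed
qed

text \<open>Required along the whole forward orbit, so that \<open>good\<close> is inherited by images under \<open>bmap g\<close>.\<close>

definition good :: "complex \<Rightarrow> bool" where
  "good \<zeta> \<longleftrightarrow> (\<forall>n. let \<eta> = (bmap g ^^ n) \<zeta> in radial_lim \<phi> \<eta> (bval \<eta>) \<and> bval \<eta> \<in> boundary E U \<and>
     bval \<eta> \<notin> triple_points \<and> bval (bmap g \<eta>) = f (bval \<eta>))"

lemma AE_good: "AE \<zeta> in circ. good \<zeta>"
proof -
  have "AE \<zeta> in circ. bval \<zeta> \<notin> triple_points"
    by (rule bval_avoids_countable[OF countable_triple_points]) (auto simp: triple_points_def)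
  then have "AE \<zeta> in circ. radial_lim \<phi> \<zeta> (bval \<zeta>) \<and> bval \<zeta> \<in> boundary E U \<and>
     bval \<zeta> \<notin> triple_points \<and> bval (bmap g \<zeta>) = f (bval \<zeta>)"
    using bval_radial_lim bval_boundary bval_bmap by eventually_elim blast
  from bmap_iterate_AE[OF g_hol g_ball g_inner this] show ?thesis
    unfolding good_def Let_def .
qed

lemma good_iterate: "good \<zeta> \<Longrightarrow> good ((bmap g ^^ n) \<zeta>)"
  unfolding good_def Let_def by (metis comp_apply funpow_add)

lemma good_conjugacy: "good \<zeta> \<Longrightarrow> (f ^^ n) (bval \<zeta>) = bval ((bmap g ^^ n) \<zeta>)"
  by (induction n) (auto simp: good_def Let_def)

lemma norm_bmap_iterate: "norm \<zeta> = 1 \<Longrightarrow> norm ((bmap g ^^ n) \<zeta>) = 1"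
  by (cases n) auto

lemma good_fibre_le_2:
  assumes good: "good \<zeta>" "good \<zeta>1" "good \<zeta>2" "good \<zeta>3" and n: "norm \<zeta>1 = 1" "norm \<zeta>2 = 1" "norm \<zeta>3 = 1"
    and eq: "bval \<zeta>1 = bval \<zeta>" "bval \<zeta>2 = bval \<zeta>" "bval \<zeta>3 = bval \<zeta>"
  shows "\<zeta>1 = \<zeta>2 \<or> \<zeta>1 = \<zeta>3 \<or> \<zeta>2 = \<zeta>3"
proof (rule ccontr)
  assume ne: "\<not> ?thesis"
  have g0: "radial_lim \<phi> \<eta> (bval \<eta>) \<and> bval \<eta> \<in> boundary E U \<and> bval \<eta> \<notin> triple_points" if "good \<eta>" for \<eta>
    using that unfolding good_def Let_def by (metis funpow_0)
  have "bval \<zeta> \<in> triple_points"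
    unfolding triple_points_def three_radii_def mem_Collect_eq
  proof (intro conjI exI)
    show "bval \<zeta> \<notin> U" "bval \<zeta> \<noteq> e"
      using g0[OF good(1)] e open_U by (auto simp: boundary_def frontier_def interior_open)
    show "radial_lim \<phi> \<zeta>1 (bval \<zeta>)" "radial_lim \<phi> \<zeta>2 (bval \<zeta>)" "radial_lim \<phi> \<zeta>3 (bval \<zeta>)"
      using g0 good eq by metis+
  qed (use ne n in auto)
  then show False using g0[OF good(1)] by blast
qed

end

section \<open>Measurability of the radial extension and essential values\<close>

lemma Lim_eq_const_if_divergent:
  fixes F :: "real \<Rightarrow> riemann_sphere"
  assumes "\<nexists>x. (F \<longlongrightarrow> x) (at_left 1)"
  shows "Lim (at_left 1) F = (THE x. False)"
  unfolding t2_space_class.Lim_def using assms by simp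

lemma convergent_at_left_iff_Cauchy:
  fixes F :: "real \<Rightarrow> riemann_sphere"
  assumes F: "continuous_on {0<..<1} F"
  shows "(\<exists>x. (F \<longlongrightarrow> x) (at_left 1)) \<longleftrightarrow>
    (\<forall>k::nat. \<exists>n::nat. \<forall>r\<in>{radius n<..<1}. \<forall>s\<in>{radius n<..<1}. dist (F r) (F s) \<le> 1 / (real k + 1))" (is "?L \<longleftrightarrow> ?R")
proof
  assume ?L
  then obtain x where x: "(F \<longlongrightarrow> x) (at_left 1)" by blast
  show ?R
  proof
    fix k :: nat
    have "\<forall>\<^sub>F r in at_left 1. dist (F r) x < 1 / (real k + 1) / 2" using x by (rule tendstoD) simp
    then obtain b where b: "b < 1" "\<And>r. b < r \<Longrightarrow> r < 1 \<Longrightarrow> dist (F r) x < 1 / (real k + 1) / 2"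
      unfolding eventually_at_left_field by blast
    have "\<forall>\<^sub>F n in sequentially. b < radius n"
      using radius_tendsto b(1) by (intro order_tendstoD(1)[of radius 1]) (auto simp: filterlim_at)
    then obtain n where "b < radius n" by (auto simp: eventually_sequentially)
    then have "dist (F r) (F s) \<le> 1 / (real k + 1)" if "r \<in> {radius n<..<1}" "s \<in> {radius n<..<1}" for r s
      using b(2)[of r] b(2)[of s] that dist_triangle_half_l[of "F r" x "1 / (real k + 1)" "F s"] by (simp add: dist_commute)
    then show "\<exists>n. \<forall>r\<in>{radius n<..<1}. \<forall>s\<in>{radius n<..<1}. dist (F r) (F s) \<le> 1 / (real k + 1)" by blast
  qed
next
  assume R: ?R
  have small: "\<exists>n. \<forall>r\<in>{radius n<..<1}. \<forall>s\<in>{radius n<..<1}. dist (F r) (F s) < \<epsilon>" if pos: "\<epsilon> > 0" for \<epsilon> :: real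
  proof -
    obtain k where "inverse (real (Suc k)) < \<epsilon>" using reals_Archimedean[OF pos] by blast
    then have k: "1 / (real k + 1) < \<epsilon>" by (simp add: inverse_eq_divide add.commute)
    then show ?thesis using R[rule_format, of k] by (meson le_less_trans)
  qed
  have ev: "\<forall>\<^sub>F m in sequentially. radius n < radius m" for n
    using radius_tendsto radius_bounds(2)[of n] by (intro order_tendstoD(1)[of radius 1]) (auto simp: filterlim_at)
  have "Cauchy (\<lambda>m. F (radius m))"
  proof (rule metric_CauchyI)
    fix \<epsilon> :: real assume "\<epsilon> > 0"
    then obtain n where n: "\<forall>r\<in>{radius n<..<1}. \<forall>s\<in>{radius n<..<1}. dist (F r) (F s) < \<epsilon>" using small by blast
    obtain N where "\<And>m. m \<ge> N \<Longrightarrow> radius n < radius m" using ev[of n] by (auto simp: eventually_sequentially)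
    then show "\<exists>M. \<forall>m\<ge>M. \<forall>n\<ge>M. dist (F (radius m)) (F (radius n)) < \<epsilon>"
      using n radius_bounds by (intro exI[of _ N]) auto
  qed
  then obtain x where x: "(\<lambda>m. F (radius m)) \<longlonglongrightarrow> x"
    using complete_sphere unfolding complete_def by blast
  have "(F \<longlongrightarrow> x) (at_left 1)"
  proof (rule tendstoI)
    fix \<epsilon> :: real assume "\<epsilon> > 0"
    then obtain n where n: "\<forall>r\<in>{radius n<..<1}. \<forall>s\<in>{radius n<..<1}. dist (F r) (F s) < \<epsilon> / 2"
      using small[of "\<epsilon> / 2"] by auto
    have "\<forall>\<^sub>F m in sequentially. dist (F (radius m)) x < \<epsilon> / 2" using x \<open>\<epsilon> > 0\<close> by (intro tendstoD) auto
    with ev[of n] have "\<forall>\<^sub>F m in sequentially. dist (F (radius m)) x < \<epsilon> / 2 \<and> radius n < radius m"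
      by eventually_elim simp
    then obtain m where m: "dist (F (radius m)) x < \<epsilon> / 2" "radius n < radius m"
      by (auto simp: eventually_sequentially)
    have "\<forall>\<^sub>F r in at_left 1. r \<in> {radius n<..<1}" by (rule eventually_at_left_real) (rule radius_bounds)
    then show "\<forall>\<^sub>F r in at_left 1. dist (F r) x < \<epsilon>"
    proof eventually_elim
      case (elim r)
      have "dist (F r) (F (radius m)) < \<epsilon> / 2" using n elim m(2) radius_bounds by auto
      then show ?case using m(1) dist_triangle[of "F r" x "F (radius m)"] by linarith
    qed
  qed
  then show ?L by blast
qed

text \<open>Arc length on the circle is not completed here, so the set of directions without radial limit has to be a
  Borel set, not merely a null set. The Cauchy criterion, available because the sphere is complete, describes its
  complement by closed conditions.\<close>

lemma measurable_radial_extension: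
  assumes \<phi>: "continuous_on (ball 0 1) \<phi>"
  shows "radial_extension \<phi> \<in> borel_measurable circ"
proof -
  define C where "C = {\<zeta>\<in>sphere 0 1. \<exists>x. ((\<lambda>r. \<phi> (of_real r * \<zeta>)) \<longlongrightarrow> x) (at_left 1)}"
  have cr: "continuous_on {0<..<1} (\<lambda>r. \<phi> (of_real r * \<zeta>))" if "norm \<zeta> = 1" for \<zeta>
    by (rule continuous_on_compose2[OF \<phi>]) (use that in \<open>auto intro!: continuous_intros simp: norm_mult\<close>)
  have cz: "continuous_on (sphere 0 1) (\<lambda>\<zeta>. \<phi> (of_real r * \<zeta>))" if "0 < r" "r < 1" for r
    by (rule continuous_on_compose2[OF \<phi>]) (use that in \<open>auto intro!: continuous_intros simp: norm_mult\<close>)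
  have C_eq: "C = (\<Inter>k. \<Union>n. \<Inter>r\<in>{radius n<..<1}. \<Inter>s\<in>{radius n<..<1}.
      {\<zeta>\<in>sphere 0 1. dist (\<phi> (of_real r * \<zeta>)) (\<phi> (of_real s * \<zeta>)) \<le> 1 / (real k + 1)})"
    (is "C = (\<Inter>k. \<Union>n. ?D k n)")
  proof -
    have ne: "{radius n<..<1} \<noteq> {}" for n using radius_bounds(2)[of n] by simp
    have "\<zeta> \<in> C \<longleftrightarrow> norm \<zeta> = 1 \<and> (\<forall>k::nat. \<exists>n::nat. \<forall>r\<in>{radius n<..<1}. \<forall>s\<in>{radius n<..<1}.
        dist (\<phi> (of_real r * \<zeta>)) (\<phi> (of_real s * \<zeta>)) \<le> 1 / (real k + 1))" for \<zeta>
      using convergent_at_left_iff_Cauchy[OF cr] by (auto simp: C_def)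
    moreover have "\<zeta> \<in> ?D k n \<longleftrightarrow> norm \<zeta> = 1 \<and> (\<forall>r\<in>{radius n<..<1}. \<forall>s\<in>{radius n<..<1}.
        dist (\<phi> (of_real r * \<zeta>)) (\<phi> (of_real s * \<zeta>)) \<le> 1 / (real k + 1))" for \<zeta> k n
    proof -
      obtain r0 where "r0 \<in> {radius n<..<1}" using ne by blast
      then show ?thesis by (simp only: INT_iff mem_Collect_eq mem_sphere_0) blast
    qed
    ultimately show ?thesis by (intro set_eqI) (simp only: INT_iff UN_iff UNIV_I, blast)
  qed
  have "closed (?D k n)" for k n
  proof (intro closed_INT ballI)
    fix r s assume rs: "r \<in> {radius n<..<1}" "s \<in> {radius n<..<1}"
    then have b: "0 < r" "r < 1" "0 < s" "s < 1" using radius_bounds(1)[of n] by auto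
    have "closedin (top_of_set (sphere 0 1)) (sphere 0 1 \<inter> (\<lambda>\<zeta>. dist (\<phi> (of_real r * \<zeta>)) (\<phi> (of_real s * \<zeta>))) -` {..1 / (real k + 1)})"
      using b by (intro continuous_closedin_preimage continuous_intros cz) auto
    then have "closed (sphere 0 1 \<inter> (\<lambda>\<zeta>. dist (\<phi> (of_real r * \<zeta>)) (\<phi> (of_real s * \<zeta>))) -` {..1 / (real k + 1)})"
      by (rule closedin_closed_trans) simp
    moreover have "sphere 0 1 \<inter> (\<lambda>\<zeta>. dist (\<phi> (of_real r * \<zeta>)) (\<phi> (of_real s * \<zeta>))) -` {..1 / (real k + 1)}
       = {\<zeta>\<in>sphere 0 1. dist (\<phi> (of_real r * \<zeta>)) (\<phi> (of_real s * \<zeta>)) \<le> 1 / (real k + 1)}" by auto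
    ultimately show "closed {\<zeta>\<in>sphere 0 1. dist (\<phi> (of_real r * \<zeta>)) (\<phi> (of_real s * \<zeta>)) \<le> 1 / (real k + 1)}" by simp
  qed
  then have "C \<in> sets borel" unfolding C_eq by (intro sets.countable_INT' sets.countable_UN borel_closed) auto
  moreover have CS: "C \<inter> sphere 0 1 = C" by (auto simp: C_def)
  ultimately have C: "C \<in> sets circ" using sets_circle_Int by metis
  show ?thesis
  proof (rule borel_measurable_LIMSEQ_metric)
    fix n
    show "(\<lambda>\<zeta>. if \<zeta> \<in> C then \<phi> (of_real (radius n) * \<zeta>) else (THE x. False)) \<in> borel_measurable circ"
      using C radius_bounds by (intro measurable_If_set borel_measurable_continuous_circle cz) (auto simp: CS)
  next
    fix \<zeta> assume \<zeta>: "\<zeta> \<in> space circ"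
    show "(\<lambda>n. if \<zeta> \<in> C then \<phi> (of_real (radius n) * \<zeta>) else (THE x. False)) \<longlonglongrightarrow> radial_extension \<phi> \<zeta>"
    proof (cases "\<zeta> \<in> C")
      case True
      then obtain x where x: "((\<lambda>r. \<phi> (of_real r * \<zeta>)) \<longlongrightarrow> x) (at_left 1)" by (auto simp: C_def)
      then have "radial_extension \<phi> \<zeta> = x" unfolding radial_extension_def by (intro tendsto_Lim) auto
      then show ?thesis using True filterlim_compose[OF x radius_tendsto] by simp
    next
      case False
      then have "radial_extension \<phi> \<zeta> = (THE x. False)"
        using \<zeta> unfolding radial_extension_def by (intro Lim_eq_const_if_divergent) (simp add: C_def)
      then show ?thesis using False by simp
    qed
  qed
qed

text \<open>By Lindeloef's theorem, almost all values of \<open>u\<close> are essential values.\<close>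

lemma infinite_essential_values:
  fixes u :: "complex \<Rightarrow> complex"
  assumes "u \<in> borel_measurable circ"
    and nS: "\<And>S. finite S \<Longrightarrow> \<not> (AE \<zeta> in circ. u \<zeta> \<in> S)"
  shows "infinite {c. \<forall>\<epsilon>>0. \<not> (AE \<zeta> in circ. u \<zeta> \<notin> ball c \<epsilon>)}" (is "infinite ?S")
proof
  assume fin: "finite ?S"
  define \<F> where "\<F> = {ball c \<epsilon> | c \<epsilon>. \<epsilon> > 0 \<and> (AE \<zeta> in circ. u \<zeta> \<notin> ball c \<epsilon>)}"
  have "\<And>S. S \<in> \<F> \<Longrightarrow> open S" by (auto simp: \<F>_def)
  then obtain \<F>' where F': "\<F>' \<subseteq> \<F>" "countable \<F>'" "\<Union>\<F>' = \<Union>\<F>"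
    using Lindelof by metis
  have "AE \<zeta> in circ. \<forall>X\<in>\<F>'. u \<zeta> \<notin> X"
    using F' by (intro AE_ball_countable') (auto simp: \<F>_def)
  then have "AE \<zeta> in circ. u \<zeta> \<in> ?S"
  proof eventually_elim
    case (elim \<zeta>)
    then have "u \<zeta> \<notin> \<Union>\<F>" using F'(3) by auto
    then show ?case by (auto simp: \<F>_def) (metis centre_in_ball)
  qed
  then show False using nS[OF fin] by blast
qed

section \<open>Dynamics on the boundary\<close>

context baker_map_bounded
begin

abbreviation M\<^sub>\<omega> :: "riemann_sphere measure" where "M\<^sub>\<omega> \<equiv> boundary_space f E U \<phi>"

definition surviving_boundary :: "riemann_sphere set" where "surviving_boundary = {x. \<forall>n. (f ^^ n) x \<in> boundary E U}"

lemma boundary_borel: "boundary E U \<in> sets borel"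
  unfolding boundary_def by (intro sets.Diff borel_closed closed_E) auto

lemma surviving_boundary_subset: "surviving_boundary \<subseteq> boundary E U" "surviving_boundary \<subseteq> - E"
proof -
  show "surviving_boundary \<subseteq> boundary E U" using funpow_0 unfolding surviving_boundary_def by (metis (mono_tags, lifting) mem_Collect_eq subsetI)
  then show "surviving_boundary \<subseteq> - E" by (auto simp: boundary_def)
qed

lemma f_surviving_boundary: "x \<in> surviving_boundary \<Longrightarrow> f x \<in> surviving_boundary"
  unfolding surviving_boundary_def mem_Collect_eq by (metis comp_apply funpow_Suc_right)

lemma f_preimage_borel: "A \<in> sets borel \<Longrightarrow> {x\<in>- E. f x \<in> A} \<in> sets borel"
proof -
  assume A: "A \<in> sets borel"
  have "f \<in> borel_measurable (restrict_space borel (- E))"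
    by (rule borel_measurable_continuous_on_restrict[OF cont_f])
  then have "f -` A \<inter> space (restrict_space borel (- E)) \<in> sets (restrict_space borel (- E))"
    using A by (rule measurable_sets)
  moreover have "f -` A \<inter> space (restrict_space borel (- E)) = {x\<in>- E. f x \<in> A}"
    by (auto simp: space_restrict_space)
  ultimately show ?thesis using closed_E by (auto simp: sets_restrict_space_iff borel_open open_Compl)
qed

lemma surviving_boundary_borel: "surviving_boundary \<in> sets borel"
proof -
  have "{x. \<forall>k\<le>n. (f ^^ k) x \<in> boundary E U} \<in> sets borel" for n
  proof (induction n)
    case 0 then show ?case using boundary_borel by simp
  next
    case (Suc n)
    have "{x. \<forall>k\<le>Suc n. (f ^^ k) x \<in> boundary E U} =
      boundary E U \<inter> {x\<in>- E. f x \<in> {x. \<forall>k\<le>n. (f ^^ k) x \<in> boundary E U}}" (is "?L = ?R")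
    proof (intro set_eqI iffI)
      fix x assume x: "x \<in> ?L"
      then have "x \<in> boundary E U" by (auto dest: spec[of _ 0])
      moreover have "(f ^^ k) (f x) \<in> boundary E U" if "k \<le> n" for k
      proof -
        have "(f ^^ Suc k) x \<in> boundary E U" using x that by blast
        then show ?thesis by (simp add: funpow_swap1)
      qed
      ultimately show "x \<in> ?R" by (auto simp: boundary_def)
    next
      fix x assume x: "x \<in> ?R"
      have "(f ^^ k) x \<in> boundary E U" if "k \<le> Suc n" for k
        using x that by (cases k) (auto simp: funpow_swap1)
      then show "x \<in> ?L" by blast
    qed
    then show ?case using boundary_borel f_preimage_borel[OF Suc] by auto
  qed
  note fin = this
  have "(\<Inter>n. {x. \<forall>k\<le>n. (f ^^ k) x \<in> boundary E U}) \<in> sets borel"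
    by (rule sets.countable_INT, rule image_subsetI, rule fin) simp
  moreover have "surviving_boundary = (\<Inter>n. {x. \<forall>k\<le>n. (f ^^ k) x \<in> boundary E U})" unfolding surviving_boundary_def by auto
  ultimately show ?thesis by (simp only:)
qed

lemma iterate_preimage_borel: "A \<in> sets borel \<Longrightarrow> {x\<in>surviving_boundary. (f ^^ n) x \<in> A} \<in> sets borel"
proof (induction n)
  case 0
  have "{x\<in>surviving_boundary. (f ^^ 0) x \<in> A} = surviving_boundary \<inter> A" by auto
  then show ?case using surviving_boundary_borel 0 by simp
next
  case (Suc n)
  have "{x\<in>surviving_boundary. (f ^^ Suc n) x \<in> A} = surviving_boundary \<inter> {x\<in>- E. f x \<in> {x\<in>surviving_boundary. (f ^^ n) x \<in> A}}"
    using surviving_boundary_subset f_surviving_boundary by (auto simp: funpow_swap1)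
  then show ?case using surviving_boundary_borel f_preimage_borel[OF Suc.IH[OF Suc.prems]] by simp
qed

lemma space_boundary_space: "space M\<^sub>\<omega> = surviving_boundary"
  using surviving_boundary_subset by (auto simp: boundary_space_def harmonic_measure_def space_restrict_space surviving_boundary_def)

lemma sets_boundary_space: "A \<subseteq> surviving_boundary \<Longrightarrow> A \<in> sets borel \<Longrightarrow> A \<in> sets M\<^sub>\<omega>"
proof -
  assume A: "A \<subseteq> surviving_boundary" "A \<in> sets borel"
  have "A \<inter> boundary E U = A" "A \<inter> surviving_boundary = A" using A surviving_boundary_subset by auto
  then show ?thesis using A(2) unfolding boundary_space_def harmonic_measure_def sets_restrict_space surviving_boundary_def[symmetric]
    by (auto simp: image_iff)
qed

lemma emeasure_boundary_space:
  assumes "A \<in> sets M\<^sub>\<omega>"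
  shows "emeasure M\<^sub>\<omega> A = emeasure circ (radial_extension \<phi> -` A \<inter> sphere 0 1)" "A \<in> sets borel" "A \<subseteq> surviving_boundary"
proof -
  let ?D = "distr circ borel (radial_extension \<phi>)"
  have b: "boundary E U \<inter> space ?D \<in> sets ?D" using boundary_borel by simp
  have b2: "surviving_boundary \<inter> space (harmonic_measure E U \<phi>) \<in> sets (harmonic_measure E U \<phi>)"
    using surviving_boundary_borel surviving_boundary_subset boundary_borel unfolding harmonic_measure_def
    by (subst sets_restrict_space_iff) (auto simp: space_restrict_space)
  have sub: "A \<subseteq> surviving_boundary" using sets.sets_into_space[OF assms] by (simp add: space_boundary_space)
  then show "A \<subseteq> surviving_boundary" .
  have A1: "A \<in> sets (harmonic_measure E U \<phi>)"
    using assms b2 unfolding boundary_space_def surviving_boundary_def[symmetric] by (subst (asm) sets_restrict_space_iff) auto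
  then show A2: "A \<in> sets borel"
    using b unfolding harmonic_measure_def by (subst (asm) sets_restrict_space_iff) auto
  have "emeasure M\<^sub>\<omega> A = emeasure (harmonic_measure E U \<phi>) A"
    unfolding boundary_space_def surviving_boundary_def[symmetric] by (rule emeasure_restrict_space[OF b2 sub])
  also have "\<dots> = emeasure ?D A"
    unfolding harmonic_measure_def using sub surviving_boundary_subset by (intro emeasure_restrict_space[OF b]) auto
  also have "\<dots> = emeasure circ (radial_extension \<phi> -` A \<inter> space circ)"
    by (rule emeasure_distr[OF measurable_radial_extension[OF \<phi>_cont] A2])
  finally show "emeasure M\<^sub>\<omega> A = emeasure circ (radial_extension \<phi> -` A \<inter> sphere 0 1)" by simp
qed

lemma good_0: assumes "good \<zeta>"
  shows "radial_lim \<phi> \<zeta> (bval \<zeta>)" "bval \<zeta> \<in> boundary E U" "bval \<zeta> \<notin> triple_points" "radial_extension \<phi> \<zeta> = bval \<zeta>"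
proof -
  show "radial_lim \<phi> \<zeta> (bval \<zeta>)" "bval \<zeta> \<in> boundary E U" "bval \<zeta> \<notin> triple_points"
    using assms unfolding good_def Let_def by (metis funpow_0)+
  then show "radial_extension \<phi> \<zeta> = bval \<zeta>"
    unfolding radial_lim_def radial_extension_def by (intro tendsto_Lim) auto
qed

lemma good_surviving_boundary: "good \<zeta> \<Longrightarrow> bval \<zeta> \<in> surviving_boundary"
  unfolding surviving_boundary_def by (auto simp: good_conjugacy good_0 good_iterate)

text \<open>Harmonic measure is the image of arc length under the radial extension, which agrees with \<open>bval\<close> at good
  points.\<close>

lemma AE_pull_back:
  assumes "AE x in M\<^sub>\<omega>. P x"
  shows "AE \<zeta> in circ. P (bval \<zeta>)"
proof -
  obtain N where N: "N \<in> null_sets M\<^sub>\<omega>" "{x\<in>surviving_boundary. \<not> P x} \<subseteq> N"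
    using assms by (auto simp: eventually_ae_filter space_boundary_space)
  then have Ns: "N \<in> sets M\<^sub>\<omega>" "emeasure M\<^sub>\<omega> N = 0" by auto
  have "emeasure circ (radial_extension \<phi> -` N \<inter> sphere 0 1) = 0"
    using emeasure_boundary_space(1)[OF Ns(1)] Ns(2) by simp
  moreover have "radial_extension \<phi> -` N \<inter> space circ \<in> sets circ"
    by (rule measurable_sets[OF measurable_radial_extension[OF \<phi>_cont] emeasure_boundary_space(2)[OF Ns(1)]])
  ultimately have "radial_extension \<phi> -` N \<inter> sphere 0 1 \<in> null_sets circ" by auto
  then have "AE \<zeta> in circ. \<zeta> \<notin> radial_extension \<phi> -` N \<inter> sphere 0 1" by (rule AE_not_in)
  then show ?thesis using AE_good AE_space
  proof eventually_elim
    case (elim \<zeta>)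
    then show ?case using N(2) good_surviving_boundary[OF elim(2)] good_0(4)[OF elim(2)] by auto
  qed
qed

text \<open>Inner regularity, applied inside a set of fast points of \<open>B\<close>, on which \<open>bval\<close> is continuous. Continuity
  matters because it makes the image under \<open>bval\<close> compact, hence Borel.\<close>

lemma exists_compact_subset:
  assumes A: "A \<in> sets circ" "\<not> (AE \<zeta> in circ. \<zeta> \<notin> A)" and Q: "AE \<zeta> in circ. Q \<zeta>"
  shows "\<exists>K. compact K \<and> K \<subseteq> A \<and> (\<forall>\<zeta>\<in>K. Q \<zeta>) \<and> continuous_on K bval \<and> 0 < emeasure circ K"
proof -
  obtain P where P: "\<And>k. P k holomorphic_on UNIV" "\<And>z. norm z < 1 \<Longrightarrow> (\<lambda>k. P k z) \<longlonglongrightarrow> B z"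
    "AE \<zeta> in circ. \<exists>m. \<zeta> \<in> fast_points P m"
    using bounded_fast_approximation[OF B_hol B_bound] by blast
  obtain N where N: "N \<in> null_sets circ" "{\<zeta>\<in>sphere 0 1. \<not> Q \<zeta>} \<subseteq> N"
    using Q by (auto simp: eventually_ae_filter)
  have "\<exists>m. \<not> (AE \<zeta> in circ. \<zeta> \<notin> A \<inter> fast_points P m - N)"
  proof (rule ccontr)
    assume "\<not> ?thesis"
    then have "\<forall>m. AE \<zeta> in circ. \<zeta> \<notin> A \<inter> fast_points P m - N" by blast
    then have "AE \<zeta> in circ. \<forall>m. \<zeta> \<notin> A \<inter> fast_points P m - N" by (rule AE_all_countable[THEN iffD2])
    moreover have "AE \<zeta> in circ. \<zeta> \<notin> N" using N(1) by (rule AE_not_in)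
    ultimately have "AE \<zeta> in circ. \<zeta> \<notin> A" using P(3) by eventually_elim auto
    then show False using A(2) by blast
  qed
  then obtain m where m: "\<not> (AE \<zeta> in circ. \<zeta> \<notin> A \<inter> fast_points P m - N)" by blast
  let ?A = "A \<inter> fast_points P m - N"
  have fs: "fast_points P m \<inter> sphere 0 1 \<in> sets circ"
    by (intro sets_circle_Int borel_closed fast_points_closed P)
  moreover have "fast_points P m \<inter> sphere 0 1 = fast_points P m" by (auto simp: fast_points_def)
  ultimately have As: "?A \<in> sets circ" using A(1) N(1) by auto
  have pos: "emeasure circ ?A \<noteq> 0"
  proof
    assume "emeasure circ ?A = 0"
    then have "?A \<in> null_sets circ" using As by (rule null_setsI)
    then show False using m AE_not_in by blast
  qed
  obtain A' where A': "A' \<in> sets borel" "?A = A' \<inter> sphere 0 1"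
    using As by (auto simp: sets_circle sets_restrict_space)
  then have Ab: "?A \<in> sets borel" by auto
  let ?lam = "distr circ borel (\<lambda>x. x)"
  have em: "emeasure ?lam X = emeasure circ (X \<inter> sphere 0 1)" if "X \<in> sets borel" for X
    using that by (subst emeasure_distr) (auto simp: vimage_def)
  have "emeasure ?lam (space ?lam) \<noteq> \<infinity>" by (subst em) (auto simp: circle.emeasure_eq_measure)
  then have "emeasure ?lam ?A = (SUP K \<in> {K. K \<subseteq> ?A \<and> compact K}. emeasure ?lam K)"
    using Ab by (intro inner_regular) auto
  moreover have "?A \<inter> sphere 0 1 = ?A" using A'(2) by auto
  ultimately have "0 < (SUP K \<in> {K. K \<subseteq> ?A \<and> compact K}. emeasure ?lam K)"
    using pos em[OF Ab] by (simp add: zero_less_iff_neq_zero)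
  then obtain K where K: "K \<subseteq> ?A" "compact K" "0 < emeasure ?lam K" by (auto simp: less_SUP_iff)
  have KS: "K \<inter> sphere 0 1 = K" using K(1) A'(2) by auto
  have "continuous_on K bval"
    unfolding bval_def[abs_def]
    by (rule continuous_on_compose2[OF R_cont continuous_on_subset[OF fast_points_continuous[OF P(1,2), of m]]]) (use K in auto)
  moreover have "0 < emeasure circ K" using K(2,3) em[of K] KS by (simp add: borel_compact)
  moreover have "Q \<zeta>" if "\<zeta> \<in> K" for \<zeta>
  proof (rule ccontr)
    assume "\<not> Q \<zeta>"
    moreover have "\<zeta> \<in> sphere 0 1" "\<zeta> \<notin> N" using that K(1) KS by blast+
    ultimately show False using N(2) by blast
  qed
  ultimately show ?thesis using K(1,2) by blast
qed

lemma emeasure_bval_image_pos: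
  assumes K: "compact K" "K \<subseteq> sphere 0 1" "\<And>\<zeta>. \<zeta> \<in> K \<Longrightarrow> good \<zeta>" "continuous_on K bval" "0 < emeasure circ K"
    and C: "C \<in> sets M\<^sub>\<omega>" "bval ` K \<subseteq> C"
  shows "0 < emeasure M\<^sub>\<omega> C"
proof -
  have "K \<subseteq> radial_extension \<phi> -` C \<inter> sphere 0 1"
    using K(2,3) C(2) good_0(4) by auto
  then have "emeasure circ K \<le> emeasure circ (radial_extension \<phi> -` C \<inter> sphere 0 1)"
    using measurable_sets[OF measurable_radial_extension[OF \<phi>_cont] emeasure_boundary_space(2)[OF C(1)]]
    by (intro emeasure_mono) auto
  then show ?thesis using emeasure_boundary_space(1)[OF C(1)] K(5) by simp
qed

lemma point_of_positive_measure:
  assumes "0 < emeasure circ K" "AE \<zeta> in circ. P \<zeta>" "K \<subseteq> sphere 0 1"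
  shows "\<exists>\<zeta>\<in>K. P \<zeta>"
proof (rule ccontr)
  assume none: "\<not> (\<exists>\<zeta>\<in>K. P \<zeta>)"
  obtain N where N: "N \<in> null_sets circ" "{\<zeta>\<in>sphere 0 1. \<not> P \<zeta>} \<subseteq> N"
    using assms(2) by (auto simp: eventually_ae_filter)
  have "K \<subseteq> {\<zeta>\<in>sphere 0 1. \<not> P \<zeta>}" using assms(3) none by blast
  then have "K \<subseteq> N" using N(2) by (rule subset_trans)
  then have "emeasure circ K \<le> emeasure circ N" using N(1) by (intro emeasure_mono) auto
  then show False using N(1) assms(1) by auto
qed

lemma continuous_iterate: "continuous_on surviving_boundary (f ^^ n)"
proof (induction n)
  case (Suc n)
  have "continuous_on surviving_boundary (\<lambda>x. (f ^^ n) (f x))"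
    by (rule continuous_on_compose2[OF Suc continuous_on_subset[OF cont_f surviving_boundary_subset(2)]]) (use f_surviving_boundary in auto)
  then show ?case by (simp add: funpow_Suc_right o_def del: funpow.simps)
qed simp

text \<open>Let \<open>\<tau>\<close> be bounded by \<open>m\<close> on a compact set \<open>K\<close> of directions. If an orbit starting in \<open>bval ` K\<close> returns
  there at the times \<open>n\<^sub>1\<close> and \<open>n\<^sub>2\<close>, with \<open>n\<^sub>1\<close> and \<open>n\<^sub>2 - n\<^sub>1\<close> larger than \<open>2 * m\<close>, then the point
  reached at time \<open>n\<^sub>2\<close> is a radial limit in three directions: the direction of start moved on \<open>n\<^sub>2\<close> times, the
  direction in \<open>K\<close> at the first return moved on \<open>n\<^sub>2 - n\<^sub>1\<close> times, and the direction in \<open>K\<close> at the second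
  return. The values of \<open>\<tau>\<close> tell these directions apart.\<close>

lemma not_recurrent:
  fixes \<tau> :: "complex \<Rightarrow> real" and s :: real
  assumes \<tau>: "\<tau> \<in> borel_measurable circ" and s: "\<bar>s\<bar> = 1"
    and shift: "AE \<zeta> in circ. \<tau> (bmap g \<zeta>) = \<tau> \<zeta> + s"
  shows "\<not> recurrent M\<^sub>\<omega> f"
proof
  assume rec: "recurrent M\<^sub>\<omega> f"
  have shiftn: "AE \<zeta> in circ. \<forall>n. \<tau> ((bmap g ^^ n) \<zeta>) = \<tau> \<zeta> + real n * s"
  proof -
    have "AE \<zeta> in circ. \<forall>n. \<tau> (bmap g ((bmap g ^^ n) \<zeta>)) = \<tau> ((bmap g ^^ n) \<zeta>) + s"
      by (rule bmap_iterate_AE[OF g_hol g_ball g_inner shift])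
    then show ?thesis
    proof eventually_elim
      case (elim \<zeta>)
      have "\<tau> ((bmap g ^^ n) \<zeta>) = \<tau> \<zeta> + real n * s" for n
        by (induction n) (use elim in \<open>auto simp: algebra_simps\<close>)
      then show ?case by blast
    qed
  qed
  have "\<exists>m::nat. \<not> (AE \<zeta> in circ. \<zeta> \<notin> {\<zeta>\<in>space circ. \<bar>\<tau> \<zeta>\<bar> \<le> real m})"
  proof (rule ccontr)
    assume "\<not> ?thesis"
    then have "\<forall>m::nat. AE \<zeta> in circ. \<zeta> \<notin> {\<zeta>\<in>space circ. \<bar>\<tau> \<zeta>\<bar> \<le> real m}" by blast
    then have "AE \<zeta> in circ. \<forall>m::nat. \<zeta> \<notin> {\<zeta>\<in>space circ. \<bar>\<tau> \<zeta>\<bar> \<le> real m}"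
      by (rule AE_all_countable[THEN iffD2])
    then have "AE \<zeta> in circ. False" using AE_space
    proof eventually_elim
      case (elim \<zeta>)
      obtain m :: nat where "\<bar>\<tau> \<zeta>\<bar> \<le> real m" using real_arch_simple by blast
      then show ?case using elim by auto
    qed
    then show False using point_of_positive_measure[of "sphere 0 1" "\<lambda>_. False"] emeasure_circle_UNIV by auto
  qed
  then obtain m :: nat where m: "\<not> (AE \<zeta> in circ. \<zeta> \<notin> {\<zeta>\<in>space circ. \<bar>\<tau> \<zeta>\<bar> \<le> real m})" by blast
  have Am: "{\<zeta>\<in>space circ. \<bar>\<tau> \<zeta>\<bar> \<le> real m} \<in> sets circ" using \<tau> by measurable
  have Q: "AE \<zeta> in circ. good \<zeta> \<and> (\<forall>n. \<tau> ((bmap g ^^ n) \<zeta>) = \<tau> \<zeta> + real n * s)"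
    using AE_good shiftn by eventually_elim blast
  obtain K where K: "compact K" "K \<subseteq> {\<zeta>\<in>space circ. \<bar>\<tau> \<zeta>\<bar> \<le> real m}"
    "\<forall>\<zeta>\<in>K. good \<zeta> \<and> (\<forall>n. \<tau> ((bmap g ^^ n) \<zeta>) = \<tau> \<zeta> + real n * s)" "continuous_on K bval" "0 < emeasure circ K"
    using exists_compact_subset[OF Am m Q] by blast
  have KS: "K \<subseteq> sphere 0 1" using K(2) by auto
  define C where "C = bval ` K"
  have "compact C" unfolding C_def by (rule compact_continuous_image[OF K(4,1)])
  then have Cs: "C \<in> sets M\<^sub>\<omega>"
    using K(3) good_surviving_boundary by (intro sets_boundary_space) (auto simp: C_def borel_compact)
  then have "AE x in M\<^sub>\<omega>. x \<in> C \<longrightarrow> (\<exists>n :: nat \<Rightarrow> nat. filterlim n at_top sequentially \<and> (\<forall>k. (f ^^ n k) x \<in> C))"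
    using rec unfolding recurrent_def by blast
  from AE_pull_back[OF this] obtain \<zeta> where \<zeta>: "\<zeta> \<in> K"
    "bval \<zeta> \<in> C \<longrightarrow> (\<exists>n :: nat \<Rightarrow> nat. filterlim n at_top sequentially \<and> (\<forall>k. (f ^^ n k) (bval \<zeta>) \<in> C))"
    using point_of_positive_measure[OF K(5) _ KS] by blast
  then obtain n :: "nat \<Rightarrow> nat" where n: "filterlim n at_top sequentially" "\<And>k. (f ^^ n k) (bval \<zeta>) \<in> C"
    by (auto simp: C_def)
  have big: "\<exists>k. n k \<ge> N" for N
    using n(1) by (auto simp: filterlim_at_top eventually_sequentially)
  obtain k1 where k1: "n k1 \<ge> 2 * m + 1" using big by blast
  obtain k2 where k2: "n k2 \<ge> n k1 + (2 * m + 1)" using big by blast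
  obtain \<zeta>1 \<zeta>2 where z: "\<zeta>1 \<in> K" "(f ^^ n k1) (bval \<zeta>) = bval \<zeta>1" "\<zeta>2 \<in> K" "(f ^^ n k2) (bval \<zeta>) = bval \<zeta>2"
    using n(2)[of k1] n(2)[of k2] by (auto simp: C_def)
  let ?\<eta>0 = "(bmap g ^^ n k2) \<zeta>" and ?\<eta>1 = "(bmap g ^^ (n k2 - n k1)) \<zeta>1"
  note Kg = K(3)[rule_format]
  have \<tau>K: "\<bar>\<tau> \<zeta>\<bar> \<le> real m" "\<bar>\<tau> \<zeta>1\<bar> \<le> real m" "\<bar>\<tau> \<zeta>2\<bar> \<le> real m" using K(2) \<zeta>(1) z by auto
  have tv: "\<tau> ?\<eta>0 = \<tau> \<zeta> + real (n k2) * s" "\<tau> ?\<eta>1 = \<tau> \<zeta>1 + real (n k2 - n k1) * s"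
    using Kg[OF \<zeta>(1)] Kg[OF z(1)] by blast+
  have e1: "bval ?\<eta>0 = bval \<zeta>2" using good_conjugacy[of \<zeta> "n k2"] Kg[OF \<zeta>(1)] z(4) by simp
  have e2: "bval ?\<eta>1 = bval \<zeta>2"
  proof -
    have "bval ?\<eta>1 = (f ^^ (n k2 - n k1)) ((f ^^ n k1) (bval \<zeta>))"
      using good_conjugacy[of \<zeta>1] Kg[OF z(1)] z(2) by simp
    also have "\<dots> = (f ^^ (n k2 - n k1 + n k1)) (bval \<zeta>)" by (simp only: funpow_add o_apply)
    also have "\<dots> = bval \<zeta>2" using k2 z(4) by simp
    finally show ?thesis .
  qed
  have "?\<eta>0 = ?\<eta>1 \<or> ?\<eta>0 = \<zeta>2 \<or> ?\<eta>1 = \<zeta>2"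
    by (rule good_fibre_le_2[of \<zeta>2]) (use e1 e2 Kg \<zeta>(1) z KS good_iterate norm_bmap_iterate in auto)
  moreover have far: "\<bar>real a * s\<bar> \<ge> 2 * real m + 1" if "a \<ge> 2 * m + 1" for a
  proof -
    have "\<bar>real a * s\<bar> = real a" using s by (simp add: abs_mult)
    then show ?thesis using that by linarith
  qed
  moreover have "real (n k2) * s - real (n k2 - n k1) * s = real (n k1) * s"
    using k2 by (simp add: of_nat_diff algebra_simps)
  moreover have "n k2 \<ge> 2 * m + 1" "n k2 - n k1 \<ge> 2 * m + 1" using k2 by auto
  ultimately show False using \<tau>K tv far[OF k1] far[of "n k2"] far[of "n k2 - n k1"]
    by (smt (verit))
qed

text \<open>For a disc of values of \<open>v\<close>, the grand orbit of the boundary points reached along directions with these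
  values is an invariant set of positive measure. If \<open>f\<close> were ergodic, almost every boundary point would lie in the
  grand orbits belonging to three disjoint discs. Far enough along its orbit this gives a point that is a radial limit in
  three directions, told apart by the invariant function \<open>v\<close>.\<close>

lemma not_ergodic:
  fixes v :: "complex \<Rightarrow> complex"
  assumes v: "v \<in> borel_measurable circ" and inv: "AE \<zeta> in circ. v (bmap g \<zeta>) = v \<zeta>"
    and nS: "\<And>S. finite S \<Longrightarrow> \<not> (AE \<zeta> in circ. v \<zeta> \<in> S)"
  shows "\<not> ergodic M\<^sub>\<omega> f"
proof
  assume erg: "ergodic M\<^sub>\<omega> f"
  have invn: "AE \<zeta> in circ. \<forall>n. v ((bmap g ^^ n) \<zeta>) = v \<zeta>"
  proof -
    have "AE \<zeta> in circ. \<forall>n. v (bmap g ((bmap g ^^ n) \<zeta>)) = v ((bmap g ^^ n) \<zeta>)"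
      by (rule bmap_iterate_AE[OF g_hol g_ball g_inner inv])
    then show ?thesis
    proof eventually_elim
      case (elim \<zeta>)
      have "v ((bmap g ^^ n) \<zeta>) = v \<zeta>" for n by (induction n) (use elim in auto)
      then show ?case by blast
    qed
  qed
  have Q: "AE \<zeta> in circ. good \<zeta> \<and> (\<forall>n. v ((bmap g ^^ n) \<zeta>) = v \<zeta>)"
    using AE_good invn by eventually_elim blast
  have grand_orbit: "AE \<zeta> in circ. \<exists>n m \<zeta>'. norm \<zeta>' = 1 \<and> good \<zeta>' \<and> (\<forall>n. v ((bmap g ^^ n) \<zeta>') = v \<zeta>') \<and> v \<zeta>' \<in> ball c \<epsilon>
      \<and> (f ^^ n) (bval \<zeta>) = (f ^^ m) (bval \<zeta>')"
    if c: "\<not> (AE \<zeta> in circ. v \<zeta> \<notin> ball c \<epsilon>)" for c \<epsilon>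
  proof -
    let ?A = "{\<zeta>\<in>space circ. v \<zeta> \<in> ball c \<epsilon>}"
    have "v -` ball c \<epsilon> \<inter> space circ \<in> sets circ" by (rule measurable_sets[OF v]) simp
    moreover have "v -` ball c \<epsilon> \<inter> space circ = ?A" by auto
    ultimately have A: "?A \<in> sets circ" by simp
    have A0: "\<not> (AE \<zeta> in circ. \<zeta> \<notin> ?A)"
    proof
      assume "AE \<zeta> in circ. \<zeta> \<notin> ?A"
      then have "AE \<zeta> in circ. v \<zeta> \<notin> ball c \<epsilon>" using AE_space by eventually_elim auto
      then show False using c by blast
    qed
    obtain K where K: "compact K" "K \<subseteq> ?A" "\<forall>\<zeta>\<in>K. good \<zeta> \<and> (\<forall>n. v ((bmap g ^^ n) \<zeta>) = v \<zeta>)"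
      "continuous_on K bval" "0 < emeasure circ K"
      using exists_compact_subset[OF A A0 Q] by blast
    define C where "C = bval ` K"
    have C: "compact C" "C \<subseteq> surviving_boundary"
      using compact_continuous_image[OF K(4,1)] K(3) good_surviving_boundary by (auto simp: C_def)
    \<comment> \<open>The grand orbit of \<open>C\<close>; allowing iterates on both sides makes it completely invariant.\<close>
    define Y where "Y = {x\<in>surviving_boundary. \<exists>n m. (f ^^ n) x \<in> (f ^^ m) ` C}"
    have "compact ((f ^^ m) ` C)" for m
      by (intro compact_continuous_image C continuous_on_subset[OF continuous_iterate])
    then have "(\<Union>n. \<Union>m. {x\<in>surviving_boundary. (f ^^ n) x \<in> (f ^^ m) ` C}) \<in> sets borel"
      by (intro sets.countable_UN image_subsetI iterate_preimage_borel borel_compact)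
    moreover have "Y = (\<Union>n. \<Union>m. {x\<in>surviving_boundary. (f ^^ n) x \<in> (f ^^ m) ` C})" by (auto simp: Y_def)
    ultimately have Y: "Y \<in> sets M\<^sub>\<omega>" by (intro sets_boundary_space) (auto simp: Y_def)
    have "f -` Y \<inter> space M\<^sub>\<omega> = Y"
    proof (intro set_eqI iffI)
      fix x assume "x \<in> f -` Y \<inter> space M\<^sub>\<omega>"
      then obtain n m where "x \<in> surviving_boundary" "(f ^^ n) (f x) \<in> (f ^^ m) ` C" by (auto simp: Y_def space_boundary_space)
      then have "x \<in> surviving_boundary" "(f ^^ Suc n) x \<in> (f ^^ m) ` C" by (auto simp: funpow_swap1)
      then show "x \<in> Y" unfolding Y_def by blast
    next
      fix x assume "x \<in> Y"
      then obtain n m y where x: "x \<in> surviving_boundary" "y \<in> C" "(f ^^ n) x = (f ^^ m) y" by (auto simp: Y_def)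
      have "(f ^^ n) (f x) = (f ^^ Suc m) y" using arg_cong[OF x(3), of f] by (simp add: funpow_swap1)
      then have "(f ^^ n) (f x) \<in> (f ^^ Suc m) ` C" using x(2) by (metis imageI)
      then have "f x \<in> Y" using f_surviving_boundary[OF x(1)] unfolding Y_def by blast
      then show "x \<in> f -` Y \<inter> space M\<^sub>\<omega>" using x(1) by (simp add: space_boundary_space)
    qed
    then have "emeasure M\<^sub>\<omega> Y = 0 \<or> emeasure M\<^sub>\<omega> (space M\<^sub>\<omega> - Y) = 0"
      using erg Y unfolding ergodic_def by blast
    moreover have "0 < emeasure M\<^sub>\<omega> Y"
    proof (rule emeasure_bval_image_pos[OF K(1) _ _ K(4,5) Y])
      show "bval ` K \<subseteq> Y"
      proof
        fix x assume "x \<in> bval ` K"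
        then have "x \<in> surviving_boundary" "(f ^^ 0) x \<in> (f ^^ 0) ` C" using C(2) by (auto simp: C_def)
        then show "x \<in> Y" unfolding Y_def by blast
      qed
    qed (use K in auto)
    ultimately have "emeasure M\<^sub>\<omega> (space M\<^sub>\<omega> - Y) = 0" by auto
    then have "space M\<^sub>\<omega> - Y \<in> null_sets M\<^sub>\<omega>" using Y by auto
    then have "AE x in M\<^sub>\<omega>. x \<in> Y" by (rule AE_I') auto
    from AE_pull_back[OF this] show ?thesis
    proof eventually_elim
      case (elim \<zeta>)
      then obtain n m \<zeta>' where "\<zeta>' \<in> K" "(f ^^ n) (bval \<zeta>) = (f ^^ m) (bval \<zeta>')" by (auto simp: Y_def C_def)
      then show ?case using K(2,3) by (intro exI[of _ n] exI[of _ m] exI[of _ \<zeta>']) auto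
    qed
  qed
  have "infinite {c. \<forall>\<epsilon>>0. \<not> (AE \<zeta> in circ. v \<zeta> \<notin> ball c \<epsilon>)}"
    by (rule infinite_essential_values[OF v nS])
  then obtain T where T: "card T = 3" "T \<subseteq> {c. \<forall>\<epsilon>>0. \<not> (AE \<zeta> in circ. v \<zeta> \<notin> ball c \<epsilon>)}"
    using infinite_arbitrarily_large by blast
  obtain c1 c2 c3 where T3: "T = {c1, c2, c3}" and c: "c1 \<noteq> c2" "c1 \<noteq> c3" "c2 \<noteq> c3"
    using T(1) unfolding card_3_iff by blast
  have cp: "\<not> (AE \<zeta> in circ. v \<zeta> \<notin> ball c \<epsilon>)" if "c \<in> {c1, c2, c3}" "\<epsilon> > 0" for c \<epsilon>
    using T(2) that unfolding T3 by blast
  define \<epsilon> where "\<epsilon> = min (dist c1 c2) (min (dist c1 c3) (dist c2 c3)) / 2"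
  have \<epsilon>: "\<epsilon> > 0" "2 * \<epsilon> \<le> dist c1 c2" "2 * \<epsilon> \<le> dist c1 c3" "2 * \<epsilon> \<le> dist c2 c3"
    using c by (auto simp: \<epsilon>_def)
  have disj: "x \<noteq> y" if "x \<in> ball c \<epsilon>" "y \<in> ball d \<epsilon>" "2 * \<epsilon> \<le> dist c d" for x y c d :: complex
    using that dist_triangle[of c d x] by (auto simp: dist_commute)
  let ?H = "\<lambda>c \<zeta>. \<exists>n m \<zeta>'. norm \<zeta>' = 1 \<and> good \<zeta>' \<and> (\<forall>n. v ((bmap g ^^ n) \<zeta>') = v \<zeta>') \<and> v \<zeta>' \<in> ball c \<epsilon>
      \<and> (f ^^ n) (bval \<zeta>) = (f ^^ m) (bval \<zeta>')"
  have H: "AE \<zeta> in circ. ?H c \<zeta>" if "c \<in> {c1, c2, c3}" for c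
    by (rule grand_orbit) (rule cp[OF that \<epsilon>(1)])
  have all: "AE \<zeta> in circ. good \<zeta> \<and> ?H c1 \<zeta> \<and> ?H c2 \<zeta> \<and> ?H c3 \<zeta>"
    using AE_good H[of c1] H[of c2] H[of c3] by simp
  have "\<exists>\<zeta>\<in>sphere 0 1. good \<zeta> \<and> ?H c1 \<zeta> \<and> ?H c2 \<zeta> \<and> ?H c3 \<zeta>"
    by (rule point_of_positive_measure[OF _ all]) (simp_all add: emeasure_circle_UNIV)
  then obtain \<zeta> where \<zeta>: "good \<zeta>" "?H c1 \<zeta>" "?H c2 \<zeta>" "?H c3 \<zeta>"
    by (elim bexE conjE)
  obtain n1 m1 \<zeta>1 where 1: "norm \<zeta>1 = 1" "good \<zeta>1" "\<And>n. v ((bmap g ^^ n) \<zeta>1) = v \<zeta>1" "v \<zeta>1 \<in> ball c1 \<epsilon>" "(f ^^ n1) (bval \<zeta>) = (f ^^ m1) (bval \<zeta>1)"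
    using \<zeta>(2) by blast
  obtain n2 m2 \<zeta>2 where 2: "norm \<zeta>2 = 1" "good \<zeta>2" "\<And>n. v ((bmap g ^^ n) \<zeta>2) = v \<zeta>2" "v \<zeta>2 \<in> ball c2 \<epsilon>" "(f ^^ n2) (bval \<zeta>) = (f ^^ m2) (bval \<zeta>2)"
    using \<zeta>(3) by blast
  obtain n3 m3 \<zeta>3 where 3: "norm \<zeta>3 = 1" "good \<zeta>3" "\<And>n. v ((bmap g ^^ n) \<zeta>3) = v \<zeta>3" "v \<zeta>3 \<in> ball c3 \<epsilon>" "(f ^^ n3) (bval \<zeta>) = (f ^^ m3) (bval \<zeta>3)"
    using \<zeta>(4) by blast
  have push: "bval ((bmap g ^^ (l + m)) \<zeta>') = bval ((bmap g ^^ (l + n)) \<zeta>)"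
    if "good \<zeta>'" "(f ^^ n) (bval \<zeta>) = (f ^^ m) (bval \<zeta>')" for l m n \<zeta>'
  proof -
    have "bval ((bmap g ^^ (l + m)) \<zeta>') = (f ^^ l) ((f ^^ m) (bval \<zeta>'))"
      using good_conjugacy[OF that(1), of "l + m"] by (simp add: funpow_add)
    also have "\<dots> = (f ^^ (l + n)) (bval \<zeta>)" by (simp add: that(2)[symmetric] funpow_add)
    finally show ?thesis using good_conjugacy[OF \<zeta>(1)] by simp
  qed
  let ?N = "n1 + n2 + n3"
  have "(bmap g ^^ (n2 + n3 + m1)) \<zeta>1 = (bmap g ^^ (n1 + n3 + m2)) \<zeta>2 \<or>
      (bmap g ^^ (n2 + n3 + m1)) \<zeta>1 = (bmap g ^^ (n1 + n2 + m3)) \<zeta>3 \<or>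
      (bmap g ^^ (n1 + n3 + m2)) \<zeta>2 = (bmap g ^^ (n1 + n2 + m3)) \<zeta>3"
  proof (rule good_fibre_le_2[of "(bmap g ^^ ?N) \<zeta>"])
    show "bval ((bmap g ^^ (n2 + n3 + m1)) \<zeta>1) = bval ((bmap g ^^ ?N) \<zeta>)"
      using push[OF 1(2,5), of "n2 + n3"] by (simp add: ac_simps)
    show "bval ((bmap g ^^ (n1 + n3 + m2)) \<zeta>2) = bval ((bmap g ^^ ?N) \<zeta>)"
      using push[OF 2(2,5), of "n1 + n3"] by (simp add: ac_simps)
    show "bval ((bmap g ^^ (n1 + n2 + m3)) \<zeta>3) = bval ((bmap g ^^ ?N) \<zeta>)"
      using push[OF 3(2,5), of "n1 + n2"] by (simp add: ac_simps)
  qed (use \<zeta>(1) 1 2 3 good_iterate norm_bmap_iterate in auto)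
  then have "v \<zeta>1 = v \<zeta>2 \<or> v \<zeta>1 = v \<zeta>3 \<or> v \<zeta>2 = v \<zeta>3" using 1(3) 2(3) 3(3) by metis
  then show False using disj[OF 1(4) 2(4) \<epsilon>(2)] disj[OF 1(4) 3(4) \<epsilon>(3)] disj[OF 2(4) 3(4) \<epsilon>(4)] by blast
qed

end

section \<open>The translation model\<close>

context baker_map_bounded
begin

text \<open>Two bounded functions give access to boundary values of \<open>\<psi>\<close>. The function \<open>u = exp (2 \<pi> \<i> \<psi>)\<close> is
  invariant under \<open>g\<close> and not constant. The function \<open>w = 1 / (\<psi> + \<i>)\<close> has no zeros, so \<open>1 / bdry w\<close> is finite
  almost everywhere, and it is translated by \<open>s\<close>.\<close>

lemma not_ergodic_not_recurrent_of_translation: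
  assumes \<psi>: "\<psi> holomorphic_on ball 0 1" and pos: "\<And>z. norm z < 1 \<Longrightarrow> 0 < Im (\<psi> z)"
    and eq: "\<And>z. norm z < 1 \<Longrightarrow> \<psi> (g z) = \<psi> z + of_real s" and s: "s = 1 \<or> s = -1"
  shows "\<not> ergodic M\<^sub>\<omega> f \<and> \<not> recurrent M\<^sub>\<omega> f"
proof
  define u where "u z = exp (2 * of_real pi * \<i> * \<psi> z)" for z
  have uh: "u holomorphic_on ball 0 1" unfolding u_def by (intro holomorphic_intros \<psi>)
  have ub: "norm (u z) \<le> 1" if "norm z < 1" for z
    using pos[OF that] by (simp add: u_def mult_nonneg_nonneg)
  have ug: "u (g z) = u z" if "norm z < 1" for z
  proof -
    have "exp (2 * of_real pi * \<i> * of_real s) = (1::complex)"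
      using s by (elim disjE) (auto simp: exp_eq_1 intro: exI[of _ "-1::int"])
    then show ?thesis by (simp add: u_def eq[OF that] distrib_left exp_add)
  qed
  have uF: "AE \<zeta> in circ. ((\<lambda>r. u (of_real r * \<zeta>)) \<longlongrightarrow> bdry u \<zeta>) (at_left 1)"
    by (rule Fatou_radial_limit[OF uh ub])
  have um: "bdry u \<in> borel_measurable circ"
    by (intro measurable_bdry holomorphic_on_imp_continuous_on uh)
  have ugF: "AE \<zeta> in circ. ((\<lambda>r. u (g (of_real r * \<zeta>))) \<longlongrightarrow> bdry u (bmap g \<zeta>)) (at_left 1)"
    by (rule bdry_compose_inner[OF g_hol g_ball g_inner uh ub])
  show "\<not> ergodic M\<^sub>\<omega> f"
  proof (rule not_ergodic[OF um])
    show "AE \<zeta> in circ. bdry u (bmap g \<zeta>) = bdry u \<zeta>"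
      using uF ugF AE_space
    proof eventually_elim
      case (elim \<zeta>)
      have "\<forall>\<^sub>F r in at_left 1. u (g (of_real r * \<zeta>)) = u (of_real r * \<zeta>)"
        using eventually_radius_in_ball[of \<zeta>] elim(3) by (auto elim!: eventually_mono simp: ug)
      then have "((\<lambda>r. u (of_real r * \<zeta>)) \<longlongrightarrow> bdry u (bmap g \<zeta>)) (at_left 1)"
        using elim(2) by (rule Lim_transform_eventually[rotated])
      then show ?case using elim(1) by (intro tendsto_unique[of "at_left (1::real)"]) auto
    qed
  next
    fix S :: "complex set" assume S: "finite S"
    show "\<not> (AE \<zeta> in circ. bdry u \<zeta> \<in> S)"
    proof
      assume AE: "AE \<zeta> in circ. bdry u \<zeta> \<in> S"
      \<comment> \<open>If the boundary values of \<open>u\<close> lay in \<open>S\<close>, then \<open>u\<close> would take values in \<open>S\<close> only and be constant.\<close>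
      define p where "p z = (\<Prod>c\<in>S. (u z - c))" for z
      have ph: "p holomorphic_on ball 0 1" unfolding p_def by (intro holomorphic_intros uh)
      have pb: "norm (p z) \<le> (\<Prod>c\<in>S. (1 + norm c))" if "norm z < 1" for z
        unfolding p_def prod_norm[symmetric]
        using ub[OF that] by (intro prod_mono) (auto intro: order_trans[OF norm_triangle_ineq4])
      have p0: "AE \<zeta> in circ. bdry p \<zeta> = 0"
        using AE uF
      proof eventually_elim
        case (elim \<zeta>)
        have "((\<lambda>r. p (of_real r * \<zeta>)) \<longlongrightarrow> (\<Prod>c\<in>S. (bdry u \<zeta> - c))) (at_left 1)"
          unfolding p_def by (intro tendsto_intros elim(2))
        then have "bdry p \<zeta> = (\<Prod>c\<in>S. (bdry u \<zeta> - c))" by (rule bdry_eqI)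
        then show ?case using elim(1) S by (simp add: prod_zero_iff)
      qed
      have "u z \<in> S" if "norm z < 1" for z
        using boundary_zero_imp_zero[OF ph pb p0 that] S by (auto simp: p_def prod_zero_iff)
      then have "finite (u ` ball 0 1)" using S by (auto intro: finite_subset[of _ S])
      moreover have "connected (u ` ball 0 1)"
        by (intro connected_continuous_image holomorphic_on_imp_continuous_on uh connected_ball)
      ultimately obtain c where c: "\<And>z. norm z < 1 \<Longrightarrow> u z = c"
        using connected_finite_iff_sing[of "u ` ball 0 1"] by (metis ball_eq_empty image_eqI image_is_empty mem_ball_0 not_one_le_zero singletonD)
      have d0: "(\<psi> has_field_derivative 0) (at z within ball 0 1)" if z: "z \<in> ball 0 1" for z
      proof -
        have d: "(\<psi> has_field_derivative deriv \<psi> z) (at z)" by (rule holomorphic_derivI[OF \<psi> open_ball z])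
        have "(u has_field_derivative exp (2 * of_real pi * \<i> * \<psi> z) * (2 * of_real pi * \<i> * deriv \<psi> z)) (at z)"
          unfolding u_def[abs_def] by (rule derivative_eq_intros d refl | simp)+
        moreover have "(u has_field_derivative 0) (at z)"
          using z c by (intro has_field_derivative_transform_within_open[OF DERIV_const[of c] open_ball z]) auto
        ultimately have "exp (2 * of_real pi * \<i> * \<psi> z) * (2 * of_real pi * \<i> * deriv \<psi> z) = 0"
          by (rule DERIV_unique)
        then have "deriv \<psi> z = 0" by simp
        then show ?thesis using d by (metis has_field_derivative_at_within)
      qed
      obtain k where k: "\<And>z. z \<in> ball 0 1 \<Longrightarrow> \<psi> z = k"
        using has_field_derivative_zero_constant[OF convex_ball d0] by blast
      have "\<psi> (g 0) = \<psi> 0 + of_real s" by (rule eq) simp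
      then show False using k[of 0] k[of "g 0"] g_ball[of 0] s by auto
    qed
  qed
  define w where "w z = 1 / (\<psi> z + \<i>)" for z
  have im: "1 \<le> Im (\<psi> z + \<i>)" if "norm z < 1" for z using pos[OF that] by simp
  have nz: "\<psi> z + \<i> \<noteq> 0" if "norm z < 1" for z using im[OF that] by (metis not_one_le_zero zero_complex.sel(2))
  have wh: "w holomorphic_on ball 0 1" unfolding w_def using nz by (intro holomorphic_intros \<psi>) auto
  have wb: "norm (w z) \<le> 1" if "norm z < 1" for z
  proof -
    have "1 \<le> norm (\<psi> z + \<i>)" using im[OF that] abs_Im_le_cmod[of "\<psi> z + \<i>"] by linarith
    then show ?thesis by (simp add: w_def norm_divide divide_le_eq)
  qed
  have w0: "w z \<noteq> 0" if "norm z < 1" for z using nz[OF that] by (simp add: w_def)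
  have wF: "AE \<zeta> in circ. ((\<lambda>r. w (of_real r * \<zeta>)) \<longlongrightarrow> bdry w \<zeta>) (at_left 1)"
    by (rule Fatou_radial_limit[OF wh wb])
  have wgF: "AE \<zeta> in circ. ((\<lambda>r. w (g (of_real r * \<zeta>))) \<longlongrightarrow> bdry w (bmap g \<zeta>)) (at_left 1)"
    by (rule bdry_compose_inner[OF g_hol g_ball g_inner wh wb])
  have wnz: "AE \<zeta> in circ. bdry w \<zeta> \<noteq> 0"
    by (rule zero_free_boundary_nonzero[OF wh wb w0])
  have wnz2: "AE \<zeta> in circ. bdry w (bmap g \<zeta>) \<noteq> 0"
    by (rule bmap_AE[OF g_hol g_ball g_inner wnz])
  have wm: "bdry w \<in> borel_measurable circ"
    by (intro measurable_bdry holomorphic_on_imp_continuous_on wh)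
  show "\<not> recurrent M\<^sub>\<omega> f"
  proof (rule not_recurrent[of "\<lambda>\<zeta>. Re (1 / bdry w \<zeta>)" s])
    show "(\<lambda>\<zeta>. Re (1 / bdry w \<zeta>)) \<in> borel_measurable circ" using wm by measurable
    show "\<bar>s\<bar> = 1" using s by auto
    show "AE \<zeta> in circ. Re (1 / bdry w (bmap g \<zeta>)) = Re (1 / bdry w \<zeta>) + s"
      using wF wgF wnz wnz2 AE_space
    proof eventually_elim
      case (elim \<zeta>)
      have "((\<lambda>r. 1 / w (of_real r * \<zeta>) + of_real s) \<longlongrightarrow> 1 / bdry w \<zeta> + of_real s) (at_left 1)"
        by (intro tendsto_intros elim(1,3))
      moreover have "\<forall>\<^sub>F r in at_left 1. 1 / w (of_real r * \<zeta>) + of_real s = 1 / w (g (of_real r * \<zeta>))"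
        using eventually_radius_in_ball[of \<zeta>] elim(5) by (auto elim!: eventually_mono simp: w_def eq)
      ultimately have "((\<lambda>r. 1 / w (g (of_real r * \<zeta>))) \<longlongrightarrow> 1 / bdry w \<zeta> + of_real s) (at_left 1)"
        by (rule Lim_transform_eventually)
      moreover have "((\<lambda>r. 1 / w (g (of_real r * \<zeta>))) \<longlongrightarrow> 1 / bdry w (bmap g \<zeta>)) (at_left 1)"
        by (intro tendsto_intros elim(2,4))
      ultimately have "1 / bdry w (bmap g \<zeta>) = 1 / bdry w \<zeta> + of_real s"
        by (intro tendsto_unique[of "at_left (1::real)"]) auto
      then show ?case by simp
    qed
  qed
qed

end

text \<open>Cowen's model belongs to some Riemann map of \<open>U\<close>; the holomorphic change of Riemann map \<open>m\<close> carries it over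
  to \<open>\<phi>\<close>. In the hyperbolic case the logarithm turns multiplication by \<open>c\<close> into translation by \<open>ln c\<close> and
  maps the upper half-plane into itself.\<close>

lemma (in baker_map) translation_model:
  assumes type: "hyperbolic_type f U \<or> simply_parabolic_type f U"
  shows "\<exists>\<psi> s. \<psi> holomorphic_on ball 0 1 \<and> (\<forall>z. norm z < 1 \<longrightarrow> 0 < Im (\<psi> z)) \<and>
    (\<forall>z. norm z < 1 \<longrightarrow> \<psi> (g z) = \<psi> z + of_real s) \<and> (s = 1 \<or> s = -1)"
proof -
  have transport: "\<exists>\<psi>'. \<psi>' holomorphic_on ball 0 1 \<and> \<psi>' ` ball 0 1 \<subseteq> upper_half_plane \<and>
      (\<forall>z\<in>ball 0 1. \<psi>' (g z) = T (\<psi>' z))"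
    if \<phi>': "riemann_map \<phi>' U" and model: "cowen_model (inner_function f \<phi>') V upper_half_plane \<psi> T" for \<phi>' V \<psi> T
  proof -
    interpret other: baker_map f E U \<phi>' e using K baker \<phi>' e by unfold_locales
    define m where "m z = inv_into (ball 0 1) \<phi>' (\<phi> z)" for z
    have m: "m z \<in> ball 0 1" "\<phi>' (m z) = \<phi> z" if "z \<in> ball 0 1" for z
    proof -
      have "\<phi> z \<in> \<phi>' ` ball 0 1" using that \<phi>_image other.\<phi>_image by blast
      then show "m z \<in> ball 0 1" "\<phi>' (m z) = \<phi> z" unfolding m_def by (rule inv_into_into, rule f_inv_into_f)
    qed
    have mh: "m holomorphic_on ball 0 1"
    proof (rule holomorphic_inverse_compose[OF other.\<Phi>_hol other.\<Phi>_inj _ m(1)])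
      show "(\<lambda>z. other.\<Phi> (m z)) holomorphic_on ball 0 1"
        by (rule holomorphic_transform[OF \<Phi>_hol]) (simp add: \<Phi>_def other.\<Phi>_def m)
    qed
    have comm: "m (g z) = inner_function f \<phi>' (m z)" if "z \<in> ball 0 1" for z
      using that m(2) \<phi>_g[of z] by (simp add: inner_function_def m_def)
    have \<psi>: "\<psi> holomorphic_on ball 0 1" "\<psi> ` ball 0 1 \<subseteq> upper_half_plane"
      "\<And>z. z \<in> ball 0 1 \<Longrightarrow> \<psi> (inner_function f \<phi>' z) = T (\<psi> z)"
      using model by (auto simp: cowen_model_def)
    have "(\<psi> \<circ> m) holomorphic_on ball 0 1"
      by (rule holomorphic_on_compose_gen[OF mh \<psi>(1)]) (use m in auto)
    moreover have "(\<psi> \<circ> m) ` ball 0 1 \<subseteq> upper_half_plane" using m(1) \<psi>(2) by auto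
    moreover have "(\<psi> \<circ> m) (g z) = T ((\<psi> \<circ> m) z)" if "z \<in> ball 0 1" for z
      using \<psi>(3)[OF m(1)[OF that]] comm[OF that] by simp
    ultimately show ?thesis by blast
  qed
  from type show ?thesis
  proof
    assume "hyperbolic_type f U"
    then obtain \<phi>' V \<psi>0 c where h: "riemann_map \<phi>' U" "1 < c"
      "cowen_model (inner_function f \<phi>') V upper_half_plane \<psi>0 (\<lambda>z. complex_of_real c * z)"
      unfolding hyperbolic_type_def hyperbolic_def by blast
    obtain \<psi> where \<psi>: "\<psi> holomorphic_on ball 0 1" "\<psi> ` ball 0 1 \<subseteq> upper_half_plane"
      "\<And>z. z \<in> ball 0 1 \<Longrightarrow> \<psi> (g z) = complex_of_real c * \<psi> z"
      using transport[OF h(1,3)] by blast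
    have im: "0 < Im (\<psi> z)" if "norm z < 1" for z
      using subsetD[OF \<psi>(2), of "\<psi> z"] that by (auto simp: upper_half_plane_def)
    have lc: "0 < ln c" using h(2) by simp
    define L where "L z = Ln (\<psi> z) / of_real (ln c)" for z
    have "\<psi> z \<notin> \<real>\<^sub>\<le>\<^sub>0" if "norm z < 1" for z using im[OF that] by (auto simp: complex_nonpos_Reals_iff)
    then have "L holomorphic_on ball 0 1"
      unfolding L_def using lc by (intro holomorphic_intros \<psi>(1)) auto
    moreover have "0 < Im (L z)" if "norm z < 1" for z
    proof -
      have "0 < Im (Ln (\<psi> z))" using im[OF that] Im_Ln_pos_lt_imp by (metis Im_Ln_pos_lt less_irrefl zero_complex.sel(2) order_less_le)
      then show ?thesis using lc by (simp add: L_def Im_divide_of_real)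
    qed
    moreover have "L (g z) = L z + of_real 1" if "norm z < 1" for z
    proof -
      have "\<psi> z \<noteq> 0" using im[OF that] by auto
      then have "Ln (of_real c * \<psi> z) = of_real (ln c) + Ln (\<psi> z)" using h(2) Ln_times_of_real[of c "\<psi> z"] by (simp add: Ln_of_real)
      then show ?thesis using \<psi>(3)[of z] that lc by (simp add: L_def add_divide_distrib)
    qed
    ultimately show ?thesis by blast
  next
    assume "simply_parabolic_type f U"
    then obtain \<phi>' V \<psi>0 where h0: "riemann_map \<phi>' U"
      "cowen_model (inner_function f \<phi>') V upper_half_plane \<psi>0 (\<lambda>z. z + 1) \<or>
       cowen_model (inner_function f \<phi>') V upper_half_plane \<psi>0 (\<lambda>z. z - 1)"
      unfolding simply_parabolic_type_def simply_parabolic_def by blast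
    then have "cowen_model (inner_function f \<phi>') V upper_half_plane \<psi>0 (\<lambda>z. z + complex_of_real 1) \<or>
       cowen_model (inner_function f \<phi>') V upper_half_plane \<psi>0 (\<lambda>z. z + complex_of_real (-1))" by simp
    then obtain s where h: "riemann_map \<phi>' U" "s = 1 \<or> s = -1"
      "cowen_model (inner_function f \<phi>') V upper_half_plane \<psi>0 (\<lambda>z. z + complex_of_real s)"
      using h0(1) by blast
    obtain \<psi> where \<psi>: "\<psi> holomorphic_on ball 0 1" "\<psi> ` ball 0 1 \<subseteq> upper_half_plane"
      "\<And>z. z \<in> ball 0 1 \<Longrightarrow> \<psi> (g z) = \<psi> z + complex_of_real s"
      using transport[OF h(1,3)] by blast
    have "0 < Im (\<psi> z)" if "norm z < 1" for z
      using subsetD[OF \<psi>(2), of "\<psi> z"] that by (auto simp: upper_half_plane_def)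
    then show ?thesis using \<psi> h(2) by (intro exI[of _ \<psi>] exI[of _ s]) auto
  qed
qed

theorem theoremA:
  fixes f :: "riemann_sphere \<Rightarrow> riemann_sphere" and E U :: "riemann_sphere set"
    and \<phi> :: "complex \<Rightarrow> riemann_sphere"
  assumes "class_K f E"
    and "baker_domain f E U"
    and "simply_connected U"
    and "hyperbolic_type f U \<or> simply_parabolic_type f U"
    and "riemann_map \<phi> U"
  shows "\<not> ergodic (boundary_space f E U \<phi>) f \<and> \<not> recurrent (boundary_space f E U \<phi>) f"
proof -
  obtain e where "e \<in> E" using assms(2) by (auto simp: baker_domain_def)
  then interpret baker_map f E U \<phi> e using assms by unfold_locales
  obtain B R M where B: "B holomorphic_on ball 0 1" "\<forall>z. norm z < 1 \<longrightarrow> norm (B z) \<le> M \<and> \<phi> z = R (B z)"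
    "continuous_on UNIV R" "\<forall>x. finite (R -` {x})"
    using exists_B by blast
  interpret baker_map_bounded f E U \<phi> e B R M
    using B by unfold_locales auto
  show ?thesis
    using translation_model[OF assms(4)] not_ergodic_not_recurrent_of_translation by blast
qed

end
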